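(* For $\varepsilon\in(0,\pi/2)$ let $\Omega_\varepsilon\subset\mathbb S^2$ be the annulus described in polar coordinates $(r,\theta)$ by $\Omega_\varepsilon=\{(r,\theta):\varepsilon<r<\pi-\varepsilon\}$, and let $\Omega_\varepsilon^\star$ be the geodesic disk in $\mathbb S^2$ with the same area as $\Omega_\varepsilon$. Then, as $\varepsilon\to0^+$, $$\mu_2(\Omega_\varepsilon)-\mu_2(\Omega_\varepsilon^\star)=3\varepsilon^4|\log\varepsilon|+o(\varepsilon^4|\log\varepsilon|).$$
   Context: $\mathbb S^2$ is the unit round sphere; polar coordinates $(r,\theta)\in(0,\pi)\times[0,2\pi)$ are based at a fixed point, $r$ being the geodesic distance from it, so the metric is $dr^2+\sin^2 r\,d\theta^2$. For a domain with smooth boundary, $\mu_2$ denotes the first positive eigenvalue of the Neumann Laplacian $\Delta u=\mu u$ with vanishing normal derivative at the boundary, where $\Delta=-\mathrm{div}\,\nabla\ge 0$. *)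

theory Defs
  imports "HOL-Analysis.Analysis" "HOL-Library.Landau_Symbols"
begin

text \<open>
  The unit round sphere is \<^term>\<open>sphere (0 :: real^3) 1\<close> with the induced metric. A function or
  vector field on (part of) the sphere is represented by an extension to an open set of the ambient
  space; the operators below depend, at points of the sphere, only on its restriction to the sphere.
\<close>

abbreviation S2 :: "(real^3) set" where
  "S2 \<equiv> sphere 0 1"

definition geodesic_dist :: "real^3 \<Rightarrow> real^3 \<Rightarrow> real" where
  "geodesic_dist p x = arccos (p \<bullet> x)"

definition annulus :: "real^3 \<Rightarrow> real \<Rightarrow> (real^3) set" where
  "annulus p \<epsilon> = {x \<in> S2. \<epsilon> < geodesic_dist p x \<and> geodesic_dist p x < pi - \<epsilon>}"

definition is_geodesic_disk :: "(real^3) set \<Rightarrow> bool" where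
  "is_geodesic_disk D \<longleftrightarrow>
     (\<exists>q\<in>S2. \<exists>R. 0 < R \<and> R < pi \<and> D = {x \<in> S2. geodesic_dist q x < R})"

text \<open>
  Surface measure on the unit sphere of a three-dimensional space: three times the volume of the
  cone over the set, since the volume element in polar coordinates is \<open>t\<^sup>2 dt dA\<close>.
\<close>

definition sphere_area :: "(real^3) set \<Rightarrow> real" where
  "sphere_area A = 3 * measure lebesgue {t *\<^sub>R x | t x. 0 < t \<and> t \<le> 1 \<and> x \<in> A}"

definition C1_on :: "(real^3) set \<Rightarrow> (real^3 \<Rightarrow> 'b::real_normed_vector) \<Rightarrow> bool" where
  "C1_on W f \<longleftrightarrow> (\<forall>x\<in>W. f differentiable (at x)) \<and>
     (\<forall>h. continuous_on W (\<lambda>x. frechet_derivative f (at x) h))"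

definition grad :: "(real^3 \<Rightarrow> real) \<Rightarrow> real^3 \<Rightarrow> real^3" where
  "grad u x = (\<Sum>b\<in>Basis. frechet_derivative u (at x) b *\<^sub>R b)"

definition C2_on :: "(real^3) set \<Rightarrow> (real^3 \<Rightarrow> real) \<Rightarrow> bool" where
  "C2_on W u \<longleftrightarrow> C1_on W u \<and> C1_on W (grad u)"

text \<open>For a unit vector \<open>x\<close>, the orthogonal projection onto the tangent plane of the sphere at \<open>x\<close>.\<close>

definition tangent_proj :: "real^3 \<Rightarrow> real^3 \<Rightarrow> real^3" where
  "tangent_proj x v = v - (x \<bullet> v) *\<^sub>R x"

definition surface_grad :: "(real^3 \<Rightarrow> real) \<Rightarrow> real^3 \<Rightarrow> real^3" where
  "surface_grad u x = tangent_proj x (grad u x)"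

text \<open>The trace, over the tangent plane at \<open>x\<close>, of the derivative of \<open>V\<close>.\<close>

definition surface_div :: "(real^3 \<Rightarrow> real^3) \<Rightarrow> real^3 \<Rightarrow> real" where
  "surface_div V x = (\<Sum>b\<in>Basis. frechet_derivative V (at x) (tangent_proj x b) \<bullet> b)"

definition sphere_laplacian :: "(real^3 \<Rightarrow> real) \<Rightarrow> real^3 \<Rightarrow> real" where
  "sphere_laplacian u x = - surface_div (surface_grad u) x"

abbreviation sphere_boundary :: "(real^3) set \<Rightarrow> (real^3) set" where
  "sphere_boundary \<Omega> \<equiv> top_of_set S2 frontier_of \<Omega>"

text \<open>
  The outward unit normal to the boundary of \<open>\<Omega>\<close>, tangent to the sphere, read off from a local
  defining function \<open>\<phi>\<close>; it exists and is unique at every regular boundary point.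
\<close>

definition outward_unit_normal :: "(real^3) set \<Rightarrow> real^3 \<Rightarrow> real^3 \<Rightarrow> bool" where
  "outward_unit_normal \<Omega> x \<nu> \<longleftrightarrow>
     (\<exists>W \<phi>. open W \<and> x \<in> W \<and> C1_on W \<phi> \<and> \<phi> x = 0 \<and>
            \<Omega> \<inter> W = {y \<in> S2 \<inter> W. \<phi> y < 0} \<and>
            surface_grad \<phi> x \<noteq> 0 \<and> \<nu> = sgn (surface_grad \<phi> x))"

text \<open>
  Classical eigenfunctions, of class \<open>C\<^sup>2\<close> up to the boundary (on domains with smooth
  boundary this is no restriction, by elliptic regularity).
\<close>

definition neumann_eigenfunction :: "(real^3) set \<Rightarrow> real \<Rightarrow> (real^3 \<Rightarrow> real) \<Rightarrow> bool" where
  "neumann_eigenfunction \<Omega> \<mu> u \<longleftrightarrow>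
     (\<exists>W. open W \<and> closure \<Omega> \<subseteq> W \<and> C2_on W u) \<and>
     (\<exists>x\<in>\<Omega>. u x \<noteq> 0) \<and>
     (\<forall>x\<in>\<Omega>. sphere_laplacian u x = \<mu> * u x) \<and>
     (\<forall>x\<in>sphere_boundary \<Omega>. \<exists>\<nu>. outward_unit_normal \<Omega> x \<nu> \<and> surface_grad u x \<bullet> \<nu> = 0)"

definition neumann_eigenvalue :: "(real^3) set \<Rightarrow> real \<Rightarrow> bool" where
  "neumann_eigenvalue \<Omega> \<mu> \<longleftrightarrow> (\<exists>u. neumann_eigenfunction \<Omega> \<mu> u)"

definition mu2 :: "(real^3) set \<Rightarrow> real" where
  "mu2 \<Omega> = (LEAST \<mu>. 0 < \<mu> \<and> neumann_eigenvalue \<Omega> \<mu>)"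

end

theory Submission
  imports Defs "HOL-Real_Asymp.Real_Asymp"
begin

text \<open>
  On both domains the first positive eigenvalue \<open>2 - \<eta>\<close> belongs to a function \<open>(x \<bullet> e) * g (x \<bullet> p)\<close> with
  \<open>e\<close> orthogonal to the axis \<open>p\<close>: the equation becomes \<open>(1 - z\<^sup>2) g'' - 4 z g' = \<eta> g\<close>, the Neumann condition
  becomes \<open>z g = (1 - z\<^sup>2) g'\<close> at the boundary values of \<open>z\<close>, and \<open>g\<close> is a hypergeometric series, in \<open>z\<^sup>2\<close>
  for the annulus and in \<open>(1 - z) / 2\<close> for the disk. No smaller positive eigenvalue exists: every angular
  Fourier mode of an eigenfunction is compared with the positive function \<open>g\<close> by Picone's identity, and the
  radial mode is first differentiated, which turns it into a Dirichlet solution of the first mode.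

  Let \<open>s = 1 - cos \<epsilon>\<close>. Equality of areas puts the boundary of the disk at \<open>z = 1 - 2 cos \<epsilon> = -1 + 2 s\<close>, that
  of the annulus being at \<open>z = \<plusminus> (1 - s)\<close>. The coefficients of the series are linear in \<open>\<eta>\<close> up to a factor
  \<open>1 + O(\<eta>)\<close>, and the linear part is \<open>A y / (1 - y) - C ln (1 - y)\<close>. Hence the boundary conditions give
  \<open>\<eta> = 6 s - 6 s\<^sup>2 ln s + O(s\<^sup>2)\<close> for the annulus and \<open>\<eta> = 6 s - 12 s\<^sup>2 ln s + O(s\<^sup>2)\<close> for the disk. The
  difference of the eigenvalues is therefore \<open>6 s\<^sup>2 \<bar>ln s\<bar> + O(s\<^sup>2)\<close>, and \<open>s\<close> is asymptotic to \<open>\<epsilon>\<^sup>2 / 2\<close>.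
\<close>

section \<open>The radial profiles as hypergeometric series\<close>

text \<open>On the whole sphere the first positive eigenvalue is 2, with eigenfunctions
  \<open>x \<bullet> e\<close>; this is \<open>\<eta> = 0\<close> with \<open>g = 1\<close>. Each
  removed polar cap of height \<open>t\<close> adds \<open>3 * t - 3 * t\<^sup>2 * ln t\<close> to
  \<open>\<eta>\<close>, up to O(t^2). The annulus lacks two caps of height \<open>s\<close>, the
  disk one cap of height \<open>2 * s\<close>. Equal areas mean equal total heights, so the linear
  terms cancel in the difference and the result sits in the second-order terms: both expansions are
  needed with an error O(s^2). The obstacle is that the series have a pole at \<open>y = 1\<close>,
  which the boundary approaches as \<open>s\<close> tends to 0. Expanding in \<open>\<kappa>\<close>
  at fixed \<open>y\<close> is therefore not enough; the error must be relative, coefficient by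
  coefficient, and uniform in the index. The closed form \<open>A + C / k\<close> of the linearised
  coefficients comes from \<open>\<sigma> = \<gamma> + 1\<close>, which holds in both cases and
  gives \<open>A = 1 / (\<gamma> * (\<gamma> + 1))\<close> and
  \<open>C = 1 / (\<gamma> + 1)\<close>.\<close>

text \<open>
  The power series solution, normalised by the value 1 at 0, of
  \<open>y (1 - y) h'' + (\<gamma> - (\<sigma> + 1) y) h' = \<kappa> h\<close>.
\<close>

definition hyp_coeff :: "real \<Rightarrow> real \<Rightarrow> real \<Rightarrow> nat \<Rightarrow> real" where
  "hyp_coeff \<gamma> \<sigma> \<kappa> k = (\<Prod>j<k. (real j * (real j + \<sigma>) + \<kappa>) / ((real j + 1) * (real j + \<gamma>)))"

definition hyp :: "real \<Rightarrow> real \<Rightarrow> real \<Rightarrow> real \<Rightarrow> real" where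
  "hyp \<gamma> \<sigma> \<kappa> y = (\<Sum>k. hyp_coeff \<gamma> \<sigma> \<kappa> k * y ^ k)"

definition hyp' :: "real \<Rightarrow> real \<Rightarrow> real \<Rightarrow> real \<Rightarrow> real" where
  "hyp' \<gamma> \<sigma> \<kappa> y = (\<Sum>k. diffs (hyp_coeff \<gamma> \<sigma> \<kappa>) k * y ^ k)"

definition hyp'' :: "real \<Rightarrow> real \<Rightarrow> real \<Rightarrow> real \<Rightarrow> real" where
  "hyp'' \<gamma> \<sigma> \<kappa> y = (\<Sum>k. diffs (diffs (hyp_coeff \<gamma> \<sigma> \<kappa>)) k * y ^ k)"

lemma hyp_coeff_Suc:
  assumes "\<gamma> > 0"
  shows "(real k + 1) * (real k + \<gamma>) * hyp_coeff \<gamma> \<sigma> \<kappa> (Suc k) = (real k * (real k + \<sigma>) + \<kappa>) * hyp_coeff \<gamma> \<sigma> \<kappa> k"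
proof -
  have "(real k + 1) * (real k + \<gamma>) \<noteq> 0"
    using assms by (metis add_nonneg_pos less_irrefl mult_eq_0_iff of_nat_0_le_iff zero_less_one)
  moreover have "hyp_coeff \<gamma> \<sigma> \<kappa> (Suc k) = hyp_coeff \<gamma> \<sigma> \<kappa> k * ((real k * (real k + \<sigma>) + \<kappa>) / ((real k + 1) * (real k + \<gamma>)))"
    by (simp add: hyp_coeff_def)
  ultimately show ?thesis by simp
qed

lemma hyp_coeff_nonneg: "\<gamma> > 0 \<Longrightarrow> \<sigma> \<ge> 0 \<Longrightarrow> \<kappa> \<ge> 0 \<Longrightarrow> hyp_coeff \<gamma> \<sigma> \<kappa> k \<ge> 0"
  unfolding hyp_coeff_def by (intro prod_nonneg) auto

text \<open>Generating function of \<open>A + C / k\<close> over \<open>k \<ge> 1\<close>, with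
  \<open>log_major'\<close> its derivative in \<open>y\<close>. The pole at \<open>y = 1\<close>
  yields the leading terms of the boundary conditions, the logarithm those with
  \<open>ln s\<close>.\<close>

definition log_major :: "real \<Rightarrow> real \<Rightarrow> real \<Rightarrow> real" where
  "log_major A C y = A * y / (1 - y) - C * ln (1 - y)"

definition log_major' :: "real \<Rightarrow> real \<Rightarrow> real \<Rightarrow> real" where
  "log_major' A C y = A / (1 - y)\<^sup>2 + C / (1 - y)"

lemma log_major'_sums:
  fixes y :: real assumes "\<bar>y\<bar> < 1"
  shows "(\<lambda>k. (A * real (Suc k) + C) * y ^ k) sums log_major' A C y"
proof -
  have "(\<lambda>k. A * (of_nat (Suc k) * y ^ k) + C * y ^ k) sums (A * (1 / (1 - y)\<^sup>2) + C * (1 / (1 - y)))"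
    using assms by (intro sums_add sums_mult geometric_deriv_sums geometric_sums) auto
  then show ?thesis by (simp add: log_major'_def algebra_simps)
qed

lemma log_major_sums:
  fixes y :: real assumes "\<bar>y\<bar> < 1"
  shows "(\<lambda>k. (A + C / real (Suc k)) * y ^ Suc k) sums log_major A C y"
proof -
  have "(\<lambda>n. - (y ^ n / of_nat n)) sums ln (1 - y)"
    using ln_series'[of "- y"] assms by simp
  from sums_minus[OF this] have "(\<lambda>n. y ^ n / of_nat n) sums (- ln (1 - y))"
    by simp
  then have "(\<lambda>n. y ^ Suc n / of_nat (Suc n)) sums (- ln (1 - y))"
    by (subst sums_Suc_iff) simp
  note l = this
  have g: "(\<lambda>n. y * y ^ n) sums (y * (1 / (1 - y)))"
    using assms by (intro sums_mult geometric_sums) auto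
  have "(\<lambda>n. A * (y * y ^ n) + C * (y ^ Suc n / of_nat (Suc n))) sums (A * (y * (1 / (1 - y))) + C * (- ln (1 - y)))"
    by (rule sums_add[OF sums_mult[OF g] sums_mult[OF l]])
  then show ?thesis by (simp add: log_major_def algebra_simps)
qed

text \<open>
  The numbers \<open>A + C / k\<close> satisfy the recursion of the coefficients at \<open>\<kappa> = 0\<close>, with the first one equal to
  \<open>1 / \<gamma>\<close>: they are the derivatives of the coefficients with respect to \<open>\<kappa>\<close> at \<open>\<kappa> = 0\<close>.
\<close>

locale log_hyp =
  fixes \<gamma> \<sigma> A C :: real
  assumes \<gamma>: "\<gamma> > 0" and \<sigma>: "\<sigma> \<ge> 1" and A: "A \<ge> 0" and C: "C \<ge> 0"
    and first: "(A + C) * \<gamma> = 1"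
    and step: "\<And>k::nat. k \<ge> 1 \<Longrightarrow> (real k + 1) * (real k + \<gamma>) * (A + C / (real k + 1)) = real k * (real k + \<sigma>) * (A + C / real k)"
begin

text \<open>Dropping \<open>\<kappa>\<close> from the numerators of the recursion gives the lower
  bound. For the upper one, each step costs a factor
  \<open>1 + \<kappa> / (n * (n + \<sigma>))\<close>, which is at most
  \<open>exp (\<kappa> / (n * (n + 1)))\<close> because \<open>\<sigma> \<ge> 1\<close>; the
  exponents telescope and stay below \<open>\<kappa>\<close>.\<close>

lemma coeff_bounds:
  assumes \<kappa>: "\<kappa> \<ge> 0"
  shows "\<kappa> * (A + C / real (Suc k)) \<le> hyp_coeff \<gamma> \<sigma> \<kappa> (Suc k)"
    and "hyp_coeff \<gamma> \<sigma> \<kappa> (Suc k) \<le> exp (\<kappa> * (1 - 1 / real (Suc k))) * (\<kappa> * (A + C / real (Suc k)))"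
proof (induction k)
  case 0
  have "1 / \<gamma> = A + C" using first \<gamma> by (simp add: field_simps)
  then have "hyp_coeff \<gamma> \<sigma> \<kappa> (Suc 0) = \<kappa> * (A + C)"
    by (simp add: hyp_coeff_def divide_inverse)
  then show "\<kappa> * (A + C / real (Suc 0)) \<le> hyp_coeff \<gamma> \<sigma> \<kappa> (Suc 0)"
    and "hyp_coeff \<gamma> \<sigma> \<kappa> (Suc 0) \<le> exp (\<kappa> * (1 - 1 / real (Suc 0))) * (\<kappa> * (A + C / real (Suc 0)))"
    by simp_all
next
  case (Suc k)
  define n where "n = real (Suc k)"
  have n: "n \<ge> 1" by (simp add: n_def)
  define B where "B = A + C / n"
  define B' where "B' = A + C / (n + 1)"
  define X where "X = hyp_coeff \<gamma> \<sigma> \<kappa> (Suc k)"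
  define Y where "Y = hyp_coeff \<gamma> \<sigma> \<kappa> (Suc (Suc k))"
  have Bs: "(n + 1) * (n + \<gamma>) * B' = n * (n + \<sigma>) * B"
    using step[of "Suc k"] by (simp add: n_def B_def B'_def)
  have XY: "(n + 1) * (n + \<gamma>) * Y = (n * (n + \<sigma>) + \<kappa>) * X"
    using hyp_coeff_Suc[OF \<gamma>, of "Suc k"] by (simp add: n_def X_def Y_def)
  have pos: "(n + 1) * (n + \<gamma>) > 0" using n \<gamma> by simp
  have B0: "B \<ge> 0" using A C n by (simp add: B_def)
  have B'0: "B' \<ge> 0" using A C n by (simp add: B'_def)
  have l: "\<kappa> * B \<le> X" and u: "X \<le> exp (\<kappa> * (1 - 1 / n)) * (\<kappa> * B)"
    using Suc.IH by (simp_all add: n_def B_def X_def)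
  have X0: "X \<ge> 0" using l \<kappa> B0 by (meson mult_nonneg_nonneg order_trans)
  have "(n + 1) * (n + \<gamma>) * (\<kappa> * B') = n * (n + \<sigma>) * (\<kappa> * B)"
    using Bs by (metis mult.assoc mult.left_commute)
  also have "\<dots> \<le> n * (n + \<sigma>) * X" using l n \<sigma> by (intro mult_left_mono) auto
  also have "\<dots> \<le> (n * (n + \<sigma>) + \<kappa>) * X" using \<kappa> X0 by (intro mult_right_mono) auto
  also have "\<dots> = (n + 1) * (n + \<gamma>) * Y" using XY by simp
  finally have L: "\<kappa> * B' \<le> Y" using pos mult_le_cancel_left_pos by blast
  have ns: "n * (n + \<sigma>) > 0" using n \<sigma> by simp
  have "(n * (n + \<sigma>) + \<kappa>) = n * (n + \<sigma>) * (1 + \<kappa> / (n * (n + \<sigma>)))"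
    using ns by (simp only: distrib_left nonzero_mult_div_cancel_left times_divide_eq_right) simp
  also have "\<dots> \<le> n * (n + \<sigma>) * exp (\<kappa> / (n * (n + \<sigma>)))"
    using ns by (intro mult_left_mono exp_ge_add_one_self) auto
  also have "\<dots> \<le> n * (n + \<sigma>) * exp (\<kappa> / (n * (n + 1)))"
    using ns n \<sigma> \<kappa> by (intro mult_left_mono) (auto intro!: divide_left_mono mult_left_mono)
  finally have r: "n * (n + \<sigma>) + \<kappa> \<le> n * (n + \<sigma>) * exp (\<kappa> / (n * (n + 1)))" .
  have "(n + 1) * (n + \<gamma>) * Y = (n * (n + \<sigma>) + \<kappa>) * X" using XY by simp
  also have "\<dots> \<le> n * (n + \<sigma>) * exp (\<kappa> / (n * (n + 1))) * (exp (\<kappa> * (1 - 1 / n)) * (\<kappa> * B))"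
    using r u X0 ns by (intro mult_mono) auto
  also have "\<dots> = exp (\<kappa> / (n * (n + 1)) + \<kappa> * (1 - 1 / n)) * (\<kappa> * (n * (n + \<sigma>) * B))"
    by (simp only: exp_add mult_ac)
  also have "\<kappa> / (n * (n + 1)) + \<kappa> * (1 - 1 / n) = \<kappa> * (1 - 1 / (n + 1))"
  proof -
    have "1 / (n * (n + 1)) = 1 / n - 1 / (n + 1)" using n by (simp add: divide_simps)
    then have "\<kappa> / (n * (n + 1)) = \<kappa> * (1 / n - 1 / (n + 1))" by (metis times_divide_eq_right mult.right_neutral)
    then show ?thesis by (simp only: right_diff_distrib)
  qed
  also have "exp (\<kappa> * (1 - 1 / (n + 1))) * (\<kappa> * (n * (n + \<sigma>) * B)) = (n + 1) * (n + \<gamma>) * (exp (\<kappa> * (1 - 1 / (n + 1))) * (\<kappa> * B'))"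
    using Bs by (metis mult.assoc mult.left_commute)
  finally have U: "Y \<le> exp (\<kappa> * (1 - 1 / (n + 1))) * (\<kappa> * B')"
    using pos mult_le_cancel_left_pos by blast
  have e: "real (Suc (Suc k)) = n + 1" by (simp add: n_def)
  show "\<kappa> * (A + C / real (Suc (Suc k))) \<le> hyp_coeff \<gamma> \<sigma> \<kappa> (Suc (Suc k))"
    using L unfolding e B'_def Y_def .
  show "hyp_coeff \<gamma> \<sigma> \<kappa> (Suc (Suc k)) \<le> exp (\<kappa> * (1 - 1 / real (Suc (Suc k)))) * (\<kappa> * (A + C / real (Suc (Suc k))))"
    using U unfolding e B'_def Y_def .
qed

lemma coeff_upper:
  assumes "\<kappa> \<ge> 0"
  shows "hyp_coeff \<gamma> \<sigma> \<kappa> (Suc k) \<le> exp \<kappa> * (\<kappa> * (A + C / real (Suc k)))"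
proof -
  have "\<kappa> * (1 - 1 / real (Suc k)) \<le> \<kappa> * 1" using assms by (intro mult_left_mono) auto
  then have "exp (\<kappa> * (1 - 1 / real (Suc k))) * (\<kappa> * (A + C / real (Suc k))) \<le> exp \<kappa> * (\<kappa> * (A + C / real (Suc k)))"
    using assms A C by (intro mult_right_mono) auto
  then show ?thesis using coeff_bounds(2)[OF assms, of k] by linarith
qed

text \<open>Being free of \<open>\<kappa>\<close> and \<open>k\<close>, this bound gives both
  convergence for \<open>\<bar>y\<bar> < 1\<close> and the majorant of the M-test in
  \<open>continuous_on_hyp\<close>.\<close>

lemma abs_coeff_le:
  assumes "0 \<le> \<kappa>" "\<kappa> \<le> 1"
  shows "\<bar>hyp_coeff \<gamma> \<sigma> \<kappa> k\<bar> \<le> 1 + exp 1 * (A + C)"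
proof (cases k)
  case 0 then show ?thesis using A C by (simp add: hyp_coeff_def)
next
  case (Suc j)
  have "exp \<kappa> * (\<kappa> * (A + C / real (Suc j))) \<le> exp 1 * (1 * (A + C))"
    using assms A C frac_le[of C C 1 "real (Suc j)"] by (intro mult_mono add_mono) (auto intro!: add_nonneg_nonneg mult_nonneg_nonneg)
  then show ?thesis
    using coeff_upper[OF assms(1), of j] Suc hyp_coeff_nonneg[OF \<gamma> _ assms(1), of \<sigma> k] \<sigma> by auto
qed

lemma summable_coeff:
  assumes "0 \<le> \<kappa>" "\<kappa> \<le> 1" "norm (y::real) < 1"
  shows "summable (\<lambda>k. hyp_coeff \<gamma> \<sigma> \<kappa> k * y ^ k)"
proof (rule summable_comparison_test')
  show "summable (\<lambda>k. (1 + exp 1 * (A + C)) * norm y ^ k)"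
    using assms by (intro summable_mult summable_geometric) auto
  show "norm (hyp_coeff \<gamma> \<sigma> \<kappa> k * y ^ k) \<le> (1 + exp 1 * (A + C)) * norm y ^ k" for k
    using abs_coeff_le[OF assms(1,2), of k] by (auto simp: abs_mult power_abs intro!: mult_right_mono)
qed

section \<open>Derivatives, differential equation and two-sided bounds of the series\<close>

context
  fixes \<kappa> :: real assumes \<kappa>: "0 \<le> \<kappa>" "\<kappa> \<le> 1"
begin

lemma summable_diffs:
  assumes "norm (y::real) < 1"
  shows "summable (\<lambda>k. diffs (hyp_coeff \<gamma> \<sigma> \<kappa>) k * y ^ k)"
  using termdiff_converges[of y 1 "hyp_coeff \<gamma> \<sigma> \<kappa>"] assms summable_coeff[OF \<kappa>] by simp

lemma summable_diffs_diffs: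
  assumes "norm (y::real) < 1"
  shows "summable (\<lambda>k. diffs (diffs (hyp_coeff \<gamma> \<sigma> \<kappa>)) k * y ^ k)"
  using termdiff_converges[of y 1 "diffs (hyp_coeff \<gamma> \<sigma> \<kappa>)"] assms summable_diffs by simp

lemma DERIV_hyp: "\<bar>y\<bar> < 1 \<Longrightarrow> (hyp \<gamma> \<sigma> \<kappa> has_real_derivative hyp' \<gamma> \<sigma> \<kappa> y) (at y)"
  unfolding hyp_def[abs_def] hyp'_def
  using termdiffs_strong'[of 1 "hyp_coeff \<gamma> \<sigma> \<kappa>" y] summable_coeff[OF \<kappa>] by simp

lemma DERIV_hyp': "\<bar>y\<bar> < 1 \<Longrightarrow> (hyp' \<gamma> \<sigma> \<kappa> has_real_derivative hyp'' \<gamma> \<sigma> \<kappa> y) (at y)"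
  unfolding hyp'_def[abs_def] hyp''_def
  using termdiffs_strong'[of 1 "diffs (hyp_coeff \<gamma> \<sigma> \<kappa>)" y] summable_diffs by simp

lemma isCont_hyp'':
  assumes "\<bar>y\<bar> < 1" shows "isCont (hyp'' \<gamma> \<sigma> \<kappa>) y"
  unfolding hyp''_def[abs_def]
  using termdiffs_strong'[of 1 "diffs (diffs (hyp_coeff \<gamma> \<sigma> \<kappa>))" y] summable_diffs_diffs assms
  by (auto intro: DERIV_isCont)

text \<open>All terms are expanded in the same powers \<open>y ^ n\<close>; the vanishing of each
  coefficient is then the recursion \<open>hyp_coeff_Suc\<close>.\<close>

lemma hyp_ode:
  assumes y: "\<bar>y\<bar> < 1"
  shows "y * (1 - y) * hyp'' \<gamma> \<sigma> \<kappa> y + (\<gamma> - (\<sigma> + 1) * y) * hyp' \<gamma> \<sigma> \<kappa> y = \<kappa> * hyp \<gamma> \<sigma> \<kappa> y"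
proof -
  let ?c = "hyp_coeff \<gamma> \<sigma> \<kappa>"
  have yn: "norm y < 1" using y by simp
  have h: "(\<lambda>n. ?c n * y ^ n) sums hyp \<gamma> \<sigma> \<kappa> y"
    unfolding hyp_def using summable_coeff[OF \<kappa> yn] by (rule summable_sums)
  have h1: "(\<lambda>n. diffs ?c n * y ^ n) sums hyp' \<gamma> \<sigma> \<kappa> y"
    unfolding hyp'_def using summable_diffs[OF yn] by (rule summable_sums)
  have yh1: "(\<lambda>n. real n * ?c n * y ^ n) sums (y * hyp' \<gamma> \<sigma> \<kappa> y)"
  proof -
    have "(\<lambda>n. y * (real n * ?c n * y ^ (n - Suc 0))) sums (y * hyp' \<gamma> \<sigma> \<kappa> y)"
      unfolding hyp'_def using diffs_equiv[OF summable_diffs[OF yn]] by (rule sums_mult)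
    moreover have "y * (real n * ?c n * y ^ (n - Suc 0)) = real n * ?c n * y ^ n" for n
      by (cases n) auto
    ultimately show ?thesis by simp
  qed
  have yh2: "(\<lambda>n. real n * diffs ?c n * y ^ n) sums (y * hyp'' \<gamma> \<sigma> \<kappa> y)"
  proof -
    have "(\<lambda>n. y * (real n * diffs ?c n * y ^ (n - Suc 0))) sums (y * hyp'' \<gamma> \<sigma> \<kappa> y)"
      unfolding hyp''_def using diffs_equiv[OF summable_diffs_diffs[OF yn]] by (rule sums_mult)
    moreover have "y * (real n * diffs ?c n * y ^ (n - Suc 0)) = real n * diffs ?c n * y ^ n" for n
      by (cases n) auto
    ultimately show ?thesis by simp
  qed
  have yyh2: "(\<lambda>n. real n * (real n - 1) * ?c n * y ^ n) sums (y * (y * hyp'' \<gamma> \<sigma> \<kappa> y))"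
  proof -
    have "(\<lambda>n. y * (real n * diffs ?c n * y ^ n)) sums (y * (y * hyp'' \<gamma> \<sigma> \<kappa> y))"
      using yh2 by (rule sums_mult)
    then have "(\<lambda>n. real (Suc n) * (real (Suc n) - 1) * ?c (Suc n) * y ^ Suc n) sums (y * (y * hyp'' \<gamma> \<sigma> \<kappa> y))"
      by (simp add: diffs_def algebra_simps)
    \<comment> \<open>The term at \<open>n = 0\<close> vanishes, so shifting the index loses
      nothing.\<close>
    then show ?thesis by (subst (asm) sums_Suc_iff) simp
  qed
  have "(\<lambda>n. real n * diffs ?c n * y ^ n - real n * (real n - 1) * ?c n * y ^ n + \<gamma> * (diffs ?c n * y ^ n)
          - (\<sigma> + 1) * (real n * ?c n * y ^ n) - \<kappa> * (?c n * y ^ n)) sums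
        (y * hyp'' \<gamma> \<sigma> \<kappa> y - y * (y * hyp'' \<gamma> \<sigma> \<kappa> y) + \<gamma> * hyp' \<gamma> \<sigma> \<kappa> y - (\<sigma> + 1) * (y * hyp' \<gamma> \<sigma> \<kappa> y) - \<kappa> * hyp \<gamma> \<sigma> \<kappa> y)"
    by (intro sums_add sums_diff sums_mult h h1 yh1 yh2 yyh2)
  moreover have "real n * diffs ?c n * y ^ n - real n * (real n - 1) * ?c n * y ^ n + \<gamma> * (diffs ?c n * y ^ n)
          - (\<sigma> + 1) * (real n * ?c n * y ^ n) - \<kappa> * (?c n * y ^ n) = 0" for n
  proof -
    have "real n * diffs ?c n * y ^ n - real n * (real n - 1) * ?c n * y ^ n + \<gamma> * (diffs ?c n * y ^ n)
          - (\<sigma> + 1) * (real n * ?c n * y ^ n) - \<kappa> * (?c n * y ^ n)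
        = ((real n + 1) * (real n + \<gamma>) * ?c (Suc n) - (real n * (real n + \<sigma>) + \<kappa>) * ?c n) * y ^ n"
      by (simp add: diffs_def algebra_simps)
    then show ?thesis using hyp_coeff_Suc[OF \<gamma>, of n \<sigma> \<kappa>] by simp
  qed
  ultimately have "(\<lambda>n::nat. 0::real) sums
     (y * hyp'' \<gamma> \<sigma> \<kappa> y - y * (y * hyp'' \<gamma> \<sigma> \<kappa> y) + \<gamma> * hyp' \<gamma> \<sigma> \<kappa> y - (\<sigma> + 1) * (y * hyp' \<gamma> \<sigma> \<kappa> y) - \<kappa> * hyp \<gamma> \<sigma> \<kappa> y)"
    by simp
  then have "y * hyp'' \<gamma> \<sigma> \<kappa> y - y * (y * hyp'' \<gamma> \<sigma> \<kappa> y) + \<gamma> * hyp' \<gamma> \<sigma> \<kappa> y - (\<sigma> + 1) * (y * hyp' \<gamma> \<sigma> \<kappa> y) - \<kappa> * hyp \<gamma> \<sigma> \<kappa> y = 0"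
    using sums_unique2 sums_zero by blast
  then show ?thesis by (simp add: algebra_simps)
qed

text \<open>For \<open>y \<ge> 0\<close> the coefficient bounds can be summed termwise. The two
  bounds for the deviation from the value at \<open>\<kappa> = 0\<close> differ by the factor
  \<open>exp \<kappa>\<close> alone, uniformly in \<open>y\<close>; so \<open>y\<close> may tend to
  1 while \<open>\<kappa>\<close> tends to 0.\<close>

lemma
  assumes y: "0 \<le> y" "y < 1"
  shows hyp_lower: "1 + \<kappa> * log_major A C y \<le> hyp \<gamma> \<sigma> \<kappa> y"
    and hyp_upper: "hyp \<gamma> \<sigma> \<kappa> y \<le> 1 + \<kappa> * exp \<kappa> * log_major A C y"
    and hyp'_lower: "\<kappa> * log_major' A C y \<le> hyp' \<gamma> \<sigma> \<kappa> y"
    and hyp'_upper: "hyp' \<gamma> \<sigma> \<kappa> y \<le> \<kappa> * exp \<kappa> * log_major' A C y"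
proof -
  let ?c = "hyp_coeff \<gamma> \<sigma> \<kappa>"
  have yn: "norm y < 1" "\<bar>y\<bar> < 1" using y by auto
  have h: "(\<lambda>n. ?c (Suc n) * y ^ Suc n) sums (hyp \<gamma> \<sigma> \<kappa> y - 1)"
  proof (subst sums_Suc_iff)
    show "(\<lambda>n. ?c n * y ^ n) sums (hyp \<gamma> \<sigma> \<kappa> y - 1 + ?c 0 * y ^ 0)"
      unfolding hyp_def using summable_sums[OF summable_coeff[OF \<kappa> yn(1)]] by (simp add: hyp_coeff_def)
  qed
  have h1: "(\<lambda>n. diffs ?c n * y ^ n) sums hyp' \<gamma> \<sigma> \<kappa> y"
    unfolding hyp'_def using summable_diffs[OF yn(1)] by (rule summable_sums)
  note lo = coeff_bounds(1)[OF \<kappa>(1)] and up = coeff_upper[OF \<kappa>(1)]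
  have "\<kappa> * log_major A C y \<le> hyp \<gamma> \<sigma> \<kappa> y - 1"
  proof (rule sums_le[OF _ sums_mult[OF log_major_sums[OF yn(2)]] h])
    show "\<kappa> * ((A + C / real (Suc n)) * y ^ Suc n) \<le> ?c (Suc n) * y ^ Suc n" for n
      using mult_right_mono[OF lo[of n], of "y ^ Suc n"] y by (simp add: mult.assoc)
  qed
  then show "1 + \<kappa> * log_major A C y \<le> hyp \<gamma> \<sigma> \<kappa> y" by simp
  have "hyp \<gamma> \<sigma> \<kappa> y - 1 \<le> (\<kappa> * exp \<kappa>) * log_major A C y"
  proof (rule sums_le[OF _ h sums_mult[OF log_major_sums[OF yn(2)]]])
    show "?c (Suc n) * y ^ Suc n \<le> \<kappa> * exp \<kappa> * ((A + C / real (Suc n)) * y ^ Suc n)" for n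
      using mult_right_mono[OF up[of n], of "y ^ Suc n"] y by (simp add: algebra_simps)
  qed
  then show "hyp \<gamma> \<sigma> \<kappa> y \<le> 1 + \<kappa> * exp \<kappa> * log_major A C y" by simp
  have d: "diffs ?c n = real (Suc n) * ?c (Suc n)" for n by (simp add: diffs_def)
  have e: "A * real (Suc n) + C = real (Suc n) * (A + C / real (Suc n))" for n
    by (simp add: field_simps)
  show "\<kappa> * log_major' A C y \<le> hyp' \<gamma> \<sigma> \<kappa> y"
  proof (rule sums_le[OF _ sums_mult[OF log_major'_sums[OF yn(2)]] h1])
    show "\<kappa> * ((A * real (Suc n) + C) * y ^ n) \<le> diffs ?c n * y ^ n" for n
      unfolding d e
      using mult_right_mono[OF mult_left_mono[OF lo[of n], of "real (Suc n)"], of "y ^ n"] y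
      by (simp add: algebra_simps del: of_nat_Suc)
  qed
  show "hyp' \<gamma> \<sigma> \<kappa> y \<le> \<kappa> * exp \<kappa> * log_major' A C y"
  proof (rule sums_le[OF _ h1 sums_mult[OF log_major'_sums[OF yn(2)]]])
    show "diffs ?c n * y ^ n \<le> \<kappa> * exp \<kappa> * ((A * real (Suc n) + C) * y ^ n)" for n
      unfolding d e
      using mult_right_mono[OF mult_left_mono[OF up[of n], of "real (Suc n)"], of "y ^ n"] y
      by (simp add: algebra_simps del: of_nat_Suc)
  qed
qed

lemma hyp_pos:
  assumes y: "0 \<le> y" "y < 1"
  shows "hyp \<gamma> \<sigma> \<kappa> y > 0"
proof -
  have "ln (1 - y) \<le> 0" using y by simp
  then have "C * ln (1 - y) \<le> 0" "A * y / (1 - y) \<ge> 0" using A C y by (auto simp: mult_nonneg_nonpos)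
  then have "log_major A C y \<ge> 0" unfolding log_major_def by linarith
  then have "\<kappa> * log_major A C y \<ge> 0" using \<kappa> by simp
  then show ?thesis using hyp_lower[OF y] by linarith
qed

end

text \<open>The partial sums are polynomials in \<open>\<kappa>\<close> and converge uniformly. The
  boundary conditions are later solved for \<open>\<kappa>\<close> at fixed \<open>y\<close> by the
  intermediate value theorem, which rests on this.\<close>

lemma
  assumes y: "\<bar>y\<bar> < 1"
  shows continuous_on_hyp: "continuous_on {0..1} (\<lambda>\<kappa>. hyp \<gamma> \<sigma> \<kappa> y)"
    and continuous_on_hyp': "continuous_on {0..1} (\<lambda>\<kappa>. hyp' \<gamma> \<sigma> \<kappa> y)"
proof -
  let ?M = "1 + exp 1 * (A + C)"
  have cont: "continuous_on {0..1} (\<lambda>\<kappa>. hyp_coeff \<gamma> \<sigma> \<kappa> k)" for k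
  proof -
    have "(real j + 1) * (real j + \<gamma>) \<noteq> 0" for j
      using \<gamma> by (metis add_nonneg_pos less_irrefl mult_eq_0_iff of_nat_0_le_iff zero_less_one)
    then show ?thesis unfolding hyp_coeff_def by (auto intro!: continuous_intros)
  qed
  have "uniform_limit {0..1} (\<lambda>n \<kappa>. \<Sum>k<n. hyp_coeff \<gamma> \<sigma> \<kappa> k * y ^ k) (\<lambda>\<kappa>. hyp \<gamma> \<sigma> \<kappa> y) sequentially"
    unfolding hyp_def
  proof (rule Weierstrass_m_test)
    show "norm (hyp_coeff \<gamma> \<sigma> \<kappa> k * y ^ k) \<le> ?M * \<bar>y\<bar> ^ k" if "\<kappa> \<in> {0..1}" for \<kappa> k
      using abs_coeff_le[of \<kappa> k] that by (auto simp: abs_mult power_abs intro!: mult_right_mono)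
    show "summable (\<lambda>k. ?M * \<bar>y\<bar> ^ k)"
      using y by (intro summable_mult summable_geometric) auto
  qed
  then show "continuous_on {0..1} (\<lambda>\<kappa>. hyp \<gamma> \<sigma> \<kappa> y)"
    by (rule uniform_limit_theorem[rotated]) (auto intro!: continuous_intros cont always_eventually)
  have "uniform_limit {0..1} (\<lambda>n \<kappa>. \<Sum>k<n. diffs (hyp_coeff \<gamma> \<sigma> \<kappa>) k * y ^ k) (\<lambda>\<kappa>. hyp' \<gamma> \<sigma> \<kappa> y) sequentially"
    unfolding hyp'_def
  proof (rule Weierstrass_m_test)
    show "norm (diffs (hyp_coeff \<gamma> \<sigma> \<kappa>) k * y ^ k) \<le> ?M * (real (Suc k) * \<bar>y\<bar> ^ k)" if "\<kappa> \<in> {0..1}" for \<kappa> k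
    proof -
      have "\<bar>hyp_coeff \<gamma> \<sigma> \<kappa> (Suc k)\<bar> * (real (Suc k) * \<bar>y\<bar> ^ k) \<le> ?M * (real (Suc k) * \<bar>y\<bar> ^ k)"
        using abs_coeff_le[of \<kappa> "Suc k"] that by (intro mult_right_mono) auto
      then show ?thesis by (simp add: diffs_def abs_mult power_abs mult_ac)
    qed
    show "summable (\<lambda>k. ?M * (real (Suc k) * \<bar>y\<bar> ^ k))"
      using geometric_deriv_sums[of "\<bar>y\<bar>"] y by (intro summable_mult) (auto dest: sums_summable)
  qed
  then show "continuous_on {0..1} (\<lambda>\<kappa>. hyp' \<gamma> \<sigma> \<kappa> y)"
    by (rule uniform_limit_theorem[rotated]) (auto intro!: continuous_intros cont always_eventually simp: diffs_def)
qed

end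

text \<open>
  Substituting \<open>y = z\<^sup>2\<close> in \<open>(1 - z\<^sup>2) g'' - 4 z g' = \<eta> g\<close> gives \<open>\<gamma> = 1/2\<close>, \<open>\<sigma> = 3/2\<close> and \<open>\<kappa> = \<eta> / 4\<close>;
  substituting \<open>y = (1 - z) / 2\<close> gives \<open>\<gamma> = 2\<close>, \<open>\<sigma> = 3\<close> and \<open>\<kappa> = \<eta>\<close>.
\<close>

interpretation annulus: log_hyp "1/2" "3/2" "4/3" "2/3"
  by unfold_locales (auto simp: field_simps)

interpretation disk: log_hyp 2 3 "1/6" "1/3"
  by unfold_locales (auto simp: field_simps)

section \<open>Comparison of modes and completeness of the Fourier system\<close>

text \<open>
  Here \<open>q = sin r * f'\<close>, and \<open>K = sin r * F' / F\<close> for a positive solution \<open>F\<close> of the equation with \<open>l = 1\<close> and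
  \<open>\<nu>\<close> in place of \<open>\<mu>\<close>. The function \<open>f q - f\<^sup>2 K\<close> has nonnegative derivative and vanishes at both ends.
\<close>

lemma picone_vanish:
  fixes f q K :: "real \<Rightarrow> real"
  assumes I: "0 \<le> \<alpha>" "\<beta> \<le> pi"
    and cont: "continuous_on {\<alpha>..\<beta>} f" "continuous_on {\<alpha>..\<beta>} q" "continuous_on {\<alpha>..\<beta>} K"
    and f: "\<And>r. \<alpha> < r \<Longrightarrow> r < \<beta> \<Longrightarrow> (f has_real_derivative q r / sin r) (at r)"
    and q: "\<And>r. \<alpha> < r \<Longrightarrow> r < \<beta> \<Longrightarrow> (q has_real_derivative l * f r / sin r - \<mu> * sin r * f r) (at r)"
    and K: "\<And>r. \<alpha> < r \<Longrightarrow> r < \<beta> \<Longrightarrow> (K has_real_derivative (1 - (K r)\<^sup>2) / sin r - \<nu> * sin r) (at r)"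
    and l: "l \<ge> 1" and \<mu>: "\<mu> < \<nu>"
    and ends: "f \<alpha> = 0 \<or> q \<alpha> = 0 \<and> K \<alpha> = 0" "f \<beta> = 0 \<or> q \<beta> = 0 \<and> K \<beta> = 0"
    and r: "\<alpha> < r" "r < \<beta>"
  shows "f r = 0"
proof -
  define W where "W = (\<lambda>r. f r * q r - (f r)\<^sup>2 * K r)"
  \<comment> \<open>The derivative of \<open>W\<close>: after inserting the three equations, the
    terms with \<open>K\<close> complete a square.\<close>
  define D where "D = (\<lambda>r. (l - 1) * (f r)\<^sup>2 / sin r + (\<nu> - \<mu>) * sin r * (f r)\<^sup>2 + (q r - K r * f r)\<^sup>2 / sin r)"
  have sin: "sin t > 0" if "\<alpha> < t" "t < \<beta>" for t
    using that I by (intro sin_gt_zero) auto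
  have W': "(W has_real_derivative D t) (at t)" if "\<alpha> < t" "t < \<beta>" for t
  proof -
    have "(W has_real_derivative q t / sin t * q t + (l * f t / sin t - \<mu> * sin t * f t) * f t -
        (2 * f t * (q t / sin t) * K t + ((1 - (K t)\<^sup>2) / sin t - \<nu> * sin t) * (f t)\<^sup>2)) (at t)"
      unfolding W_def power2_eq_square
      by (rule DERIV_cong, rule DERIV_diff[OF DERIV_mult[OF f[OF that] q[OF that]] DERIV_mult[OF DERIV_mult[OF f[OF that] f[OF that]] K[OF that]]])
        (simp add: algebra_simps power2_eq_square)
    moreover have "q t / sin t * q t + (l * f t / sin t - \<mu> * sin t * f t) * f t -
        (2 * f t * (q t / sin t) * K t + ((1 - (K t)\<^sup>2) / sin t - \<nu> * sin t) * (f t)\<^sup>2) = D t"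
    proof -
      define S F Q k where "S = sin t" and "F = f t" and "Q = q t" and "k = K t"
      have S: "S \<noteq> 0" using sin[OF that] by (simp add: S_def)
      have "Q / S * Q + (l * F / S - \<mu> * S * F) * F - (2 * F * (Q / S) * k + ((1 - k\<^sup>2) / S - \<nu> * S) * F\<^sup>2)
          - ((l - 1) * F\<^sup>2 / S + (\<nu> - \<mu>) * S * F\<^sup>2 + (Q - k * F)\<^sup>2 / S) =
         (Q * Q + l * F * F - 2 * F * Q * k - (1 - k\<^sup>2) * F\<^sup>2 - (l - 1) * F\<^sup>2 - (Q - k * F)\<^sup>2) / S
          - \<mu> * S * F * F + \<nu> * S * F\<^sup>2 - (\<nu> - \<mu>) * S * F\<^sup>2"
        by (simp add: add_divide_distrib diff_divide_distrib algebra_simps)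
      also have "\<dots> = 0" by (simp add: algebra_simps power2_eq_square)
      finally show ?thesis unfolding D_def S_def F_def Q_def k_def by simp
    qed
    ultimately show ?thesis by simp
  qed
  have D0: "D t \<ge> 0" if "\<alpha> < t" "t < \<beta>" for t
    unfolding D_def using sin[OF that] l \<mu> by simp
  \<comment> \<open>At the ends only continuity is available, since \<open>sin\<close> vanishes at
    \<open>\<alpha> = 0\<close>, the centre of a disk.\<close>
  have cW: "continuous_on {\<alpha>..\<beta>} W" unfolding W_def by (intro continuous_intros cont)
  have "W t = 0" if t: "\<alpha> < t" "t < \<beta>" for t
  proof -
    have "W \<alpha> \<le> W t"
    proof (rule DERIV_nonneg_imp_increasing_open[where f = W and a = \<alpha> and b = t])
      show "\<exists>y. DERIV W x :> y \<and> y \<ge> 0" if "\<alpha> < x" "x < t" for x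
        using W'[of x] D0[of x] that t by (intro exI[of _ "D x"]) simp
      show "continuous_on {\<alpha>..t} W" by (rule continuous_on_subset[OF cW]) (use t in auto)
    qed (use t in simp)
    moreover have "W t \<le> W \<beta>"
    proof (rule DERIV_nonneg_imp_increasing_open[where f = W and a = t and b = \<beta>])
      show "\<exists>y. DERIV W x :> y \<and> y \<ge> 0" if "t < x" "x < \<beta>" for x
        using W'[of x] D0[of x] that t by (intro exI[of _ "D x"]) simp
      show "continuous_on {t..\<beta>} W" by (rule continuous_on_subset[OF cW]) (use t in auto)
    qed (use t in simp)
    moreover have "W \<alpha> = 0" "W \<beta> = 0" using ends by (auto simp: W_def)
    ultimately show ?thesis by simp
  qed
  then have W0: "0 = W t" if "t \<in> {\<alpha><..<\<beta>}" for t using that by simp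
  \<comment> \<open>\<open>W\<close> vanishes on the open interval, hence so does \<open>D\<close>;
    of its three nonnegative terms, the one with the positive factor \<open>\<nu> - \<mu>\<close>
    forces \<open>f r = 0\<close>.\<close>
  have "((\<lambda>_. 0) has_real_derivative D r) (at r)"
    by (rule has_field_derivative_transform_within_open[OF W'[OF r], of "{\<alpha><..<\<beta>}"]) (use r W0 in simp_all)
  from DERIV_unique[OF this DERIV_const] have "D r = 0" .
  moreover have "D r \<ge> (\<nu> - \<mu>) * sin r * (f r)\<^sup>2"
    unfolding D_def using sin[OF r] l by simp
  ultimately have "(\<nu> - \<mu>) * sin r * (f r)\<^sup>2 \<le> 0" by simp
  then show ?thesis using mult_pos_pos[of "\<nu> - \<mu>" "sin r"] sin[OF r] \<mu> by (simp add: mult_le_0_iff)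
qed

section \<open>Completeness of the trigonometric functions on the circle\<close>

lemma integral_square_eq_0:
  fixes w :: "real \<Rightarrow> real"
  assumes "a < b" and w: "continuous_on {a..b} w" and "integral {a..b} (\<lambda>t. w t * w t) = 0" and "t \<in> {a..b}"
  shows "w t = 0"
proof -
  have "((\<lambda>t. w t * w t) has_integral 0) (cbox a b)"
    using integrable_integral[of "\<lambda>t. w t * w t" "{a..b}"] assms
    by (auto intro!: integrable_continuous_real continuous_intros)
  then have "w t * w t = 0"
    using assms by (intro has_integral_0_cbox_imp_0[of a b "\<lambda>t. w t * w t" t]) (auto intro!: continuous_intros)
  then show ?thesis by simp
qed

text \<open>Stone-Weierstrass: \<open>v\<close> is orthogonal to all polynomials in
  \<open>cos t\<close> and \<open>sin t\<close>, and a polynomial within \<open>e\<close> of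
  \<open>v\<close> then bounds the integral of the square of \<open>v\<close> by \<open>e\<close>
  times that of \<open>\<bar>v\<bar>\<close>. The phase \<open>a\<close> treats cosines and sines
  together.\<close>

lemma orthogonal_trig_imp_zero:
  fixes v :: "complex \<Rightarrow> real"
  assumes v: "continuous_on (sphere 0 1) v"
    and orth: "\<And>(m::int) a. integral {0..2*pi} (\<lambda>t. v (cis t) * cos (of_int m * t - a)) = 0"
    and z: "z \<in> sphere 0 1"
  shows "v z = 0"
proof -
  define ann :: "(real \<Rightarrow> real) \<Rightarrow> bool" where
    "ann w \<longleftrightarrow> continuous_on {0..2*pi} w \<and> (\<forall>(m::int) a. integral {0..2*pi} (\<lambda>t. w t * cos (of_int m * t - a)) = 0)" for w
  have vc: "continuous_on {0..2*pi} (\<lambda>t. v (cis t))"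
    by (rule continuous_on_compose2[OF v]) (auto intro!: continuous_intros)
  have annv: "ann (\<lambda>t. v (cis t))"
    using vc orth by (simp add: ann_def)
  \<comment> \<open>The annihilator of the trigonometric functions is a module over the polynomials in \<open>cos t\<close> and \<open>sin t\<close>.\<close>
  have poly: "ann (\<lambda>t. p (cis t) * w t)" if "real_polynomial_function p" "ann w" for p :: "complex \<Rightarrow> real" and w
    using that
  proof (induction arbitrary: w)
    case (linear f)
    have wc: "continuous_on {0..2*pi} w" using linear by (simp add: ann_def)
    have wi: "integral {0..2*pi} (\<lambda>t. w t * cos (of_int m * t - a)) = 0" for m :: int and a
      using linear by (simp add: ann_def)
    have f: "f (cis t) = cos t * f 1 + sin t * f \<i>" for t
    proof -
      have "cis t = cos t *\<^sub>R 1 + sin t *\<^sub>R \<i>" by (simp add: complex_eq_iff)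
      then show ?thesis using linear(1) by (simp add: linear_simps)
    qed
    have fc: "continuous_on {0..2*pi} (\<lambda>t. f (cis t))"
      unfolding f by (intro continuous_intros)
    have "integral {0..2*pi} (\<lambda>t. f (cis t) * w t * cos (of_int m * t - a)) = 0" for m :: int and a
    proof -
      \<comment> \<open>Product-to-sum formulas: a factor \<open>cos t\<close> shifts the frequency
        to \<open>m + 1\<close> and \<open>m - 1\<close>, a factor \<open>sin t\<close> also shifts
        the phase by \<open>pi / 2\<close>.\<close>
      have "f (cis t) * w t * cos (of_int m * t - a) =
          (f 1 / 2) * (w t * cos (of_int (m + 1) * t - a)) + (f 1 / 2) * (w t * cos (of_int (m - 1) * t - a))
        + (f \<i> / 2) * (w t * cos (of_int (m + 1) * t - (a + pi / 2))) - (f \<i> / 2) * (w t * cos (of_int (m - 1) * t - (a + pi / 2)))" for t :: real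
      proof -
        define X where "X = of_int m * t - a"
        have "of_int (m + 1) * t - a = X + t" "of_int (m - 1) * t - a = X - t"
          "of_int (m + 1) * t - (a + pi / 2) = (X + t) - pi / 2" "of_int (m - 1) * t - (a + pi / 2) = (X - t) - pi / 2"
          by (simp_all add: X_def algebra_simps)
        then show ?thesis
          unfolding f X_def[symmetric]
          by (simp only: cos_add cos_diff sin_add sin_diff cos_pi_half sin_pi_half) (simp add: field_simps)
      qed
      moreover have "((\<lambda>t. w t * cos (of_int k * t - b)) has_integral 0) {0..2*pi}" for k :: int and b
      proof -
        have "(\<lambda>t. w t * cos (of_int k * t - b)) integrable_on {0..2*pi}"
          by (intro integrable_continuous_real continuous_intros wc)
        then show ?thesis using wi[of k b] by (metis integrable_integral)
      qed
      then have "((\<lambda>t. (f 1 / 2) * (w t * cos (of_int (m + 1) * t - a)) + (f 1 / 2) * (w t * cos (of_int (m - 1) * t - a))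
        + (f \<i> / 2) * (w t * cos (of_int (m + 1) * t - (a + pi / 2))) - (f \<i> / 2) * (w t * cos (of_int (m - 1) * t - (a + pi / 2))))
          has_integral (f 1 / 2) * 0 + (f 1 / 2) * 0 + (f \<i> / 2) * 0 - (f \<i> / 2) * 0) {0..2*pi}"
        by (intro has_integral_add has_integral_diff has_integral_mult_right)
      ultimately show ?thesis by (simp only: integral_unique)
    qed
    then show ?case using fc wc by (simp add: ann_def continuous_on_mult)
  next
    case (const c)
    then show ?case by (simp add: ann_def mult.assoc continuous_on_mult_left)
  next
    case (add f g)
    have "ann (\<lambda>t. f (cis t) * w t)" "ann (\<lambda>t. g (cis t) * w t)" using add by auto
    then show ?case
      by (auto simp: ann_def distrib_right intro!: continuous_intros)
         (subst integral_add, auto intro!: integrable_continuous_real continuous_intros)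
  next
    case (mult f g)
    then have "ann (\<lambda>t. f (cis t) * (g (cis t) * w t))" by blast
    then show ?case by (simp add: mult.assoc)
  qed
  define N where "N = integral {0..2*pi} (\<lambda>t. \<bar>v (cis t)\<bar>)"
  have N0: "N \<ge> 0" unfolding N_def
    by (intro integral_nonneg integrable_continuous_real continuous_intros vc) auto
  have sq: "integral {0..2*pi} (\<lambda>t. v (cis t) * v (cis t)) \<le> e * N" if e: "e > 0" for e
  proof -
    obtain g where g: "real_polynomial_function g" "\<And>x. x \<in> sphere 0 1 \<Longrightarrow> \<bar>v x - g x\<bar> < e"
      using Stone_Weierstrass_real_polynomial_function[of "sphere 0 1" v e] v e by auto
    have ag: "ann (\<lambda>t. g (cis t) * v (cis t))" by (rule poly[OF g(1) annv])
    then have gc: "continuous_on {0..2*pi} (\<lambda>t. g (cis t) * v (cis t))" by (simp add: ann_def)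
    have "integral {0..2*pi} (\<lambda>t. g (cis t) * v (cis t) * cos (of_int 0 * t - 0)) = 0"
      using ag unfolding ann_def by blast
    then have g0: "integral {0..2*pi} (\<lambda>t. g (cis t) * v (cis t)) = 0" by simp
    have "integral {0..2*pi} (\<lambda>t. v (cis t) * v (cis t)) =
        integral {0..2*pi} (\<lambda>t. v (cis t) * v (cis t) - g (cis t) * v (cis t))"
      by (subst integral_diff) (auto intro!: integrable_continuous_real continuous_intros vc gc simp: g0)
    also have "\<dots> \<le> integral {0..2*pi} (\<lambda>t. e * \<bar>v (cis t)\<bar>)"
    proof (rule integral_le)
      show "(\<lambda>t. v (cis t) * v (cis t) - g (cis t) * v (cis t)) integrable_on {0..2*pi}"
        by (intro integrable_continuous_real continuous_on_diff gc continuous_on_mult vc)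
      show "(\<lambda>t. e * \<bar>v (cis t)\<bar>) integrable_on {0..2*pi}"
        by (intro integrable_continuous_real continuous_intros vc)
      fix t
      have "v (cis t) * v (cis t) - g (cis t) * v (cis t) = (v (cis t) - g (cis t)) * v (cis t)"
        by (simp add: algebra_simps)
      also have "\<dots> \<le> \<bar>v (cis t) - g (cis t)\<bar> * \<bar>v (cis t)\<bar>" by (metis abs_ge_self abs_mult)
      also have "\<dots> \<le> e * \<bar>v (cis t)\<bar>" using g(2)[of "cis t"] by (intro mult_right_mono) auto
      finally show "v (cis t) * v (cis t) - g (cis t) * v (cis t) \<le> e * \<bar>v (cis t)\<bar>" .
    qed
    also have "\<dots> = e * N" by (simp add: N_def)
    finally show ?thesis .
  qed
  have "integral {0..2*pi} (\<lambda>t. v (cis t) * v (cis t)) \<le> 0"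
  proof (rule field_le_epsilon)
    fix e :: real assume "e > 0"
    \<comment> \<open>\<open>N + 1\<close> instead of \<open>N\<close>, which may be 0.\<close>
    have "e / (N + 1) * N \<le> e" using N0 \<open>e > 0\<close> by (simp add: field_simps)
    then show "integral {0..2*pi} (\<lambda>t. v (cis t) * v (cis t)) \<le> 0 + e"
      using sq[of "e / (N + 1)"] N0 \<open>e > 0\<close> by simp
  qed
  moreover have "integral {0..2*pi} (\<lambda>t. v (cis t) * v (cis t)) \<ge> 0"
    by (intro integral_nonneg integrable_continuous_real continuous_intros vc) auto
  ultimately have i0: "integral {0..2*pi} (\<lambda>t. v (cis t) * v (cis t)) = 0" by simp
  obtain t where t: "t \<in> {0..2*pi}" "z = cis t"
  proof -
    have "z = cis (Arg2pi z)" using Arg2pi_eq[of z] z by (simp add: cis_conv_exp)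
    then show ?thesis using that[of "Arg2pi z"] Arg2pi_ge_0[of z] Arg2pi_lt_2pi[of z] by simp
  qed
  show ?thesis using integral_square_eq_0[OF _ vc i0 t(1)] t(2) by simp
qed

section \<open>The Laplacian of the sphere in ambient coordinates\<close>

lemma linear_real_eq_inner_sum:
  fixes f :: "real^3 \<Rightarrow> real"
  assumes "linear f"
  shows "(\<Sum>b\<in>Basis. f b * (v \<bullet> b)) = f v"
proof -
  have "f v = f (\<Sum>b\<in>Basis. (v \<bullet> b) *\<^sub>R b)" by (simp add: euclidean_representation)
  also have "\<dots> = (\<Sum>b\<in>Basis. (v \<bullet> b) * f b)" using assms by (simp add: linear_sum linear_cmul)
  finally show ?thesis by (simp add: mult.commute)
qed

lemma grad_eqI:
  assumes "(u has_derivative (\<lambda>h. v \<bullet> h)) (at x)"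
  shows "grad u x = v"
proof -
  have "frechet_derivative u (at x) = (\<lambda>h. v \<bullet> h)" using frechet_derivative_at[OF assms] by simp
  then show ?thesis unfolding grad_def by (simp add: euclidean_representation)
qed

lemma has_derivative_grad:
  assumes "u differentiable (at x)"
  shows "(u has_derivative (\<lambda>h. grad u x \<bullet> h)) (at x)"
proof -
  have d: "(u has_derivative frechet_derivative u (at x)) (at x)"
    using assms frechet_derivative_works by blast
  have "frechet_derivative u (at x) h = grad u x \<bullet> h" for h
    using linear_real_eq_inner_sum[OF linear_frechet_derivative[OF assms], of h]
    by (simp add: grad_def inner_sum_left inner_commute[of h])
  then have "frechet_derivative u (at x) = (\<lambda>h. grad u x \<bullet> h)" by (rule ext)
  then show ?thesis using d by simp
qed

lemma C1_onI:
  assumes "\<And>x. x \<in> W \<Longrightarrow> (f has_derivative D x) (at x)"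
    and "\<And>h. continuous_on W (\<lambda>x. D x h)"
  shows "C1_on W f"
proof -
  have "frechet_derivative f (at x) h = D x h" if "x \<in> W" for x h
    using frechet_derivative_at[OF assms(1)[OF that]] by simp
  then show ?thesis using assms
    by (auto simp: C1_on_def differentiable_def cong: continuous_on_cong)
qed

lemma C1_onD:
  assumes "C1_on W f"
  shows "\<And>x. x \<in> W \<Longrightarrow> f differentiable (at x)" "\<And>h. continuous_on W (\<lambda>x. frechet_derivative f (at x) h)"
  using assms unfolding C1_on_def by auto

lemma tangent_proj_self: "x \<in> S2 \<Longrightarrow> tangent_proj x x = 0"
  by (simp add: tangent_proj_def dot_square_norm)

lemma linear_tangent_proj: "linear (tangent_proj x)"
  by (auto simp: tangent_proj_def linear_iff inner_add_right algebra_simps)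

text \<open>The derivative of the surface gradient is traced over the tangent plane. Its part along
  \<open>x\<close> drops out because \<open>tangent_proj x x = 0\<close>, and the coefficient 2 is
  the trace of \<open>tangent_proj x\<close>.\<close>

lemma sphere_laplacian_eq:
  assumes x: "x \<in> S2" and H: "(grad u has_derivative H) (at x)"
  shows "sphere_laplacian u x = 2 * (x \<bullet> grad u x) - (\<Sum>b\<in>Basis. H (tangent_proj x b) \<bullet> b)"
proof -
  let ?P = "tangent_proj x" and ?g = "grad u x"
  have lH: "linear H" using H by (rule has_derivative_linear)
  define D where "D = (\<lambda>h. H h - ((x \<bullet> ?g) *\<^sub>R h + (x \<bullet> H h + h \<bullet> ?g) *\<^sub>R x))"
  have "((\<lambda>y. grad u y - (y \<bullet> grad u y) *\<^sub>R y) has_derivative D) (at x)"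
    unfolding D_def
    by (intro has_derivative_diff has_derivative_scaleR has_derivative_inner has_derivative_ident H)
  then have "(surface_grad u has_derivative D) (at x)"
    by (simp add: surface_grad_def[abs_def] tangent_proj_def)
  then have fd: "frechet_derivative (surface_grad u) (at x) = D"
    using frechet_derivative_at by fastforce
  have lin: "linear (\<lambda>v. x \<bullet> H (?P v) + ?P v \<bullet> ?g)"
    using lH linear_tangent_proj[of x] by (auto simp: linear_iff inner_add_right inner_add_left algebra_simps)
  have s1: "(\<Sum>b\<in>Basis. (x \<bullet> H (?P b) + ?P b \<bullet> ?g) * (x \<bullet> b)) = 0"
    using linear_real_eq_inner_sum[OF lin, of x] x lH
    by (simp add: tangent_proj_self linear_0)
  have s2: "(\<Sum>b\<in>Basis. ?P b \<bullet> b) = 2"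
  proof -
    have "(\<Sum>b\<in>Basis. ?P b \<bullet> b) = (\<Sum>b\<in>(Basis :: (real^3) set). b \<bullet> b) - (\<Sum>b\<in>Basis. (x \<bullet> b) * (x \<bullet> b))"
      by (simp add: tangent_proj_def inner_diff_left sum_subtractf)
    also have "(\<Sum>b\<in>Basis. (x \<bullet> b) * (x \<bullet> b)) = 1"
      using x by (simp add: euclidean_inner[symmetric] dot_square_norm)
    also have "(\<Sum>b\<in>(Basis :: (real^3) set). b \<bullet> b) = 3" by simp
    finally show ?thesis by simp
  qed
  have "surface_div (surface_grad u) x = (\<Sum>b\<in>Basis. D (?P b) \<bullet> b)"
    by (simp add: surface_div_def fd)
  also have "\<dots> = (\<Sum>b\<in>Basis. H (?P b) \<bullet> b) - (x \<bullet> ?g) * (\<Sum>b\<in>Basis. ?P b \<bullet> b)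
       - (\<Sum>b\<in>Basis. (x \<bullet> H (?P b) + ?P b \<bullet> ?g) * (x \<bullet> b))"
    by (simp add: D_def inner_diff_left inner_add_left sum_subtractf sum.distrib sum_distrib_left)
  also have "\<dots> = (\<Sum>b\<in>Basis. H (?P b) \<bullet> b) - (x \<bullet> ?g) * 2"
    by (simp only: s1 s2)
  finally show ?thesis by (simp add: sphere_laplacian_def)
qed

text \<open>For a unit vector \<open>e\<close> orthogonal to \<open>p\<close>, this is the first
  angular mode \<open>sin r * cos t * g (cos r)\<close> in polar coordinates about \<open>p\<close>.
  In ambient coordinates its regularity at a pole needs no separate argument.\<close>

lemma
  fixes p e :: "real^3" and J :: "real set"
  assumes J: "open J"
    and g: "\<And>z. z \<in> J \<Longrightarrow> (g has_real_derivative g' z) (at z)"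
    and g': "\<And>z. z \<in> J \<Longrightarrow> (g' has_real_derivative g'' z) (at z)"
    and g'': "continuous_on J g''"
  defines "u \<equiv> \<lambda>x. (x \<bullet> e) * g (x \<bullet> p)" and "W \<equiv> {x. x \<bullet> p \<in> J}"
  shows open_slab: "open W"
    and C2_on_axial: "C2_on W u"
    and grad_axial: "\<And>x. x \<in> W \<Longrightarrow> grad u x = g (x \<bullet> p) *\<^sub>R e + ((x \<bullet> e) * g' (x \<bullet> p)) *\<^sub>R p"
    and laplacian_axial: "\<And>x. x \<in> W \<Longrightarrow> x \<in> S2 \<Longrightarrow> p \<in> S2 \<Longrightarrow> p \<bullet> e = 0 \<Longrightarrow>
      sphere_laplacian u x = (x \<bullet> e) * (2 * g (x \<bullet> p) + 4 * (x \<bullet> p) * g' (x \<bullet> p) - (1 - (x \<bullet> p)\<^sup>2) * g'' (x \<bullet> p))"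
proof -
  have W: "W = (\<lambda>x. x \<bullet> p) -` J" by (auto simp: W_def)
  show oW: "open W" unfolding W by (intro open_vimage J continuous_intros)
  have comp: "((\<lambda>x. f (x \<bullet> p)) has_derivative (\<lambda>h. f' (x \<bullet> p) * (h \<bullet> p))) (at x)"
    if "\<And>z. z \<in> J \<Longrightarrow> (f has_real_derivative f' z) (at z)" "x \<in> W" for f f' and x :: "real^3"
  proof -
    have "(f has_derivative (\<lambda>h. f' (x \<bullet> p) * h)) (at (x \<bullet> p))"
      using that by (auto simp: has_field_derivative_def W_def)
    then show ?thesis
      using has_derivative_compose[where f = "\<lambda>x. x \<bullet> p" and f' = "\<lambda>h. h \<bullet> p" and g = f and g' = "(*) (f' (x \<bullet> p))" and x = x and s = UNIV]
        has_derivative_inner_left[OF has_derivative_ident, of p] by simp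
  qed
  have cont: "continuous_on W (\<lambda>x. f (x \<bullet> p))" if "continuous_on J f" for f
    by (rule continuous_on_compose2[OF that]) (auto intro!: continuous_intros simp: W_def)
  have cg: "continuous_on J g" and cg': "continuous_on J g'"
    by (rule DERIV_continuous_on, rule has_field_derivative_at_within, fact g,
        rule DERIV_continuous_on, rule has_field_derivative_at_within, fact g')
  define G where "G = (\<lambda>x. g (x \<bullet> p) *\<^sub>R e + ((x \<bullet> e) * g' (x \<bullet> p)) *\<^sub>R p)"
  have du: "(u has_derivative (\<lambda>h. G x \<bullet> h)) (at x)" if "x \<in> W" for x
  proof -
    have "((\<lambda>x. (x \<bullet> e) * g (x \<bullet> p)) has_derivative (\<lambda>h. (x \<bullet> e) * (g' (x \<bullet> p) * (h \<bullet> p)) + (h \<bullet> e) * g (x \<bullet> p))) (at x)"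
      by (intro has_derivative_mult has_derivative_inner_left has_derivative_ident comp g that)
    then show ?thesis unfolding u_def G_def
      by (simp add: inner_add_left inner_commute algebra_simps)
  qed
  show gG: "grad u x = g (x \<bullet> p) *\<^sub>R e + ((x \<bullet> e) * g' (x \<bullet> p)) *\<^sub>R p" if "x \<in> W" for x
    using grad_eqI[OF du[OF that]] by (simp add: G_def)
  define H where "H = (\<lambda>x h. (g' (x \<bullet> p) * (h \<bullet> p)) *\<^sub>R e + ((x \<bullet> e) * (g'' (x \<bullet> p) * (h \<bullet> p)) + (h \<bullet> e) * g' (x \<bullet> p)) *\<^sub>R p)"
  have dG: "(grad u has_derivative H x) (at x)" if "x \<in> W" for x
  proof (rule has_derivative_transform_within_open[OF _ oW that])
    show "(G has_derivative H x) (at x)" unfolding G_def H_def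
      by (intro has_derivative_add has_derivative_scaleR_left has_derivative_mult has_derivative_inner_left
          has_derivative_ident comp g g' that)
    show "G y = grad u y" if "y \<in> W" for y using gG[OF that] by (simp add: G_def)
  qed
  show "C2_on W u" unfolding C2_on_def
  proof
    show "C1_on W u"
      by (rule C1_onI[OF du]) (auto simp: G_def intro!: continuous_intros cont cg cg')
    show "C1_on W (grad u)"
      by (rule C1_onI[OF dG]) (auto simp: H_def intro!: continuous_intros cont cg cg' g'')
  qed
  show "sphere_laplacian u x = (x \<bullet> e) * (2 * g (x \<bullet> p) + 4 * (x \<bullet> p) * g' (x \<bullet> p) - (1 - (x \<bullet> p)\<^sup>2) * g'' (x \<bullet> p))"
    if x: "x \<in> W" "x \<in> S2" and p: "p \<in> S2" "p \<bullet> e = 0" for x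
  proof -
    let ?P = "tangent_proj x"
    have ep: "p \<bullet> e = 0" "e \<bullet> p = 0" using p by (auto simp: inner_commute)
    define z y where "z = x \<bullet> p" and "y = x \<bullet> e"
    \<comment> \<open>Contraction of the projection with two vectors: the sum of
      \<open>(?P b \<bullet> v) * (w \<bullet> b)\<close> over the basis is
      \<open>?P w \<bullet> v\<close>.\<close>
    have lp: "linear (\<lambda>v. ?P v \<bullet> w)" for w
      using linear_tangent_proj[of x] by (auto simp: linear_iff inner_add_left)
    have pp: "(\<Sum>b\<in>Basis. (?P b \<bullet> p) * (e \<bullet> b)) = - y * z"
      unfolding linear_real_eq_inner_sum[OF lp] using p
      by (simp add: tangent_proj_def inner_diff_left y_def z_def ep)
    have pe: "(\<Sum>b\<in>Basis. (?P b \<bullet> e) * (p \<bullet> b)) = - y * z"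
      unfolding linear_real_eq_inner_sum[OF lp] using p
      by (simp add: tangent_proj_def inner_diff_left y_def z_def ep)
    have ppp: "(\<Sum>b\<in>Basis. (?P b \<bullet> p) * (p \<bullet> b)) = 1 - z\<^sup>2"
      unfolding linear_real_eq_inner_sum[OF lp] using p
      by (simp add: tangent_proj_def inner_diff_left z_def power2_eq_square dot_square_norm)
    have "(\<Sum>b\<in>Basis. H x (?P b) \<bullet> b) =
        g' z * (\<Sum>b\<in>Basis. (?P b \<bullet> p) * (e \<bullet> b)) + y * g'' z * (\<Sum>b\<in>Basis. (?P b \<bullet> p) * (p \<bullet> b))
        + g' z * (\<Sum>b\<in>Basis. (?P b \<bullet> e) * (p \<bullet> b))"
      by (simp add: H_def inner_add_left sum_distrib_left sum.distrib y_def z_def algebra_simps)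
    also have "\<dots> = y * (g'' z * (1 - z\<^sup>2) - 2 * z * g' z)"
      unfolding pp pe ppp by (simp add: algebra_simps)
    finally have t: "(\<Sum>b\<in>Basis. H x (?P b) \<bullet> b) = y * (g'' z * (1 - z\<^sup>2) - 2 * z * g' z)" .
    have "x \<bullet> grad u x = y * (g z + z * g' z)"
      unfolding gG[OF x(1)] by (simp add: inner_add_right y_def z_def algebra_simps)
    then show ?thesis
      unfolding sphere_laplacian_eq[OF x(2) dG[OF x(1)]] t by (simp add: y_def z_def algebra_simps)
  qed
qed

section \<open>Zones\<close>

text \<open>For \<open>\<alpha> = 0\<close> the pole \<open>p\<close> belongs to the zone, which is then a geodesic disk rather than a punctured one.\<close>

definition zone :: "real^3 \<Rightarrow> real \<Rightarrow> real \<Rightarrow> (real^3) set" where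
  "zone p \<alpha> \<beta> = {x \<in> S2. cos \<beta> < p \<bullet> x \<and> (\<alpha> = 0 \<or> p \<bullet> x < cos \<alpha>)}"

lemma abs_inner_S2: "p \<in> S2 \<Longrightarrow> x \<in> S2 \<Longrightarrow> \<bar>p \<bullet> x\<bar> \<le> 1"
  using Cauchy_Schwarz_ineq2[of p x] by simp

lemma geodesic_dist_less_iff:
  assumes "p \<in> S2" "x \<in> S2" "0 \<le> r" "r \<le> pi"
  shows "geodesic_dist p x < r \<longleftrightarrow> cos r < p \<bullet> x" "r < geodesic_dist p x \<longleftrightarrow> p \<bullet> x < cos r"
proof -
  let ?t = "arccos (p \<bullet> x)"
  have t: "0 \<le> ?t" "?t \<le> pi" "cos ?t = p \<bullet> x"
    using abs_inner_S2[OF assms(1,2)] arccos[of "p \<bullet> x"] by (auto simp: abs_le_iff)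
  show "geodesic_dist p x < r \<longleftrightarrow> cos r < p \<bullet> x"
    using cos_mono_less_eq[of r ?t] assms t by (simp add: geodesic_dist_def)
  show "r < geodesic_dist p x \<longleftrightarrow> p \<bullet> x < cos r"
    using cos_mono_less_eq[of ?t r] assms t by (simp add: geodesic_dist_def)
qed

lemma annulus_eq_zone:
  assumes "p \<in> S2" "0 < \<epsilon>" "\<epsilon> < pi / 2"
  shows "annulus p \<epsilon> = zone p \<epsilon> (pi - \<epsilon>)"
  using assms geodesic_dist_less_iff[OF assms(1), of _ \<epsilon>] geodesic_dist_less_iff[OF assms(1), of _ "pi - \<epsilon>"]
  by (auto simp: annulus_def zone_def)

lemma disk_eq_zone:
  assumes "q \<in> S2" "0 < R" "R < pi"
  shows "{x \<in> S2. geodesic_dist q x < R} = zone q 0 R"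
  using assms by (auto simp: zone_def geodesic_dist_less_iff)

lemma closure_zone_subset:
  "closure (zone p \<alpha> \<beta>) \<subseteq> {x \<in> S2. cos \<beta> \<le> p \<bullet> x \<and> (\<alpha> = 0 \<or> p \<bullet> x \<le> cos \<alpha>)}"
proof (rule closure_minimal)
  show "closed {x \<in> S2. cos \<beta> \<le> p \<bullet> x \<and> (\<alpha> = 0 \<or> p \<bullet> x \<le> cos \<alpha>)}"
    by (cases "\<alpha> = 0") (auto simp: Collect_conj_eq intro!: closed_Int closed_Collect_le closed_Collect_eq continuous_intros)
qed (auto simp: zone_def)

lemma zone_eq_Int_open:
  obtains T where "open T" "zone p \<alpha> \<beta> = S2 \<inter> T"
proof
  show "open {x. cos \<beta> < p \<bullet> x \<and> (\<alpha> = 0 \<or> p \<bullet> x < cos \<alpha>)}"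
    by (cases "\<alpha> = 0") (auto simp: Collect_conj_eq intro!: open_Int open_Collect_less continuous_intros)
qed (auto simp: zone_def)

text \<open>A zone is relatively open, so its frontier lies in the closure but outside the zone: the
  weak inequalities hold and one of the strict ones fails.\<close>

lemma sphere_boundary_zone_subset:
  assumes "x \<in> sphere_boundary (zone p \<alpha> \<beta>)"
  shows "x \<in> S2" "p \<bullet> x = cos \<beta> \<or> (\<alpha> \<noteq> 0 \<and> p \<bullet> x = cos \<alpha>)"
    "cos \<beta> \<le> p \<bullet> x" "\<alpha> \<noteq> 0 \<Longrightarrow> p \<bullet> x \<le> cos \<alpha>"
proof -
  obtain T where T: "open T" "zone p \<alpha> \<beta> = S2 \<inter> T" by (rule zone_eq_Int_open)
  have "openin (top_of_set S2) (zone p \<alpha> \<beta>)" unfolding T by (simp add: T(1) openin_open_Int)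
  then have "top_of_set S2 interior_of zone p \<alpha> \<beta> = zone p \<alpha> \<beta>" by (simp add: interior_of_eq)
  then have x: "x \<in> top_of_set S2 closure_of zone p \<alpha> \<beta>" "x \<notin> zone p \<alpha> \<beta>"
    using assms by (auto simp: frontier_of_def)
  have "x \<in> closure (zone p \<alpha> \<beta>)" using x(1) closure_mono[of "S2 \<inter> zone p \<alpha> \<beta>" "zone p \<alpha> \<beta>"] by (auto simp: closure_of_subtopology)
  then have c: "x \<in> S2 \<and> cos \<beta> \<le> p \<bullet> x \<and> (\<alpha> = 0 \<or> p \<bullet> x \<le> cos \<alpha>)" using closure_zone_subset by fast
  then show "x \<in> S2" "cos \<beta> \<le> p \<bullet> x" "\<alpha> \<noteq> 0 \<Longrightarrow> p \<bullet> x \<le> cos \<alpha>" by auto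
  show "p \<bullet> x = cos \<beta> \<or> (\<alpha> \<noteq> 0 \<and> p \<bullet> x = cos \<alpha>)"
    using c x(2) unfolding zone_def by auto
qed

section \<open>Normals of zones and the axial eigenfunction\<close>

lemma orthonormal_frame:
  fixes p :: "real^3"
  assumes p: "p \<in> S2"
  obtains e1 e2 :: "real^3" where "p \<bullet> p = 1" "e1 \<bullet> e1 = 1" "e2 \<bullet> e2 = 1" "p \<bullet> e1 = 0" "p \<bullet> e2 = 0" "e1 \<bullet> e2 = 0"
    "\<And>x. x = (x \<bullet> p) *\<^sub>R p + (x \<bullet> e1) *\<^sub>R e1 + (x \<bullet> e2) *\<^sub>R e2"
proof -
  have "norm (axis 3 1 :: real^3) = norm p" using p by (simp add: norm_axis_1)
  then obtain f where f: "orthogonal_transformation f" "f (axis 3 1 :: real^3) = p"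
    by (rule orthogonal_transformation_exists)
  then have lf: "linear f" and ip: "f v \<bullet> f w = v \<bullet> w" for v w
    by (auto simp: orthogonal_transformation_def)
  let ?e1 = "f (axis 1 1)" and ?e2 = "f (axis 2 1)"
  show ?thesis
  proof (rule that[of ?e1 ?e2])
    show "x = (x \<bullet> p) *\<^sub>R p + (x \<bullet> ?e1) *\<^sub>R ?e1 + (x \<bullet> ?e2) *\<^sub>R ?e2" for x
    proof -
      obtain y where y: "x = f y" using orthogonal_transformation_surj[OF f(1)] by (metis surjD)
      have "y = (y $ 3) *\<^sub>R axis 3 1 + (y $ 1) *\<^sub>R axis 1 1 + (y $ 2) *\<^sub>R axis 2 1"
        by (auto simp: vec_eq_iff forall_3 axis_def)
      from arg_cong[OF this, of f] have "f y = (y $ 3) *\<^sub>R p + (y $ 1) *\<^sub>R ?e1 + (y $ 2) *\<^sub>R ?e2"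
        by (simp only: linear_add[OF lf] linear_cmul[OF lf] f(2))
      then show ?thesis unfolding y f(2)[symmetric] ip by (simp add: inner_axis)
    qed
  qed (simp_all add: f(2)[symmetric] ip inner_axis_axis)
qed

text \<open>Each boundary circle has an affine defining function
  \<open>s * (p \<bullet> y) + k\<close> on an open set that excludes the other circle. Only the
  direction is recorded, because the Neumann condition is homogeneous in the normal.\<close>

lemma outward_unit_normal_zone:
  assumes p: "p \<in> S2" and x: "x \<in> S2" and ab: "0 \<le> \<alpha>" "\<alpha> < \<beta>" "\<beta> < pi"
    and bd: "p \<bullet> x = cos \<beta> \<or> (\<alpha> \<noteq> 0 \<and> p \<bullet> x = cos \<alpha>)"
  shows "\<exists>c. outward_unit_normal (zone p \<alpha> \<beta>) x (c *\<^sub>R (p - (x \<bullet> p) *\<^sub>R x))"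
proof -
  have cos_less: "cos \<beta> < cos \<alpha>" using ab by (simp add: cos_mono_less_eq)
  \<comment> \<open>Otherwise \<open>x\<close> would be a pole, but the boundary circles avoid both
    poles.\<close>
  have nz: "p - (x \<bullet> p) *\<^sub>R x \<noteq> 0"
  proof
    assume "p - (x \<bullet> p) *\<^sub>R x = 0"
    then have "p \<bullet> p = (x \<bullet> p)\<^sup>2" by (metis eq_iff_diff_eq_0 inner_commute inner_scaleR_left power2_eq_square inner_scaleR_right)
    then have "(p \<bullet> x)\<^sup>2 = 1" using p by (simp add: dot_square_norm inner_commute)
    moreover have "(cos r)\<^sup>2 \<noteq> 1" if "0 < r" "r < pi" for r
      using sin_gt_zero[OF that] sin_squared_eq[of r] by auto
    then have "(cos \<beta>)\<^sup>2 \<noteq> 1" "\<alpha> \<noteq> 0 \<Longrightarrow> (cos \<alpha>)\<^sup>2 \<noteq> 1" using ab by auto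
    ultimately show False using bd by auto
  qed
  have grad_aff: "grad (\<lambda>y. s * (p \<bullet> y) + k) y = s *\<^sub>R p" for s k and y :: "real^3"
  proof (rule grad_eqI)
    have "((\<lambda>y. s * (p \<bullet> y) + k) has_derivative (\<lambda>h. s * (p \<bullet> h) + 0)) (at y)"
      by (intro has_derivative_add has_derivative_const has_derivative_mult_right has_derivative_inner_right has_derivative_ident)
    then show "((\<lambda>y. s * (p \<bullet> y) + k) has_derivative (\<lambda>h. (s *\<^sub>R p) \<bullet> h)) (at y)" by simp
  qed
  have C1_aff: "C1_on V (\<lambda>y. s * (p \<bullet> y) + k)" for s k V
  proof (rule C1_onI)
    show "((\<lambda>y. s * (p \<bullet> y) + k) has_derivative (\<lambda>h. s * (p \<bullet> h) + 0)) (at y)" for y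
      by (intro has_derivative_add has_derivative_const has_derivative_mult_right has_derivative_inner_right has_derivative_ident)
  qed simp
  have sg: "surface_grad (\<lambda>y. s * (p \<bullet> y) + k) x = s *\<^sub>R (p - (x \<bullet> p) *\<^sub>R x)" for s k
    by (simp add: surface_grad_def grad_aff tangent_proj_def scaleR_diff_right)
  have main: ?thesis if V: "open V" "x \<in> V" "s * (p \<bullet> x) + k = 0" "s \<noteq> 0"
    "zone p \<alpha> \<beta> \<inter> V = {y \<in> S2 \<inter> V. s * (p \<bullet> y) + k < 0}" for V s k
  proof -
    have "outward_unit_normal (zone p \<alpha> \<beta>) x (sgn (s *\<^sub>R (p - (x \<bullet> p) *\<^sub>R x)))"
      unfolding outward_unit_normal_def sg[of s k, symmetric]
      using V C1_aff[of V s k] nz sg[of s k] by (intro exI[of _ V] exI[of _ "\<lambda>y. s * (p \<bullet> y) + k"]) auto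
    then show ?thesis unfolding sgn_div_norm scaleR_scaleR by blast
  qed
  show ?thesis
  proof (cases "p \<bullet> x = cos \<beta>")
    case True
    show ?thesis
    proof (cases "\<alpha> = 0")
      case True
      show ?thesis
        by (rule main[of UNIV "-1" "cos \<beta>"]) (use True \<open>p \<bullet> x = cos \<beta>\<close> in \<open>auto simp: zone_def\<close>)
    next
      case False
      show ?thesis
        by (rule main[of "{y. p \<bullet> y < cos \<alpha>}" "-1" "cos \<beta>"])
          (use False \<open>p \<bullet> x = cos \<beta>\<close> cos_less in \<open>auto simp: zone_def intro!: open_Collect_less continuous_intros\<close>)
    qed
  next
    case False
    then have "\<alpha> \<noteq> 0" "p \<bullet> x = cos \<alpha>" using bd by auto
    then show ?thesis
      by (intro main[of "{y. cos \<beta> < p \<bullet> y}" "1" "- cos \<alpha>"])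
        (use cos_less in \<open>auto simp: zone_def intro!: open_Collect_less continuous_intros\<close>)
  qed
qed

text \<open>The normal direction is the tangential part of \<open>p\<close>; its product with
  \<open>grad u\<close> is \<open>(x \<bullet> e) * ((1 - z\<^sup>2) * g' z - z * g z)\<close>,
  which is why \<open>bc\<close> has its form.\<close>

lemma neumann_eigenvalue_zone:
  assumes p: "p \<in> S2" and ab: "0 \<le> \<alpha>" "\<alpha> < \<beta>" "\<beta> < pi"
    and J: "open J" "{cos \<beta>..cos \<alpha>} \<subseteq> J"
    and g: "\<And>z. z \<in> J \<Longrightarrow> (g has_real_derivative g' z) (at z)"
    and g': "\<And>z. z \<in> J \<Longrightarrow> (g' has_real_derivative g'' z) (at z)"
    and g'': "continuous_on J g''"
    and ode: "\<And>z. z \<in> J \<Longrightarrow> (1 - z\<^sup>2) * g'' z - 4 * z * g' z = \<eta> * g z"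
    and pos: "\<And>z. z \<in> {cos \<beta>..cos \<alpha>} \<Longrightarrow> g z > 0"
    and bc: "\<And>r. r = \<beta> \<or> (\<alpha> \<noteq> 0 \<and> r = \<alpha>) \<Longrightarrow> cos r * g (cos r) = (1 - (cos r)\<^sup>2) * g' (cos r)"
  shows "neumann_eigenvalue (zone p \<alpha> \<beta>) (2 - \<eta>)"
proof -
  obtain e e2 where e: "p \<bullet> p = 1" "e \<bullet> e = 1" "p \<bullet> e = 0"
    by (rule orthonormal_frame[OF p]) blast
  define u where "u = (\<lambda>x. (x \<bullet> e) * g (x \<bullet> p))"
  define W where "W = {x. x \<bullet> p \<in> J}"
  \<comment> \<open>For \<open>\<alpha> = 0\<close> the upper bound is
    \<open>p \<bullet> x \<le> 1 = cos 0\<close>.\<close>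
  have inJ: "x \<bullet> p \<in> J" if "x \<in> S2" "cos \<beta> \<le> p \<bullet> x" "\<alpha> \<noteq> 0 \<Longrightarrow> p \<bullet> x \<le> cos \<alpha>" for x
    using that abs_inner_S2[OF p that(1)] J(2) by (cases "\<alpha> = 0") (auto simp: inner_commute)
  show ?thesis unfolding neumann_eigenvalue_def neumann_eigenfunction_def
  proof (intro exI[of _ u] conjI ballI)
    show "\<exists>W. open W \<and> closure (zone p \<alpha> \<beta>) \<subseteq> W \<and> C2_on W u"
    proof (intro exI[of _ W] conjI)
      show "open W" unfolding W_def by (rule open_slab[OF J(1) g g' g''])
      show "C2_on W u" unfolding W_def u_def by (rule C2_on_axial[OF J(1) g g' g''])
      show "closure (zone p \<alpha> \<beta>) \<subseteq> W"
        using closure_zone_subset[of p \<alpha> \<beta>] inJ unfolding W_def by blast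
    qed
    define r where "r = (\<alpha> + \<beta>) / 2"
    have r: "\<alpha> < r" "r < \<beta>" using ab by (auto simp: r_def)
    \<comment> \<open>A point of the zone on the meridian through \<open>e\<close>, where
      \<open>x \<bullet> e = sin r\<close> is positive.\<close>
    define x where "x = cos r *\<^sub>R p + sin r *\<^sub>R e"
    have xp: "p \<bullet> x = cos r" and xe: "x \<bullet> e = sin r"
      using e by (simp_all add: x_def inner_add_right inner_add_left inner_commute)
    have "x \<bullet> x = (cos r)\<^sup>2 + (sin r)\<^sup>2"
      using e by (simp add: x_def inner_add_right inner_add_left inner_commute power2_eq_square)
    then have "x \<in> S2" by (simp add: norm_eq_1)
    have cr: "cos \<beta> < cos r" "cos r < cos \<alpha>" using r ab by (auto simp: cos_mono_less_eq)
    have "x \<in> zone p \<alpha> \<beta>" using \<open>x \<in> S2\<close> cr xp by (simp add: zone_def)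
    moreover have "u x \<noteq> 0"
    proof -
      have "sin r > 0" using r ab by (intro sin_gt_zero) auto
      moreover have "g (cos r) > 0" using cr by (intro pos) auto
      ultimately show ?thesis using xp xe by (simp add: u_def inner_commute)
    qed
    ultimately show "\<exists>x\<in>zone p \<alpha> \<beta>. u x \<noteq> 0" by blast
  next
    fix x assume x: "x \<in> zone p \<alpha> \<beta>"
    then have xS: "x \<in> S2" and xJ: "x \<bullet> p \<in> J" by (auto simp: zone_def intro!: inJ)
    have "sphere_laplacian u x = (x \<bullet> e) * (2 * g (x \<bullet> p) + 4 * (x \<bullet> p) * g' (x \<bullet> p) - (1 - (x \<bullet> p)\<^sup>2) * g'' (x \<bullet> p))"
      unfolding u_def using xS xJ p e by (intro laplacian_axial[OF J(1) g g' g'']) auto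
    also have "\<dots> = (x \<bullet> e) * ((2 - \<eta>) * g (x \<bullet> p))"
    proof -
      have "2 * g (x \<bullet> p) + 4 * (x \<bullet> p) * g' (x \<bullet> p) - (1 - (x \<bullet> p)\<^sup>2) * g'' (x \<bullet> p) = (2 - \<eta>) * g (x \<bullet> p)"
        using ode[OF xJ] by (simp add: algebra_simps)
      then show ?thesis by simp
    qed
    finally show "sphere_laplacian u x = (2 - \<eta>) * u x" by (simp add: u_def)
  next
    fix x assume x: "x \<in> sphere_boundary (zone p \<alpha> \<beta>)"
    note b = sphere_boundary_zone_subset[OF x]
    obtain c where c: "outward_unit_normal (zone p \<alpha> \<beta>) x (c *\<^sub>R (p - (x \<bullet> p) *\<^sub>R x))"
      using outward_unit_normal_zone[OF p b(1) ab b(2)] by blast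
    define z where "z = x \<bullet> p"
    have zJ: "z \<in> J" using inJ[OF b(1,3,4)] by (simp add: z_def)
    have bcz: "z * g z = (1 - z\<^sup>2) * g' z"
      using b(2) bc[of \<beta>] bc[of \<alpha>] by (auto simp: z_def inner_commute)
    have gu: "grad u x = g z *\<^sub>R e + ((x \<bullet> e) * g' z) *\<^sub>R p"
      unfolding u_def z_def using zJ by (intro grad_axial[OF J(1) g g' g'']) (auto simp: z_def)
    have "x \<bullet> x = 1" using b(1) by (simp add: dot_square_norm)
    then have "surface_grad u x \<bullet> (p - z *\<^sub>R x) = grad u x \<bullet> (p - z *\<^sub>R x)"
      by (simp add: surface_grad_def tangent_proj_def inner_diff_left inner_diff_right z_def inner_commute)
    also have "\<dots> = (x \<bullet> e) * ((1 - z\<^sup>2) * g' z - z * g z)"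
      unfolding gu using e
      by (simp add: inner_add_left inner_diff_right z_def inner_commute power2_eq_square algebra_simps)
    also have "\<dots> = 0" using bcz by simp
    finally show "\<exists>\<nu>. outward_unit_normal (zone p \<alpha> \<beta>) x \<nu> \<and> surface_grad u x \<bullet> \<nu> = 0"
      using c by (intro exI[of _ "c *\<^sub>R (p - (x \<bullet> p) *\<^sub>R x)"]) (simp add: z_def)
  qed
qed

section \<open>Polar coordinates and angular modes\<close>

locale orthonormal_frame =
  fixes p e1 e2 :: "real^3"
  assumes inner_frame [simp]: "p \<bullet> p = 1" "e1 \<bullet> e1 = 1" "e2 \<bullet> e2 = 1" "p \<bullet> e1 = 0" "p \<bullet> e2 = 0" "e1 \<bullet> e2 = 0"
    and expand: "\<And>x. x = (x \<bullet> p) *\<^sub>R p + (x \<bullet> e1) *\<^sub>R e1 + (x \<bullet> e2) *\<^sub>R e2"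
begin

lemma inner_frame' [simp]: "e1 \<bullet> p = 0" "e2 \<bullet> p = 0" "e2 \<bullet> e1 = 0"
  by (simp_all add: inner_commute[of _ p] inner_commute[of e2 e1])

lemma frame_eqI:
  assumes "v \<bullet> p = w \<bullet> p" "v \<bullet> e1 = w \<bullet> e1" "v \<bullet> e2 = w \<bullet> e2"
  shows "v = w"
  using expand[of v] expand[of w] assms by simp

text \<open>With \<open>polar\<close>, the vectors \<open>rad\<close> and \<open>ang\<close> form
  the moving frame of spherical coordinates: \<open>rad\<close> is the derivative in
  \<open>r\<close>, and \<open>ang\<close> the derivative in \<open>t\<close> divided by
  \<open>sin r\<close>, hence defined at the poles too.\<close>

definition hor :: "real \<Rightarrow> real^3" where "hor t = cos t *\<^sub>R e1 + sin t *\<^sub>R e2"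
definition polar :: "real \<Rightarrow> real \<Rightarrow> real^3" where "polar r t = cos r *\<^sub>R p + sin r *\<^sub>R hor t"
definition rad :: "real \<Rightarrow> real \<Rightarrow> real^3" where "rad r t = (- sin r) *\<^sub>R p + cos r *\<^sub>R hor t"
definition ang :: "real \<Rightarrow> real^3" where "ang t = (- sin t) *\<^sub>R e1 + cos t *\<^sub>R e2"

lemma inner_polar [simp]:
  "hor t \<bullet> p = 0" "hor t \<bullet> e1 = cos t" "hor t \<bullet> e2 = sin t" "ang t \<bullet> p = 0" "ang t \<bullet> e1 = - sin t" "ang t \<bullet> e2 = cos t"
  "polar r t \<bullet> p = cos r" "polar r t \<bullet> e1 = sin r * cos t" "polar r t \<bullet> e2 = sin r * sin t"
  "rad r t \<bullet> p = - sin r" "rad r t \<bullet> e1 = cos r * cos t" "rad r t \<bullet> e2 = cos r * sin t"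
  by (simp_all add: polar_def rad_def hor_def ang_def inner_add_left inner_diff_left)

lemma inner_polar_right:
  "v \<bullet> hor t = cos t * (v \<bullet> e1) + sin t * (v \<bullet> e2)"
  "v \<bullet> polar r t = cos r * (v \<bullet> p) + sin r * (cos t * (v \<bullet> e1) + sin t * (v \<bullet> e2))"
  "v \<bullet> rad r t = - sin r * (v \<bullet> p) + cos r * (cos t * (v \<bullet> e1) + sin t * (v \<bullet> e2))"
  "v \<bullet> ang t = - sin t * (v \<bullet> e1) + cos t * (v \<bullet> e2)"
  by (simp_all add: polar_def rad_def hor_def ang_def inner_add_right inner_diff_right)

lemma polar_S2 [simp]: "polar r t \<in> S2"
proof -
  have "polar r t \<bullet> polar r t = (cos r)\<^sup>2 + (sin r)\<^sup>2 * ((cos t)\<^sup>2 + (sin t)\<^sup>2)"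
    unfolding inner_polar_right by (simp only: inner_polar algebra_simps power2_eq_square)
  then show ?thesis by (simp add: norm_eq_1)
qed

lemma polar_inner_rad: "polar r t \<bullet> rad r t = 0"
proof -
  have "polar r t \<bullet> rad r t = sin r * cos r * ((cos t)\<^sup>2 + (sin t)\<^sup>2 - 1)"
    unfolding inner_polar_right by (simp only: inner_polar algebra_simps power2_eq_square)
  then show ?thesis by simp
qed

lemma tangent_proj_polar: "tangent_proj (polar r t) v = (v \<bullet> rad r t) *\<^sub>R rad r t + (v \<bullet> ang t) *\<^sub>R ang t"
proof -
  define a b c where "a = v \<bullet> p" and "b = v \<bullet> e1" and "c = v \<bullet> e2"
  define C S c' s' where "C = cos r" and "S = sin r" and "c' = cos t" and "s' = sin t"
  \<comment> \<open>With letters for the trigonometric values, each component becomes a polynomial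
    identity modulo the two Pythagorean relations.\<close>
  have id: "C * C = 1 - S * S" "c' * c' = 1 - s' * s'"
    using sin_cos_squared_add3[of r] sin_cos_squared_add3[of t] by (auto simp: C_def S_def c'_def s'_def algebra_simps)
  show ?thesis
    by (rule frame_eqI)
      (simp_all add: tangent_proj_def inner_diff_left inner_add_left inner_polar_right inner_commute[of _ v],
       simp_all only: a_def[symmetric] b_def[symmetric] c_def[symmetric] C_def[symmetric] S_def[symmetric] c'_def[symmetric] s'_def[symmetric],
       (use id in algebra)+)
qed

lemma polar_cover:
  assumes x: "x \<in> S2"
  obtains t where "x = polar (arccos (p \<bullet> x)) t"
proof -
  define r where "r = arccos (p \<bullet> x)"
  have "\<bar>p \<bullet> x\<bar> \<le> 1" using Cauchy_Schwarz_ineq2[of p x] x by (simp add: norm_eq_sqrt_inner)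
  then have cr: "cos r = x \<bullet> p" and sr: "sin r \<ge> 0"
    using arccos[of "p \<bullet> x"] by (auto simp: r_def abs_le_iff inner_commute intro!: sin_ge_zero)
  have "x \<bullet> x = 1" using x by (simp add: dot_square_norm)
  moreover have "x \<bullet> x = (x \<bullet> p)\<^sup>2 + (x \<bullet> e1)\<^sup>2 + (x \<bullet> e2)\<^sup>2"
    by (subst (2) expand[of x]) (simp add: inner_add_right power2_eq_square)
  ultimately have sq: "(x \<bullet> e1)\<^sup>2 + (x \<bullet> e2)\<^sup>2 = (sin r)\<^sup>2"
    using sin_squared_eq[of r] by (simp add: cr)
  obtain t where t: "x \<bullet> e1 = sin r * cos t" "x \<bullet> e2 = sin r * sin t"
  proof (cases "sin r = 0")
    case True
    then show ?thesis using sq that[of 0] by (simp add: sum_power2_eq_zero_iff)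
  next
    case False
    have "(x \<bullet> e1 / sin r)\<^sup>2 + (x \<bullet> e2 / sin r)\<^sup>2 = 1"
      using sq False by (simp add: power_divide flip: add_divide_distrib)
    then obtain t where "x \<bullet> e1 / sin r = cos t" "x \<bullet> e2 / sin r = sin t"
      using sincos_total_2pi by metis
    then show ?thesis using that[of t] False by (simp add: field_simps)
  qed
  have "x = polar r t" by (rule frame_eqI) (simp_all add: cr t)
  then show ?thesis using that by (simp add: r_def)
qed

lemma polar_derivs:
  "((\<lambda>r. polar r t) has_vector_derivative rad r t) (at r)"
  "((\<lambda>r. rad r t) has_vector_derivative - polar r t) (at r)"
  "((\<lambda>t. polar r t) has_vector_derivative sin r *\<^sub>R ang t) (at t)"
  "(ang has_vector_derivative - hor t) (at t)"
  unfolding polar_def rad_def hor_def ang_def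
  by (auto intro!: derivative_eq_intros simp: has_vector_derivative_def algebra_simps scaleR_add_right)

lemma continuous_on_polar [continuous_intros]:
  fixes f g :: "'a::t2_space \<Rightarrow> real"
  assumes "continuous_on A f" "continuous_on A g"
  shows "continuous_on A (\<lambda>x. polar (f x) (g x))" "continuous_on A (\<lambda>x. rad (f x) (g x))" "continuous_on A (\<lambda>x. ang (g x))"
    "continuous_on A (\<lambda>x. hor (g x))"
  unfolding polar_def rad_def hor_def ang_def by (intro continuous_intros assms)+

end

section \<open>Polar derivatives of functions of class C^2\<close>

lemma has_vector_derivative_chain:
  assumes "(c has_vector_derivative v) (at s)" "(F has_derivative F') (at (c s))"
  shows "((\<lambda>s. F (c s)) has_vector_derivative F' v) (at s)"
proof -
  have "((\<lambda>s. F (c s)) has_derivative (\<lambda>h. F' (h *\<^sub>R v))) (at s)"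
    using has_derivative_compose[OF assms(1)[unfolded has_vector_derivative_def] assms(2)] .
  moreover have "F' (h *\<^sub>R v) = h *\<^sub>R F' v" for h
    using assms(2) by (simp add: has_derivative_linear linear_cmul)
  ultimately show ?thesis by (simp add: has_vector_derivative_def)
qed

locale polar_C2 = orthonormal_frame +
  fixes u :: "real^3 \<Rightarrow> real" and W :: "(real^3) set" and H :: "real^3 \<Rightarrow> real^3 \<Rightarrow> real^3"
  assumes W: "open W"
    and du: "\<And>x. x \<in> W \<Longrightarrow> (u has_derivative (\<lambda>h. grad u x \<bullet> h)) (at x)"
    and dG: "\<And>x. x \<in> W \<Longrightarrow> (grad u has_derivative H x) (at x)"
    and cH: "\<And>h. continuous_on W (\<lambda>x. H x h)"
begin

text \<open>The partial derivatives in \<open>r\<close> and \<open>t\<close>, written out through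
  the gradient and the Hessian \<open>H\<close>; the last terms of \<open>Urr\<close> and
  \<open>Utt\<close> come from differentiating \<open>rad\<close> and \<open>ang\<close>. In this
  form continuity at a pole is immediate.\<close>

definition U where "U r t = u (polar r t)"
definition Ur where "Ur r t = grad u (polar r t) \<bullet> rad r t"
definition Urr where "Urr r t = H (polar r t) (rad r t) \<bullet> rad r t - grad u (polar r t) \<bullet> polar r t"
definition Ut where "Ut r t = sin r * (grad u (polar r t) \<bullet> ang t)"
definition Utt where "Utt r t = (sin r)\<^sup>2 * (H (polar r t) (ang t) \<bullet> ang t) - sin r * (grad u (polar r t) \<bullet> hor t)"

lemma
  assumes "polar r t \<in> W"
  shows DERIV_U: "((\<lambda>r. U r t) has_real_derivative Ur r t) (at r)"
    and DERIV_Ur: "((\<lambda>r. Ur r t) has_real_derivative Urr r t) (at r)"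
    and DERIV_U_t: "((\<lambda>t. U r t) has_real_derivative Ut r t) (at t)"
    and DERIV_Ut: "((\<lambda>t. Ut r t) has_real_derivative Utt r t) (at t)"
proof -
  note ch = has_vector_derivative_chain[OF polar_derivs(1) du[OF assms]] has_vector_derivative_chain[OF polar_derivs(3) du[OF assms]]
    has_vector_derivative_chain[OF polar_derivs(1) dG[OF assms]] has_vector_derivative_chain[OF polar_derivs(3) dG[OF assms]]
  note ip = bounded_bilinear.has_vector_derivative[OF bounded_bilinear_inner]
  have lH: "linear (H (polar r t))" using dG[OF assms] by (rule has_derivative_linear)
  show "((\<lambda>r. U r t) has_real_derivative Ur r t) (at r)"
    unfolding U_def Ur_def has_real_derivative_iff_has_vector_derivative by (rule ch(1))
  show "((\<lambda>t. U r t) has_real_derivative Ut r t) (at t)"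
    unfolding U_def Ut_def has_real_derivative_iff_has_vector_derivative using ch(2) by simp
  show "((\<lambda>r. Ur r t) has_real_derivative Urr r t) (at r)"
    unfolding Ur_def Urr_def has_real_derivative_iff_has_vector_derivative
    using ip[OF ch(3) polar_derivs(2)] by (simp add: inner_minus_right)
  have "((\<lambda>t. grad u (polar r t) \<bullet> ang t) has_real_derivative
      sin r * (H (polar r t) (ang t) \<bullet> ang t) - grad u (polar r t) \<bullet> hor t) (at t)"
    unfolding has_real_derivative_iff_has_vector_derivative
    using ip[OF ch(4) polar_derivs(4)] lH by (simp add: inner_minus_right linear_cmul)
  from DERIV_cmult[OF this, of "sin r"] show "((\<lambda>t. Ut r t) has_real_derivative Utt r t) (at t)"
    unfolding Ut_def Utt_def by (simp add: algebra_simps power2_eq_square)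
qed

text \<open>Multiplying by \<open>(sin r)\<^sup>2\<close> avoids division at a pole. The curvature
  of meridians and of parallels contributes one normal derivative
  \<open>grad u x \<bullet> x\<close> each, through \<open>Urr\<close> and \<open>Utt\<close>;
  together they match the coefficient 2 in \<open>sphere_laplacian_eq\<close>.\<close>

lemma laplacian_polar:
  assumes "polar r t \<in> W"
  shows "(sin r)\<^sup>2 * sphere_laplacian u (polar r t) = - ((sin r)\<^sup>2 * Urr r t + sin r * cos r * Ur r t + Utt r t)"
proof -
  let ?x = "polar r t"
  let ?g = "grad u ?x" and ?h = "H ?x"
  have lH: "linear ?h" using dG[OF assms] by (rule has_derivative_linear)
  have ip: "(\<Sum>b\<in>Basis. (b \<bullet> v) * (w \<bullet> b)) = w \<bullet> v" for v w :: "real^3"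
    unfolding inner_commute[of _ v] by (rule euclidean_inner[symmetric])
  have "(\<Sum>b\<in>Basis. ?h (tangent_proj ?x b) \<bullet> b) =
      (\<Sum>b\<in>Basis. (b \<bullet> rad r t) * (?h (rad r t) \<bullet> b) + (b \<bullet> ang t) * (?h (ang t) \<bullet> b))"
    using lH by (simp add: tangent_proj_polar linear_add linear_cmul inner_add_left)
  also have "\<dots> = ?h (rad r t) \<bullet> rad r t + ?h (ang t) \<bullet> ang t"
    by (simp only: sum.distrib ip)
  finally have tr: "(\<Sum>b\<in>Basis. ?h (tangent_proj ?x b) \<bullet> b) = ?h (rad r t) \<bullet> rad r t + ?h (ang t) \<bullet> ang t" .
  have hor: "hor t = sin r *\<^sub>R ?x + cos r *\<^sub>R rad r t"
  proof (rule frame_eqI)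
    have *: "sin r * (sin r * k) + cos r * (cos r * k) = k" for k
      using sin_cos_squared_add3[of r] by (metis distrib_right mult.assoc mult_1 add.commute)
    show "hor t \<bullet> p = (sin r *\<^sub>R ?x + cos r *\<^sub>R rad r t) \<bullet> p"
      "hor t \<bullet> e1 = (sin r *\<^sub>R ?x + cos r *\<^sub>R rad r t) \<bullet> e1"
      "hor t \<bullet> e2 = (sin r *\<^sub>R ?x + cos r *\<^sub>R rad r t) \<bullet> e2"
      by (simp_all add: inner_add_left *)
  qed
  have gh: "?g \<bullet> hor t = sin r * (?g \<bullet> ?x) + cos r * Ur r t"
    unfolding hor Ur_def by (simp add: inner_add_right)
  show ?thesis
    unfolding sphere_laplacian_eq[OF polar_S2 dG[OF assms]] tr Utt_def Urr_def gh
    by (simp add: inner_commute[of ?x] algebra_simps power2_eq_square)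
qed

text \<open>The assumption \<open>cH\<close> fixes the direction; a moving direction is expanded in
  the basis.\<close>

lemma continuous_on_H:
  assumes "continuous_on A c" "continuous_on A v" "c ` A \<subseteq> W"
  shows "continuous_on A (\<lambda>s. H (c s) (v s))"
proof -
  have "H (c s) (v s) = (\<Sum>b\<in>Basis. (v s \<bullet> b) *\<^sub>R H (c s) b)" if "s \<in> A" for s
  proof -
    have "linear (H (c s))" using dG assms(3) that by (blast intro: has_derivative_linear)
    then have "H (c s) (\<Sum>b\<in>Basis. (v s \<bullet> b) *\<^sub>R b) = (\<Sum>b\<in>Basis. (v s \<bullet> b) *\<^sub>R H (c s) b)"
      by (simp add: linear_sum linear_cmul)
    then show ?thesis by (simp add: euclidean_representation)
  qed
  moreover have "continuous_on A (\<lambda>s. \<Sum>b\<in>Basis. (v s \<bullet> b) *\<^sub>R H (c s) b)"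
    by (intro continuous_intros assms(2) continuous_on_compose2[OF cH assms(1,3)])
  ultimately show ?thesis by (simp cong: continuous_on_cong)
qed

lemma
  fixes f g :: "'a::t2_space \<Rightarrow> real"
  assumes f: "continuous_on A f" "continuous_on A g" and sub: "\<And>x. x \<in> A \<Longrightarrow> polar (f x) (g x) \<in> W"
  shows continuous_on_U: "continuous_on A (\<lambda>x. U (f x) (g x))"
    and continuous_on_Ur: "continuous_on A (\<lambda>x. Ur (f x) (g x))"
    and continuous_on_Urr: "continuous_on A (\<lambda>x. Urr (f x) (g x))"
proof -
  have cu: "continuous_on W u" and cg: "continuous_on W (grad u)"
    using du dG by (auto intro!: continuous_at_imp_continuous_on has_derivative_continuous)
  have sub': "(\<lambda>x. polar (f x) (g x)) ` A \<subseteq> W" using sub by auto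
  note cp = continuous_on_polar[OF f]
  note c = continuous_on_compose2[OF cu cp(1) sub'] continuous_on_compose2[OF cg cp(1) sub']
  show "continuous_on A (\<lambda>x. U (f x) (g x))" "continuous_on A (\<lambda>x. Ur (f x) (g x))" "continuous_on A (\<lambda>x. Urr (f x) (g x))"
    unfolding U_def Ur_def Urr_def by (intro continuous_intros c cp continuous_on_H sub')+
qed

end

section \<open>Angular Fourier modes\<close>

lemma integral_by_parts_trig:
  fixes w w1 w2 :: "real \<Rightarrow> real"
  assumes w: "\<And>t. (w has_real_derivative w1 t) (at t)" "\<And>t. (w1 has_real_derivative w2 t) (at t)"
    and per: "w (2 * pi) = w 0" "w1 (2 * pi) = w1 0"
  shows "((\<lambda>t. w2 t * cos (of_int m * t - a)) has_integral - (of_int m)\<^sup>2 * integral {0..2*pi} (\<lambda>t. w t * cos (of_int m * t - a))) {0..2*pi}"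
proof -
  let ?c = "\<lambda>t::real. cos (of_int m * t - a)" and ?s = "\<lambda>t::real. sin (of_int m * t - a)"
  have p1: "?c (2 * pi) = ?c 0" "?s (2 * pi) = ?s 0"
  proof -
    have "of_int m * (2 * pi) - a = (0 * of_int m - a) + 2 * pi * of_int m" by simp
    then show "?c (2 * pi) = ?c 0" "?s (2 * pi) = ?s 0"
      using sin.plus_of_int[of "0 * of_int m - a" m] cos.plus_of_int[of "0 * of_int m - a" m]
      by (simp_all add: mult_ac)
  qed
  \<comment> \<open>Both integrations by parts at once: the mixed terms cancel in the derivative,
    and by periodicity this antiderivative has equal values at \<open>0\<close> and
    \<open>2 * pi\<close>.\<close>
  have "((\<lambda>t. w1 t * ?c t + of_int m * (w t * ?s t)) has_real_derivative (w2 t * ?c t + (of_int m)\<^sup>2 * (w t * ?c t))) (at t)" for t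
    by (rule derivative_eq_intros w refl)+ (simp add: algebra_simps power2_eq_square)
  then have "((\<lambda>t. w2 t * ?c t + (of_int m)\<^sup>2 * (w t * ?c t)) has_integral
      (w1 (2*pi) * ?c (2*pi) + of_int m * (w (2*pi) * ?s (2*pi))) - (w1 0 * ?c 0 + of_int m * (w 0 * ?s 0))) {0..2*pi}"
    by (intro fundamental_theorem_of_calculus)
      (auto simp flip: has_real_derivative_iff_has_vector_derivative intro: has_field_derivative_at_within)
  then have 1: "((\<lambda>t. w2 t * ?c t + (of_int m)\<^sup>2 * (w t * ?c t)) has_integral 0) {0..2*pi}"
    unfolding per p1 by simp
  have "continuous_on {0..2*pi} w"
    by (rule DERIV_continuous_on, rule has_field_derivative_at_within, rule w(1))
  then have "(\<lambda>t. w t * ?c t) integrable_on {0..2*pi}"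
    by (intro integrable_continuous_real continuous_intros)
  then have 2: "((\<lambda>t. (of_int m)\<^sup>2 * (w t * ?c t)) has_integral (of_int m)\<^sup>2 * integral {0..2*pi} (\<lambda>t. w t * ?c t)) {0..2*pi}"
    by (intro has_integral_mult_right integrable_integral)
  show ?thesis using has_integral_diff[OF 1 2] by simp
qed

text \<open>Angular Fourier coefficient; \<open>a = 0\<close> gives the cosine and
  \<open>a = pi / 2\<close> the sine coefficients.\<close>

definition trig_mode :: "(real \<Rightarrow> real \<Rightarrow> real) \<Rightarrow> int \<Rightarrow> real \<Rightarrow> real \<Rightarrow> real" where
  "trig_mode f m a r = integral {0..2*pi} (\<lambda>t. f r t * cos (of_int m * t - a))"

context polar_C2
begin

context
  fixes \<alpha> \<beta> :: real
  assumes sub: "\<And>r t. \<alpha> \<le> r \<Longrightarrow> r \<le> \<beta> \<Longrightarrow> polar r t \<in> W"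
begin

text \<open>Differentiation under the integral sign. Derivatives within the closed interval also
  provide the continuity at the ends that \<open>picone_vanish\<close> requires.\<close>

lemma
  assumes r: "r \<in> {\<alpha>..\<beta>}"
  shows DERIV_mode_U: "(trig_mode U m a has_real_derivative trig_mode Ur m a r) (at r within {\<alpha>..\<beta>})"
    and DERIV_mode_Ur: "(trig_mode Ur m a has_real_derivative trig_mode Urr m a r) (at r within {\<alpha>..\<beta>})"
proof -
  have 1: "((\<lambda>r. integral (cbox 0 (2*pi)) (\<lambda>t. U r t * cos (of_int m * t - a))) has_real_derivative
      integral (cbox 0 (2*pi)) (\<lambda>t. Ur r t * cos (of_int m * t - a))) (at r within {\<alpha>..\<beta>})"
  proof (rule leibniz_rule_field_derivative)
    show "((\<lambda>r. U r t * cos (of_int m * t - a)) has_real_derivative Ur r t * cos (of_int m * t - a)) (at r within {\<alpha>..\<beta>})"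
      if "r \<in> {\<alpha>..\<beta>}" for r t
      using DERIV_cmult_right[OF DERIV_U[OF sub]] that by (auto intro: has_field_derivative_at_within)
    show "(\<lambda>t. U r t * cos (of_int m * t - a)) integrable_on cbox 0 (2 * pi)" if "r \<in> {\<alpha>..\<beta>}" for r
      using that sub by (intro integrable_continuous continuous_intros continuous_on_U) auto
    show "continuous_on ({\<alpha>..\<beta>} \<times> cbox 0 (2 * pi)) (\<lambda>(r, t). Ur r t * cos (of_int m * t - a))"
      unfolding case_prod_beta using sub by (intro continuous_intros continuous_on_Ur) auto
  qed (use r in auto)
  show "(trig_mode U m a has_real_derivative trig_mode Ur m a r) (at r within {\<alpha>..\<beta>})"
    using 1 by (simp add: trig_mode_def[abs_def])
  have 2: "((\<lambda>r. integral (cbox 0 (2*pi)) (\<lambda>t. Ur r t * cos (of_int m * t - a))) has_real_derivative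
      integral (cbox 0 (2*pi)) (\<lambda>t. Urr r t * cos (of_int m * t - a))) (at r within {\<alpha>..\<beta>})"
  proof (rule leibniz_rule_field_derivative)
    show "((\<lambda>r. Ur r t * cos (of_int m * t - a)) has_real_derivative Urr r t * cos (of_int m * t - a)) (at r within {\<alpha>..\<beta>})"
      if "r \<in> {\<alpha>..\<beta>}" for r t
      using DERIV_cmult_right[OF DERIV_Ur[OF sub]] that by (auto intro: has_field_derivative_at_within)
    show "(\<lambda>t. Ur r t * cos (of_int m * t - a)) integrable_on cbox 0 (2 * pi)" if "r \<in> {\<alpha>..\<beta>}" for r
      using that sub by (intro integrable_continuous continuous_intros continuous_on_Ur) auto
    show "continuous_on ({\<alpha>..\<beta>} \<times> cbox 0 (2 * pi)) (\<lambda>(r, t). Urr r t * cos (of_int m * t - a))"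
      unfolding case_prod_beta using sub by (intro continuous_intros continuous_on_Urr) auto
  qed (use r in auto)
  show "(trig_mode Ur m a has_real_derivative trig_mode Urr m a r) (at r within {\<alpha>..\<beta>})"
    using 2 by (simp add: trig_mode_def[abs_def])
qed

text \<open>\<open>laplacian_polar\<close> is integrated against the cosine; moving both angular
  derivatives onto the cosine produces the factor \<open>(of_int m)\<^sup>2\<close>.\<close>

lemma mode_ode:
  assumes r: "r \<in> {\<alpha>..\<beta>}" and eq: "\<And>t. sphere_laplacian u (polar r t) = \<mu> * U r t"
  shows "(sin r)\<^sup>2 * trig_mode Urr m a r + sin r * cos r * trig_mode Ur m a r = ((of_int m)\<^sup>2 - \<mu> * (sin r)\<^sup>2) * trig_mode U m a r"
proof -
  let ?c = "\<lambda>t::real. cos (of_int m * t - a)"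
  have rW: "polar r t \<in> W" for t using r sub by auto
  have int: "((\<lambda>t. U r t * ?c t) has_integral trig_mode U m a r) {0..2*pi}"
    "((\<lambda>t. Ur r t * ?c t) has_integral trig_mode Ur m a r) {0..2*pi}"
    "((\<lambda>t. Urr r t * ?c t) has_integral trig_mode Urr m a r) {0..2*pi}"
    unfolding trig_mode_def
    by (intro integrable_integral integrable_continuous_real continuous_intros continuous_on_U continuous_on_Ur continuous_on_Urr rW)+
  have per: "U r (2*pi) = U r 0" "Ut r (2*pi) = Ut r 0"
    by (simp_all add: U_def Ut_def polar_def hor_def ang_def)
  have 1: "((\<lambda>t. Utt r t * ?c t) has_integral - (of_int m)\<^sup>2 * trig_mode U m a r) {0..2*pi}"
    unfolding trig_mode_def
    by (rule integral_by_parts_trig[of "U r" "Ut r" "Utt r"]) (use DERIV_U_t[OF rW] DERIV_Ut[OF rW] per in auto)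
  have "Utt r t * ?c t = - ((sin r)\<^sup>2 * (Urr r t * ?c t) + sin r * cos r * (Ur r t * ?c t) + \<mu> * (sin r)\<^sup>2 * (U r t * ?c t))" for t
  proof -
    have "Utt r t = - ((sin r)\<^sup>2 * Urr r t + sin r * cos r * Ur r t + \<mu> * (sin r)\<^sup>2 * U r t)"
      using laplacian_polar[OF rW, of t] unfolding eq by (simp add: algebra_simps)
    then show ?thesis by (simp only:) (simp add: algebra_simps)
  qed
  moreover have "((\<lambda>t. - ((sin r)\<^sup>2 * (Urr r t * ?c t) + sin r * cos r * (Ur r t * ?c t) + \<mu> * (sin r)\<^sup>2 * (U r t * ?c t))) has_integral
      - ((sin r)\<^sup>2 * trig_mode Urr m a r + sin r * cos r * trig_mode Ur m a r + \<mu> * (sin r)\<^sup>2 * trig_mode U m a r)) {0..2*pi}"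
    by (intro has_integral_neg has_integral_add has_integral_mult_right int)
  ultimately have "((\<lambda>t. Utt r t * ?c t) has_integral
      - ((sin r)\<^sup>2 * trig_mode Urr m a r + sin r * cos r * trig_mode Ur m a r + \<mu> * (sin r)\<^sup>2 * trig_mode U m a r)) {0..2*pi}"
    by simp
  from has_integral_unique[OF 1 this] show ?thesis by (simp add: algebra_simps)
qed

lemma modes_zero_imp_zero:
  assumes r: "r \<in> {\<alpha>..\<beta>}" and "\<And>m a. trig_mode U m a r = 0"
  shows "U r t = 0"
proof -
  \<comment> \<open>The restriction of \<open>u\<close> to a parallel, transported to the unit
    circle of the complex plane as \<open>orthogonal_trig_imp_zero\<close> expects.\<close>
  define v where "v z = u (cos r *\<^sub>R p + sin r *\<^sub>R (Re z *\<^sub>R e1 + Im z *\<^sub>R e2))" for z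
  have vc: "v (cis t) = U r t" for t by (simp add: v_def U_def polar_def hor_def)
  have cu: "continuous_on W u" using du by (auto intro!: continuous_at_imp_continuous_on has_derivative_continuous)
  have "continuous_on (sphere 0 1) v" unfolding v_def
  proof (rule continuous_on_compose2[OF cu])
    show "continuous_on (sphere 0 1) (\<lambda>z. cos r *\<^sub>R p + sin r *\<^sub>R (Re z *\<^sub>R e1 + Im z *\<^sub>R e2))"
      by (intro continuous_intros)
    show "(\<lambda>z. cos r *\<^sub>R p + sin r *\<^sub>R (Re z *\<^sub>R e1 + Im z *\<^sub>R e2)) ` sphere 0 1 \<subseteq> W"
    proof safe
      fix z :: complex assume "z \<in> sphere 0 1"
      then have "z = cis (Arg2pi z)" using Arg2pi_eq[of z] by (simp add: cis_conv_exp)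
      then have "cos r *\<^sub>R p + sin r *\<^sub>R (Re z *\<^sub>R e1 + Im z *\<^sub>R e2) = polar r (Arg2pi z)"
        unfolding polar_def hor_def by (metis cis.simps)
      then show "cos r *\<^sub>R p + sin r *\<^sub>R (Re z *\<^sub>R e1 + Im z *\<^sub>R e2) \<in> W" using sub r by simp
    qed
  qed
  then have "v (cis t) = 0"
    by (rule orthogonal_trig_imp_zero) (use assms(2) in \<open>auto simp: vc trig_mode_def\<close>)
  then show ?thesis by (simp add: vc)
qed

end

end

section \<open>Zones in polar coordinates\<close>

context orthonormal_frame
begin

lemma inner_p_polar [simp]: "p \<bullet> polar r t = cos r"
  by (simp add: inner_polar_right)

lemma polar_in_zone:
  assumes "0 \<le> \<alpha>" "\<alpha> < r" "r < \<beta>" "\<beta> \<le> pi"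
  shows "polar r t \<in> zone p \<alpha> \<beta>"
  using assms by (simp add: zone_def cos_mono_less_eq del: mem_sphere_0) (use polar_S2 in simp)

lemma polar_in_closure_zone:
  assumes "0 \<le> \<alpha>" "\<alpha> < \<beta>" "\<beta> \<le> pi" "\<alpha> \<le> r" "r \<le> \<beta>"
  shows "polar r t \<in> closure (zone p \<alpha> \<beta>)"
proof -
  have "(\<lambda>r. polar r t) ` closure {\<alpha><..<\<beta>} \<subseteq> closure (zone p \<alpha> \<beta>)"
  proof (rule image_closure_subset)
    show "continuous_on (closure {\<alpha><..<\<beta>}) (\<lambda>r. polar r t)" by (intro continuous_intros)
    show "(\<lambda>r. polar r t) ` {\<alpha><..<\<beta>} \<subseteq> closure (zone p \<alpha> \<beta>)"
      using polar_in_zone assms closure_subset by fastforce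
  qed simp
  then show ?thesis using assms by auto
qed

lemma polar_in_boundary:
  assumes ab: "0 \<le> \<alpha>" "\<alpha> < \<beta>" "\<beta> \<le> pi" and r: "r = \<beta> \<or> (\<alpha> \<noteq> 0 \<and> r = \<alpha>)"
  shows "polar r t \<notin> zone p \<alpha> \<beta>" "polar r t \<in> sphere_boundary (zone p \<alpha> \<beta>)"
proof -
  show *: "polar r t \<notin> zone p \<alpha> \<beta>" using r by (auto simp: zone_def)
  have "S2 \<inter> zone p \<alpha> \<beta> = zone p \<alpha> \<beta>" by (auto simp: zone_def)
  then have "polar r t \<in> top_of_set S2 closure_of zone p \<alpha> \<beta>"
    using polar_in_closure_zone[of \<alpha> \<beta> r t] ab r polar_S2 by (auto simp: closure_of_subtopology)
  moreover have "polar r t \<notin> top_of_set S2 interior_of zone p \<alpha> \<beta>"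
    using * interior_of_subset by fastforce
  ultimately show "polar r t \<in> sphere_boundary (zone p \<alpha> \<beta>)" by (simp add: frontier_of_def)
qed

text \<open>An arbitrary defining function \<open>\<phi>\<close> is nonnegative along the parallel
  through the boundary point, since the parallel avoids the zone, and is 0 at the point itself. This
  local minimum kills the component of the gradient along \<open>ang t\<close>.\<close>

lemma outward_unit_normal_polar:
  assumes ab: "0 \<le> \<alpha>" "\<alpha> < \<beta>" "\<beta> < pi" and r: "r = \<beta> \<or> (\<alpha> \<noteq> 0 \<and> r = \<alpha>)"
    and \<nu>: "outward_unit_normal (zone p \<alpha> \<beta>) (polar r t) \<nu>"
  obtains c where "c \<noteq> 0" "\<nu> = c *\<^sub>R rad r t"
proof -
  let ?x = "polar r t"
  obtain V \<phi> where V: "open V" "?x \<in> V" "C1_on V \<phi>" "\<phi> ?x = 0"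
    "zone p \<alpha> \<beta> \<inter> V = {y \<in> S2 \<inter> V. \<phi> y < 0}" "surface_grad \<phi> ?x \<noteq> 0" "\<nu> = sgn (surface_grad \<phi> ?x)"
    using \<nu> unfolding outward_unit_normal_def by blast
  have "(\<phi> has_derivative (\<lambda>h. grad \<phi> ?x \<bullet> h)) (at ?x)"
    using C1_onD(1)[OF V(3,2)] by (rule has_derivative_grad)
  from has_vector_derivative_chain[OF polar_derivs(3) this]
  have d: "((\<lambda>t. \<phi> (polar r t)) has_real_derivative grad \<phi> ?x \<bullet> (sin r *\<^sub>R ang t)) (at t)"
    unfolding has_real_derivative_iff_has_vector_derivative .
  have "open ((\<lambda>t. polar r t) -` V)"
    by (intro open_vimage V(1) continuous_intros)
  then obtain d where d0: "d > 0" "ball t d \<subseteq> (\<lambda>t. polar r t) -` V"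
    using V(2) open_contains_ball by (metis vimageI)
  have "grad \<phi> ?x \<bullet> (sin r *\<^sub>R ang t) = 0"
  proof (rule DERIV_local_min[OF d d0(1)], intro allI impI)
    fix s assume "\<bar>t - s\<bar> < d"
    then have "polar r s \<in> V" using d0(2) by (auto simp: dist_real_def)
    moreover have "polar r s \<notin> zone p \<alpha> \<beta>" using polar_in_boundary(1)[of \<alpha> \<beta> r s] ab r by auto
    ultimately have "\<not> \<phi> (polar r s) < 0" using V(5) polar_S2 by blast
    then show "\<phi> (polar r t) \<le> \<phi> (polar r s)" using V(4) by simp
  qed
  moreover have "sin r > 0" using ab r by (intro sin_gt_zero) auto
  ultimately have "grad \<phi> ?x \<bullet> ang t = 0" by simp
  then have sg: "surface_grad \<phi> ?x = (grad \<phi> ?x \<bullet> rad r t) *\<^sub>R rad r t"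
    unfolding surface_grad_def tangent_proj_polar by simp
  show ?thesis
  proof (rule that)
    show "\<nu> = ((grad \<phi> ?x \<bullet> rad r t) / norm (surface_grad \<phi> ?x)) *\<^sub>R rad r t"
      unfolding V(7) sgn_div_norm by (subst (2) sg) (simp add: divide_inverse mult.commute)
    show "(grad \<phi> ?x \<bullet> rad r t) / norm (surface_grad \<phi> ?x) \<noteq> 0"
      using V(6) sg by auto
  qed
qed

end

section \<open>Lower bound for the eigenvalues\<close>

text \<open>Passing to \<open>K = sin r * F' / F\<close> with \<open>F r = sin r * g (cos r)\<close>
  turns the linear equation of the first mode, with eigenvalue \<open>2 - \<eta>\<close>, into a
  Riccati equation.\<close>

lemma DERIV_riccati:
  assumes g: "(g has_real_derivative g' z) (at z)" "(g' has_real_derivative g'' z) (at z)" and z: "z = cos r"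
    and ode: "(1 - z\<^sup>2) * g'' z - 4 * z * g' z = \<eta> * g z" and nz: "g z \<noteq> 0" "sin r \<noteq> 0"
  defines "K \<equiv> \<lambda>r. cos r - (sin r)\<^sup>2 * (g' (cos r) / g (cos r))"
  shows "(K has_real_derivative (1 - (K r)\<^sup>2) / sin r - (2 - \<eta>) * sin r) (at r)"
proof -
  define s h where "s = sin r" and "h = g' z / g z"
  have s: "s \<noteq> 0" "s\<^sup>2 = 1 - z\<^sup>2" using nz by (auto simp: s_def z sin_squared_eq)
  have c: "(cos has_real_derivative - s) (at r)" using DERIV_cos[of r] by (simp add: s_def)
  have gc: "((\<lambda>r. g (cos r)) has_real_derivative g' z * (- s)) (at r)"
    using DERIV_chain2[of g "g' z" cos r "- s" UNIV] g(1) c by (simp add: z)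
  have g'c: "((\<lambda>r. g' (cos r)) has_real_derivative g'' z * (- s)) (at r)"
    using DERIV_chain2[of g' "g'' z" cos r "- s" UNIV] g(2) c by (simp add: z)
  have q: "((\<lambda>r. g' (cos r) / g (cos r)) has_real_derivative (g'' z * (- s) * g z - g' z * (g' z * (- s))) / (g z * g z)) (at r)"
    using DERIV_divide[OF g'c gc] nz by (simp add: z)
  have s2: "((\<lambda>r. (sin r)\<^sup>2) has_real_derivative 2 * s * z) (at r)"
    by (rule derivative_eq_intros refl)+ (simp add: s_def z)
  have D: "(K has_real_derivative - s - (2 * s * z * h + (g'' z * (- s) * g z - g' z * (g' z * (- s))) / (g z * g z) * s\<^sup>2)) (at r)"
    unfolding K_def using DERIV_diff[OF c DERIV_mult[OF s2 q]] by (simp add: h_def z s_def)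
  have gz: "g'' z * s\<^sup>2 = (4 * z * h + \<eta>) * g z"
    using ode nz(1) unfolding s(2) by (simp add: h_def algebra_simps)
  have "(g'' z * (- s) * g z - g' z * (g' z * (- s))) / (g z * g z) * s\<^sup>2 = - s * ((g'' z * s\<^sup>2) / g z - h\<^sup>2 * s\<^sup>2)"
    using nz(1) by (simp add: h_def field_simps power2_eq_square)
  also have "\<dots> = - s * (4 * z * h + \<eta> - h\<^sup>2 * s\<^sup>2)" unfolding gz using nz(1) by simp
  finally have e1: "(g'' z * (- s) * g z - g' z * (g' z * (- s))) / (g z * g z) * s\<^sup>2 = - s * (4 * z * h + \<eta> - h\<^sup>2 * s\<^sup>2)" .
  have Kr: "K r = z - s\<^sup>2 * h" by (simp add: K_def z s_def h_def)
  have "1 - (K r)\<^sup>2 = (1 - z\<^sup>2) + 2 * z * s\<^sup>2 * h - (s\<^sup>2 * h)\<^sup>2"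
    unfolding Kr by (simp add: power2_eq_square algebra_simps)
  also have "\<dots> = s * (s + 2 * z * s * h - s * s\<^sup>2 * h\<^sup>2)"
    unfolding s(2)[symmetric] by (simp add: power2_eq_square algebra_simps)
  finally have "(1 - (K r)\<^sup>2) / s = s + 2 * z * s * h - s * s\<^sup>2 * h\<^sup>2" using s(1) by simp
  then have "(1 - (K r)\<^sup>2) / sin r - (2 - \<eta>) * sin r = - s - (2 * s * z * h + - s * (4 * z * h + \<eta> - h\<^sup>2 * s\<^sup>2))"
    unfolding s_def[symmetric] by (simp add: algebra_simps)
  then show ?thesis using D unfolding e1 by simp
qed

text \<open>An eigenvalue below \<open>2 - \<eta>\<close> would make all angular modes vanish, and
  with them \<open>u\<close> on the zone. For \<open>\<alpha> = 0\<close> there is no boundary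
  condition at the inner end; the regularity of \<open>u\<close> at \<open>p\<close> replaces
  it.\<close>

lemma neumann_eigenvalue_zone_ge:
  assumes p: "p \<in> S2" and ab: "0 \<le> \<alpha>" "\<alpha> < \<beta>" "\<beta> < pi"
    and J: "{cos \<beta>..cos \<alpha>} \<subseteq> J"
    and g: "\<And>z. z \<in> J \<Longrightarrow> (g has_real_derivative g' z) (at z)"
    and g': "\<And>z. z \<in> J \<Longrightarrow> (g' has_real_derivative g'' z) (at z)"
    and ode: "\<And>z. z \<in> J \<Longrightarrow> (1 - z\<^sup>2) * g'' z - 4 * z * g' z = \<eta> * g z"
    and pos: "\<And>z. z \<in> {cos \<beta>..cos \<alpha>} \<Longrightarrow> g z > 0"
    and bc: "\<And>r. r = \<beta> \<or> (\<alpha> \<noteq> 0 \<and> r = \<alpha>) \<Longrightarrow> cos r * g (cos r) = (1 - (cos r)\<^sup>2) * g' (cos r)"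
    and ev: "neumann_eigenvalue (zone p \<alpha> \<beta>) \<mu>" and \<mu>0: "\<mu> > 0"
  shows "2 - \<eta> \<le> \<mu>"
proof (rule ccontr)
  assume "\<not> 2 - \<eta> \<le> \<mu>"
  then have \<mu>: "\<mu> < 2 - \<eta>" by simp
  obtain u W where oW: "open W" "closure (zone p \<alpha> \<beta>) \<subseteq> W" "C2_on W u"
    and nz: "\<exists>x\<in>zone p \<alpha> \<beta>. u x \<noteq> 0"
    and lap: "\<And>x. x \<in> zone p \<alpha> \<beta> \<Longrightarrow> sphere_laplacian u x = \<mu> * u x"
    and neu: "\<And>x. x \<in> sphere_boundary (zone p \<alpha> \<beta>) \<Longrightarrow> \<exists>\<nu>. outward_unit_normal (zone p \<alpha> \<beta>) x \<nu> \<and> surface_grad u x \<bullet> \<nu> = 0"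
    using ev unfolding neumann_eigenvalue_def neumann_eigenfunction_def by metis
  obtain e1 e2 where fr: "p \<bullet> p = 1" "e1 \<bullet> e1 = 1" "e2 \<bullet> e2 = 1" "p \<bullet> e1 = 0" "p \<bullet> e2 = 0" "e1 \<bullet> e2 = 0"
    "\<And>x. x = (x \<bullet> p) *\<^sub>R p + (x \<bullet> e1) *\<^sub>R e1 + (x \<bullet> e2) *\<^sub>R e2"
    using orthonormal_frame[OF p] by metis
  interpret orthonormal_frame p e1 e2 by (unfold_locales; fact fr)
  have C: "C1_on W u" "C1_on W (grad u)" using oW(3) by (auto simp: C2_on_def)
  interpret polar_C2 p e1 e2 u W "\<lambda>x. frechet_derivative (grad u) (at x)"
  proof unfold_locales
    show "(u has_derivative (\<bullet>) (grad u x)) (at x)" if "x \<in> W" for x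
      using has_derivative_grad[OF C1_onD(1)[OF C(1) that]] .
    show "(grad u has_derivative frechet_derivative (grad u) (at x)) (at x)" if "x \<in> W" for x
      using C1_onD(1)[OF C(2) that] frechet_derivative_works by blast
    show "continuous_on W (\<lambda>x. frechet_derivative (grad u) (at x) h)" for h by (rule C1_onD(2)[OF C(2)])
  qed (fact oW(1))
  have sub: "polar r t \<in> W" if "\<alpha> \<le> r" "r \<le> \<beta>" for r t
    using polar_in_closure_zone[of \<alpha> \<beta> r t] that ab oW(2) by auto
  \<comment> \<open>The eigenfunction comes with some admissible normal;
    \<open>outward_unit_normal_polar\<close> shows that it is radial.\<close>
  have Ur0: "Ur r t = 0" if r: "r = \<beta> \<or> (\<alpha> \<noteq> 0 \<and> r = \<alpha>)" for r t
  proof -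
    obtain \<nu> where \<nu>: "outward_unit_normal (zone p \<alpha> \<beta>) (polar r t) \<nu>" "surface_grad u (polar r t) \<bullet> \<nu> = 0"
      using neu polar_in_boundary(2)[OF ab(1,2) _ r] ab(3) by (meson less_imp_le)
    obtain c where c: "c \<noteq> 0" "\<nu> = c *\<^sub>R rad r t" using outward_unit_normal_polar[OF ab r \<nu>(1)] by blast
    then have "surface_grad u (polar r t) \<bullet> rad r t = 0" using \<nu>(2) by simp
    then show ?thesis
      by (simp add: Ur_def surface_grad_def tangent_proj_def inner_diff_left polar_inner_rad)
  qed
  have sin: "sin r > 0" if "\<alpha> < r" "r < \<beta>" for r
    using that ab by (intro sin_gt_zero) auto
  \<comment> \<open>\<open>K = sin r * F' / F\<close> for the first mode \<open>F r = sin r * g (cos r)\<close>; unlike \<open>F' / F\<close> it is continuous at \<open>r = 0\<close>.\<close>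
  define K where "K = (\<lambda>r. cos r - (sin r)\<^sup>2 * (g' (cos r) / g (cos r)))"
  have cosI: "cos r \<in> {cos \<beta>..cos \<alpha>}" if "r \<in> {\<alpha>..\<beta>}" for r
    using that ab by (auto simp: cos_mono_le_eq)
  have gpos: "g (cos r) > 0" if "r \<in> {\<alpha>..\<beta>}" for r by (rule pos[OF cosI[OF that]])
  have cg: "continuous_on J g" by (rule DERIV_continuous_on, rule has_field_derivative_at_within, fact g)
  have cg': "continuous_on J g'" by (rule DERIV_continuous_on, rule has_field_derivative_at_within, fact g')
  have cosJ: "cos ` {\<alpha>..\<beta>} \<subseteq> J" using cosI J by blast
  have cK: "continuous_on {\<alpha>..\<beta>} K" unfolding K_def
  proof (intro continuous_on_diff continuous_on_mult continuous_on_divide continuous_on_power)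
    show "continuous_on {\<alpha>..\<beta>} (\<lambda>x. g (cos x))" by (rule continuous_on_compose2[OF cg _ cosJ]) (intro continuous_intros)
    show "continuous_on {\<alpha>..\<beta>} (\<lambda>x. g' (cos x))" by (rule continuous_on_compose2[OF cg' _ cosJ]) (intro continuous_intros)
    show "\<forall>x\<in>{\<alpha>..\<beta>}. g (cos x) \<noteq> 0" using gpos by fastforce
  qed (intro continuous_intros)+
  have K': "(K has_real_derivative (1 - (K r)\<^sup>2) / sin r - (2 - \<eta>) * sin r) (at r)" if "\<alpha> < r" "r < \<beta>" for r
  proof -
    have r: "r \<in> {\<alpha>..\<beta>}" using that by simp
    then have "cos r \<in> J" using cosJ by blast
    then show ?thesis unfolding K_def
      using g g' ode gpos[OF r] sin[OF that] by (intro DERIV_riccati[where g'' = g'']) auto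
  qed
  have K0: "K r = 0" if "r = \<beta> \<or> (\<alpha> \<noteq> 0 \<and> r = \<alpha>)" for r
  proof -
    have "r \<in> {\<alpha>..\<beta>}" using that ab by auto
    then show ?thesis using bc[OF that] gpos[of r] by (simp add: K_def sin_squared_eq field_simps)
  qed
  have dU: "(trig_mode U m a has_real_derivative trig_mode Ur m a r) (at r)"
    and dUr: "(trig_mode Ur m a has_real_derivative trig_mode Urr m a r) (at r)" if "\<alpha> < r" "r < \<beta>" for m a r
    using DERIV_mode_U[OF sub, of \<alpha> \<beta> r m a] DERIV_mode_Ur[OF sub, of \<alpha> \<beta> r m a] that
    by (auto simp: at_within_Icc_at)
  have cU: "continuous_on {\<alpha>..\<beta>} (trig_mode U m a)" for m a
    by (rule DERIV_continuous_on, rule DERIV_mode_U[OF sub])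
  have cUr: "continuous_on {\<alpha>..\<beta>} (trig_mode Ur m a)" for m a
    by (rule DERIV_continuous_on, rule DERIV_mode_Ur[OF sub])
  have ode_m: "(sin r)\<^sup>2 * trig_mode Urr m a r + sin r * cos r * trig_mode Ur m a r = ((of_int m)\<^sup>2 - \<mu> * (sin r)\<^sup>2) * trig_mode U m a r"
    if r: "\<alpha> < r" "r < \<beta>" for m a r
  proof (rule mode_ode[OF sub])
    show "sphere_laplacian u (polar r t) = \<mu> * U r t" for t
      using lap polar_in_zone[of \<alpha> r \<beta> t] ab r by (simp add: U_def)
  qed (use r in auto)
  have Ur_bd: "trig_mode Ur m a r = 0" if "r = \<beta> \<or> (\<alpha> \<noteq> 0 \<and> r = \<alpha>)" for m a r
    unfolding trig_mode_def using Ur0[OF that] by simp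
  have cos_int: "((\<lambda>t. k * cos (of_int m * t - a)) has_integral 0) {0..2*pi}" if "m \<noteq> 0" for k a and m :: int
  proof -
    \<comment> \<open>With a constant \<open>w\<close>, integration by parts equates the integral of
      0 with a nonzero multiple of the desired integral.\<close>
    have "((\<lambda>t. 0 * cos (of_int m * t - a)) has_integral - (of_int m)\<^sup>2 * integral {0..2*pi} (\<lambda>t. k * cos (of_int m * t - a))) {0..2*pi}"
      by (rule integral_by_parts_trig[of "\<lambda>_. k" "\<lambda>_. 0" "\<lambda>_. 0" m a]) auto
    then have "- (of_int m)\<^sup>2 * integral {0..2*pi} (\<lambda>t. k * cos (of_int m * t - a)) = 0"
      using has_integral_unique[OF _ has_integral_0] by simp
    then have "integral {0..2*pi} (\<lambda>t. k * cos (of_int m * t - a)) = 0" using that by simp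
    moreover have "(\<lambda>t. k * cos (of_int m * t - a)) integrable_on {0..2*pi}"
      by (intro integrable_continuous_real continuous_intros)
    ultimately show ?thesis by (metis integrable_integral)
  qed
  have mode_nz: "trig_mode U m a r = 0" if m: "m \<noteq> 0" and r: "\<alpha> < r" "r < \<beta>" for m a r
  proof (rule picone_vanish[where f = "trig_mode U m a" and r = r and \<alpha> = \<alpha> and \<beta> = \<beta> and q = "\<lambda>r. sin r * trig_mode Ur m a r" and K = K and l = "(of_int m)\<^sup>2" and \<mu> = \<mu> and \<nu> = "2 - \<eta>"])
    show "continuous_on {\<alpha>..\<beta>} (\<lambda>r. sin r * trig_mode Ur m a r)" by (intro continuous_intros cUr)
    show "(trig_mode U m a has_real_derivative sin r * trig_mode Ur m a r / sin r) (at r)" if "\<alpha> < r" "r < \<beta>" for r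
      using dU[OF that] sin[OF that] by simp
    show "((\<lambda>r. sin r * trig_mode Ur m a r) has_real_derivative (of_int m)\<^sup>2 * trig_mode U m a r / sin r - \<mu> * sin r * trig_mode U m a r) (at r)"
      if "\<alpha> < r" "r < \<beta>" for r
    proof -
      have "sin r * (cos r * trig_mode Ur m a r + trig_mode Urr m a r * sin r) = ((of_int m)\<^sup>2 - \<mu> * (sin r)\<^sup>2) * trig_mode U m a r"
        using ode_m[OF that, of m a] by (simp add: algebra_simps power2_eq_square)
      then have e: "cos r * trig_mode Ur m a r + trig_mode Urr m a r * sin r = (of_int m)\<^sup>2 * trig_mode U m a r / sin r - \<mu> * sin r * trig_mode U m a r"
        using sin[OF that] by (simp add: field_simps power2_eq_square)
      show ?thesis using DERIV_mult[OF DERIV_sin dUr[OF that, of m a]] unfolding e .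
    qed
    have "m\<^sup>2 \<ge> 1" using m by (metis int_one_le_iff_zero_less zero_less_power2)
    then show "1 \<le> (real_of_int m)\<^sup>2" by (metis of_int_1_le_iff of_int_power)
    show "trig_mode U m a \<beta> = 0 \<or> sin \<beta> * trig_mode Ur m a \<beta> = 0 \<and> K \<beta> = 0" using Ur_bd K0 by simp
    show "trig_mode U m a \<alpha> = 0 \<or> sin \<alpha> * trig_mode Ur m a \<alpha> = 0 \<and> K \<alpha> = 0"
    proof (cases "\<alpha> = 0")
      case True
      \<comment> \<open>All meridians meet in \<open>p\<close>, so \<open>U 0 t\<close> is constant
        in \<open>t\<close> and has no mode with \<open>m \<noteq> 0\<close>.\<close>
      have "trig_mode U m a 0 = 0"
        unfolding trig_mode_def U_def using integral_unique[OF cos_int[OF m, of "u p" a]] by (simp add: polar_def)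
      then show ?thesis using True by simp
    qed (use Ur_bd K0 in simp)
  qed (use ab K' \<mu> cU cK r in auto)
  have mode_0: "trig_mode U 0 0 r = 0" if r: "\<alpha> < r" "r < \<beta>" for r
  proof -
    \<comment> \<open>The derivative of the radial mode solves the equation of the first mode and vanishes at both ends.\<close>
    define q where "q = (\<lambda>r. - (cos r * trig_mode Ur 0 0 r) - \<mu> * (sin r * trig_mode U 0 0 r))"
    \<comment> \<open>Thanks to the equation, \<open>q\<close> involves only \<open>U\<close> and
      \<open>Ur\<close>; it can thus be differentiated once more although \<open>u\<close> is only
      of class C^2.\<close>
    have q: "trig_mode Urr 0 0 r = q r / sin r" if "\<alpha> < r" "r < \<beta>" for r
    proof -
      have "sin r * (sin r * trig_mode Urr 0 0 r) = sin r * q r"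
        using ode_m[OF that, of 0 0] by (simp add: q_def algebra_simps power2_eq_square)
      then show ?thesis using sin[OF that] by (simp add: field_simps)
    qed
    have Ur00: "trig_mode Ur 0 0 r = 0" if r: "\<alpha> < r" "r < \<beta>" for r
    proof (rule picone_vanish[where f = "trig_mode Ur 0 0" and r = r and \<alpha> = \<alpha> and \<beta> = \<beta> and q = q and K = K and l = 1 and \<mu> = \<mu> and \<nu> = "2 - \<eta>"])
      show "continuous_on {\<alpha>..\<beta>} q" unfolding q_def by (intro continuous_intros cUr cU)
      show "(trig_mode Ur 0 0 has_real_derivative q r / sin r) (at r)" if "\<alpha> < r" "r < \<beta>" for r
        using dUr[OF that, of 0 0] unfolding q[OF that] .
      show "(q has_real_derivative 1 * trig_mode Ur 0 0 r / sin r - \<mu> * sin r * trig_mode Ur 0 0 r) (at r)" if "\<alpha> < r" "r < \<beta>" for r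
      proof -
        let ?s = "sin r" and ?c = "cos r"
        have d: "(q has_real_derivative - (- ?s * trig_mode Ur 0 0 r + trig_mode Urr 0 0 r * ?c) - \<mu> * (?c * trig_mode U 0 0 r + trig_mode Ur 0 0 r * ?s)) (at r)"
          unfolding q_def
          by (intro DERIV_diff DERIV_minus DERIV_cmult DERIV_mult DERIV_sin DERIV_cos dU dUr that)
        have "?s * trig_mode Urr 0 0 r = q r" using q[OF that] sin[OF that] by (simp add: field_simps)
        then have "?s * (- (- ?s * trig_mode Ur 0 0 r + trig_mode Urr 0 0 r * ?c) - \<mu> * (?c * trig_mode U 0 0 r + trig_mode Ur 0 0 r * ?s))
            = ?s * ?s * trig_mode Ur 0 0 r - ?c * q r - \<mu> * (?s * ?c * trig_mode U 0 0 r + ?s * ?s * trig_mode Ur 0 0 r)"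
          by (simp add: algebra_simps)
        also have "\<dots> = (?s * ?s * trig_mode Ur 0 0 r + ?c * ?c * trig_mode Ur 0 0 r) - \<mu> * ?s * ?s * trig_mode Ur 0 0 r"
          by (simp add: q_def algebra_simps)
        also have "\<dots> = (?s * ?s + ?c * ?c) * trig_mode Ur 0 0 r - \<mu> * ?s * ?s * trig_mode Ur 0 0 r"
          by (simp only: distrib_right)
        also have "\<dots> = ?s * (1 * trig_mode Ur 0 0 r / ?s - \<mu> * ?s * trig_mode Ur 0 0 r)"
        proof -
          have one: "?s * ?s + ?c * ?c = 1" using sin_cos_squared_add3[of r] by linarith
          show ?thesis unfolding one using sin[OF that] by (simp add: algebra_simps)
        qed
        finally show ?thesis using d sin[OF that] by simp
      qed
      show "trig_mode Ur 0 0 \<beta> = 0 \<or> q \<beta> = 0 \<and> K \<beta> = 0" using Ur_bd by simp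
      show "trig_mode Ur 0 0 \<alpha> = 0 \<or> q \<alpha> = 0 \<and> K \<alpha> = 0"
      proof (cases "\<alpha> = 0")
        case True
        \<comment> \<open>At the pole \<open>Ur 0 t\<close> is
          \<open>grad u p \<bullet> hor t\<close>, a pure first harmonic with mean 0.\<close>
        have "((\<lambda>t. (grad u p \<bullet> e1) * cos (of_int 1 * t - 0) + (grad u p \<bullet> e2) * cos (of_int 1 * t - pi / 2)) has_integral 0 + 0) {0..2*pi}"
          by (intro has_integral_add cos_int) auto
        then have "trig_mode Ur 0 0 0 = 0"
          unfolding trig_mode_def Ur_def by (intro integral_unique) (simp add: polar_def inner_polar_right cos_diff mult_ac)
        then show ?thesis using True by simp
      qed (use Ur_bd in simp)
    qed (use ab K' \<mu> cUr cK r in auto)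
    have "((\<lambda>_. 0) has_real_derivative trig_mode Urr 0 0 r) (at r)"
      by (rule has_field_derivative_transform_within_open[OF dUr[OF r], of "{\<alpha><..<\<beta>}"]) (use r Ur00 in auto)
    from DERIV_unique[OF this DERIV_const] have "trig_mode Urr 0 0 r = 0" .
    \<comment> \<open>The radial mode is constant by now, and \<open>\<mu> > 0\<close> excludes
      nonzero constants.\<close>
    then show ?thesis using ode_m[OF r, of 0 0] Ur00[OF r] sin[OF r] \<mu>0 by simp
  qed
  have "trig_mode U m a r = 0" if r: "\<alpha> < r" "r < \<beta>" for m a r
  proof (cases "m = 0")
    case True
    have "integral {0..2*pi} (\<lambda>t. U r t * cos a) = cos a * integral {0..2*pi} (U r)" by (simp add: mult.commute)
    then show ?thesis using mode_0[OF r] True by (simp add: trig_mode_def)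
  qed (use mode_nz r in blast)
  then have Uz: "U r t = 0" if "\<alpha> < r" "r < \<beta>" for r t
    using modes_zero_imp_zero[OF sub, of \<alpha> \<beta> r t] that by simp
  obtain x where x: "x \<in> zone p \<alpha> \<beta>" "u x \<noteq> 0" using nz by blast
  then have xS: "x \<in> S2" by (simp add: zone_def)
  define r where "r = arccos (p \<bullet> x)"
  obtain t where t: "x = polar r t" using polar_cover[OF xS] unfolding r_def by blast
  have gd: "geodesic_dist p x = r" by (simp add: geodesic_dist_def r_def)
  have r: "r < \<beta>" "\<alpha> \<noteq> 0 \<Longrightarrow> \<alpha> < r"
    using x(1) geodesic_dist_less_iff[OF p xS, of \<beta>] geodesic_dist_less_iff[OF p xS, of \<alpha>] ab gd
    by (auto simp: zone_def)
  have r0: "r \<ge> 0" using abs_inner_S2[OF p xS] arccos_lbound[of "p \<bullet> x"] by (simp add: r_def abs_le_iff)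
  show False
  proof (cases "\<alpha> < r")
    case True
    then show False using Uz[of r t] r x(2) t by (simp add: U_def)
  next
    case False
    then have "\<alpha> = 0" using r by blast
    then have z: "\<alpha> = 0" "r = 0" using r r0 False by auto
    \<comment> \<open>The centre of a disk is not covered by \<open>Uz\<close>; it is reached by
      continuity along a meridian.\<close>
    have "isCont (\<lambda>r. U r t) 0" using DERIV_isCont[OF DERIV_U[OF sub, of 0 t]] z ab by simp
    then have "((\<lambda>r. U r t) \<longlongrightarrow> U 0 t) (at_right 0)"
      by (simp add: isCont_def filterlim_at_split)
    moreover have "eventually (\<lambda>r. U r t = 0) (at_right 0)"
      using z ab Uz[of _ t] by (intro eventually_at_right_less[THEN eventually_mono] eventually_at_rightI[of 0 \<beta>]) auto
    then have "((\<lambda>r. U r t) \<longlongrightarrow> 0) (at_right 0)" by (rule tendsto_eventually)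
    ultimately have "U 0 t = 0" using tendsto_unique trivial_limit_at_right_real by blast
    then show False using x(2) t z by (simp add: U_def)
  qed
qed

section \<open>Areas of zones\<close>

lemma has_derivative_compose_nth:
  fixes g :: "real \<Rightarrow> real" and y :: "real^'n"
  assumes "(g has_real_derivative D) (at (y $ i))"
  shows "((\<lambda>y. g (y $ i)) has_derivative (\<lambda>h. D * (h $ i))) (at y within S)"
proof -
  have "((\<lambda>y::real^'n. y $ i) has_derivative (\<lambda>h. h $ i)) (at y within S)"
    by (intro bounded_linear_imp_has_derivative bounded_linear_vec_nth)
  from DERIV_compose_FDERIV[OF assms this] show ?thesis by (simp add: mult.commute)
qed

text \<open>The first variable is the cube of the distance to the origin, which makes the Jacobian constant.\<close>

definition cone_map :: "real^3 \<Rightarrow> real^3" where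
  "cone_map y = (y $ 1 powr (1 / 3) * (sqrt (1 - (y $ 3)\<^sup>2) * cos (y $ 2))) *\<^sub>R axis 1 1
     + (y $ 1 powr (1 / 3) * (sqrt (1 - (y $ 3)\<^sup>2) * sin (y $ 2))) *\<^sub>R axis 2 1
     + (y $ 1 powr (1 / 3) * y $ 3) *\<^sub>R axis 3 1"

lemma cone_map_nth:
  "cone_map y $ 1 = y $ 1 powr (1 / 3) * (sqrt (1 - (y $ 3)\<^sup>2) * cos (y $ 2))"
  "cone_map y $ 2 = y $ 1 powr (1 / 3) * (sqrt (1 - (y $ 3)\<^sup>2) * sin (y $ 2))"
  "cone_map y $ 3 = y $ 1 powr (1 / 3) * y $ 3"
  by (simp_all add: cone_map_def axis_def)

text \<open>In distance \<open>t\<close>, angle and height on the unit sphere, the volume element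
  has density \<open>t\<^sup>2\<close>; since \<open>y $ 1 = t ^ 3\<close> has derivative
  \<open>3 * t\<^sup>2\<close>, the factor 1/3 remains.\<close>

lemma cone_map_derivative:
  assumes w: "y $ 1 > 0" and z: "\<bar>y $ 3\<bar> < 1"
  obtains D where "\<And>S. (cone_map has_derivative D) (at y within S)" "det (matrix D) = 1 / 3"
proof -
  define t t' c s q z where "t = y $ 1 powr (1 / 3)" and "t' = 1 / 3 * y $ 1 powr (1 / 3 - 1)"
    and "c = cos (y $ 2)" and "s = sin (y $ 2)" and "q = sqrt (1 - (y $ 3)\<^sup>2)" and "z = y $ 3"
  have "1 - z\<^sup>2 > 0" using assms(2) by (simp add: z_def abs_square_less_1)
  then have q: "q > 0" "q * q = 1 - z * z" by (auto simp: q_def z_def power2_eq_square)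
  have dt: "((\<lambda>x. x powr (1 / 3)) has_real_derivative t') (at (y $ 1))"
    unfolding t'_def using w by (rule has_real_derivative_powr)
  have dq: "((\<lambda>x. sqrt (1 - x\<^sup>2)) has_real_derivative - z / q) (at (y $ 3))"
    using q(1) by (auto intro!: derivative_eq_intros simp: q_def z_def field_simps)
  have dc: "(cos has_real_derivative - s) (at (y $ 2))" unfolding s_def by (rule DERIV_cos)
  have ds: "(sin has_real_derivative c) (at (y $ 2))" unfolding c_def by (rule DERIV_sin)
  have dz: "((\<lambda>y::real^3. y $ 3) has_derivative (\<lambda>h. h $ 3)) (at y within S)" for S
    by (intro bounded_linear_imp_has_derivative bounded_linear_vec_nth)
  define D where "D = (\<lambda>h::real^3. (t * (q * (- s * h $ 2) + (- z / q * h $ 3) * c) + (t' * h $ 1) * (q * c)) *\<^sub>R (axis 1 1 :: real^3)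
     + (t * (q * (c * h $ 2) + (- z / q * h $ 3) * s) + (t' * h $ 1) * (q * s)) *\<^sub>R axis 2 1
     + (t * h $ 3 + (t' * h $ 1) * z) *\<^sub>R axis 3 1)"
  have D: "(cone_map has_derivative D) (at y within S)" for S
    unfolding cone_map_def[abs_def] D_def
    unfolding t_def c_def s_def q_def z_def
    by (intro has_derivative_add has_derivative_scaleR_left has_derivative_mult dz
        has_derivative_compose_nth[OF dt] has_derivative_compose_nth[OF dq, unfolded q_def z_def]
        has_derivative_compose_nth[OF dc, unfolded s_def] has_derivative_compose_nth[OF ds, unfolded c_def])
  have cs: "c * c = 1 - s * s" using sin_cos_squared_add3[of "y $ 2"] by (simp add: c_def s_def algebra_simps)
  have tt: "t * t * t' = 1 / 3"
  proof -
    have "y $ 1 powr (1 / 3) * y $ 1 powr (1 / 3) * y $ 1 powr (1 / 3 - 1) = y $ 1 powr (1 / 3 + 1 / 3 + (1 / 3 - 1))"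
      by (simp only: powr_add)
    also have "\<dots> = 1" using w by simp
    finally show ?thesis by (simp add: t_def t'_def)
  qed
  have m: "matrix D = (\<chi> i j. D (axis j 1) $ i)" by (simp add: matrix_def)
  have "det (matrix D) = t * t * t' * (c * c + s * s) * (q * q + z * (q * (z / q)))"
    unfolding m det_3 by (simp add: D_def axis_def algebra_simps)
  also have "q * (z / q) = z" using q(1) by simp
  also have "t * t * t' * (c * c + s * s) * (q * q + z * z) = 1 / 3" unfolding q(2) cs tt by simp
  finally have "det (matrix D) = 1 / 3" .
  with D show ?thesis by (rule that)
qed

section \<open>Volume of the cone over a zone\<close>

definition solid_cone :: "(real^3) set \<Rightarrow> (real^3) set" where
  "solid_cone A = {t *\<^sub>R x | t x. 0 < t \<and> t \<le> 1 \<and> x \<in> A}"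

text \<open>The angles range over the values of \<open>Arg\<close>, and for \<open>a\<close> and
  \<open>b\<close> in \<open>{-1..1}\<close> the open height range keeps off the axis; both serve
  the injectivity of \<open>cone_map\<close>.\<close>

definition cone_domain :: "real \<Rightarrow> real \<Rightarrow> (real^3) set" where
  "cone_domain a b = {y. 0 < y $ 1 \<and> y $ 1 \<le> 1 \<and> - pi < y $ 2 \<and> y $ 2 \<le> pi \<and> a < y $ 3 \<and> y $ 3 < b}"

lemma inj_on_cone_map:
  assumes ab: "-1 \<le> a" "b \<le> 1"
  shows "inj_on cone_map (cone_domain a b)"
proof (rule inj_onI)
  fix y y' assume y: "y \<in> cone_domain a b" "y' \<in> cone_domain a b" and eq: "cone_map y = cone_map y'"
  have sq: "(cone_map v $ 1)\<^sup>2 + (cone_map v $ 2)\<^sup>2 + (cone_map v $ 3)\<^sup>2 = (v $ 1 powr (1 / 3))\<^sup>2"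
    if "v \<in> cone_domain a b" for v
  proof -
    have "\<bar>v $ 3\<bar> < 1" using that ab by (auto simp: cone_domain_def)
    then have q: "(sqrt (1 - (v $ 3)\<^sup>2))\<^sup>2 = 1 - (v $ 3)\<^sup>2" by (simp add: abs_square_less_1 less_imp_le)
    have "(cone_map v $ 1)\<^sup>2 + (cone_map v $ 2)\<^sup>2 + (cone_map v $ 3)\<^sup>2
        = (v $ 1 powr (1 / 3))\<^sup>2 * ((sqrt (1 - (v $ 3)\<^sup>2))\<^sup>2 * ((cos (v $ 2))\<^sup>2 + (sin (v $ 2))\<^sup>2) + (v $ 3)\<^sup>2)"
      unfolding cone_map_nth power_mult_distrib by (simp only: distrib_left)
    then show ?thesis unfolding q by simp
  qed
  have pos: "v $ 1 powr (1 / 3) > 0" if "v \<in> cone_domain a b" for v using that by (simp add: cone_domain_def)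
  have t: "y $ 1 powr (1 / 3) = y' $ 1 powr (1 / 3)"
    using sq[OF y(1)] sq[OF y(2)] pos[OF y(1)] pos[OF y(2)] unfolding eq by (simp add: power2_eq_iff)
  then have "(y $ 1 powr (1 / 3)) powr 3 = (y' $ 1 powr (1 / 3)) powr 3" by simp
  then have 1: "y $ 1 = y' $ 1" using y by (simp add: powr_powr cone_domain_def)
  have 3: "y $ 3 = y' $ 3"
    using cone_map_nth(3)[of y] cone_map_nth(3)[of y'] pos[OF y(1)] unfolding eq 1 by simp
  have "\<bar>y' $ 3\<bar> < 1" using y(2) ab by (auto simp: cone_domain_def)
  then have "sqrt (1 - (y' $ 3)\<^sup>2) > 0" by (simp add: abs_square_less_1)
  then have "cos (y $ 2) = cos (y' $ 2)" "sin (y $ 2) = sin (y' $ 2)"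
    using cone_map_nth(1)[of y] cone_map_nth(1)[of y'] cone_map_nth(2)[of y] cone_map_nth(2)[of y'] pos[OF y(2)]
    unfolding eq 1 3 by auto
  then have "cis (y $ 2) = cis (y' $ 2)" by (simp add: complex_eq_iff)
  moreover have "Arg (cis (v $ 2)) = v $ 2" if "v \<in> cone_domain a b" for v
    by (rule cis_Arg_unique) (use that in \<open>simp_all add: cone_domain_def\<close>)
  ultimately have "y $ 2 = y' $ 2" using y by metis
  with 1 3 show "y = y'" by (simp add: vec_eq_iff forall_3)
qed

lemma
  assumes ab: "-1 \<le> a" "a < b" "b \<le> 1"
  shows lmeasurable_cone_map: "cone_map ` cone_domain a b \<in> lmeasurable"
    and measure_cone_map: "measure lebesgue (cone_map ` cone_domain a b) = 2 * pi * (b - a) / 3"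
proof -
  let ?S = "cone_domain a b"
  define l u :: "real^3" where "l = vector [0, - pi, a]" and "u = vector [1, pi, b]"
  have lu: "l $ 1 = 0" "l $ 2 = - pi" "l $ 3 = a" "u $ 1 = 1" "u $ 2 = pi" "u $ 3 = b"
    by (simp_all add: l_def u_def vector_3)
  have sub: "box l u \<subseteq> ?S" "?S \<subseteq> cbox l u"
    by (auto simp: mem_box_cart forall_3 lu cone_domain_def)
  have ne: "cbox l u \<noteq> {}" using ab by (auto simp: interval_ne_empty_cart forall_3 lu)
  \<comment> \<open>The domain lies between the open and the closed box and so differs from the
    latter by a null set.\<close>
  have neg: "negligible ((?S - cbox l u) \<union> (cbox l u - ?S))"
    by (rule negligible_subset[OF negligible_frontier_interval[of l u]]) (use sub in auto)
  have S: "?S \<in> lmeasurable"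
    by (rule lmeasurable_negligible_symdiff[OF lmeasurable_cbox[of l u]]) (use neg in \<open>simp add: Un_commute\<close>)
  have "((\<lambda>_. 1 / 3) has_integral measure lborel (cbox l u) *\<^sub>R (1 / 3 :: real)) (cbox l u)"
    by (rule has_integral_const)
  then have i: "((\<lambda>_. 1 / 3) has_integral measure lborel (cbox l u) *\<^sub>R (1 / 3 :: real)) ?S"
  proof (rule has_integral_spike_set_eq[THEN iffD1, rotated 2])
    show "negligible {x \<in> cbox l u - ?S. 1 / 3 \<noteq> (0::real)}" "negligible {x \<in> ?S - cbox l u. 1 / 3 \<noteq> (0::real)}"
      by (rule negligible_subset[OF neg]; blast)+
  qed
  have c: "measure lborel (cbox l u) = 2 * pi * (b - a)"
  proof -
    have "prod f UNIV = f 1 * f 2 * f 3" for f :: "3 \<Rightarrow> real" unfolding UNIV_3 by (simp add: mult.assoc)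
    then show ?thesis unfolding content_cbox_cart[OF ne] by (simp add: lu)
  qed
  have yS: "y $ 1 > 0" "\<bar>y $ 3\<bar> < 1" if "y \<in> ?S" for y using that ab by (auto simp: cone_domain_def)
  have "\<forall>y. \<exists>D. y \<in> ?S \<longrightarrow> (cone_map has_derivative D) (at y within ?S) \<and> det (matrix D) = 1 / 3"
    using cone_map_derivative yS by metis
  then obtain D where D: "\<And>y. y \<in> ?S \<Longrightarrow> (cone_map has_derivative D y) (at y within ?S)"
    "\<And>y. y \<in> ?S \<Longrightarrow> det (matrix (D y)) = 1 / 3" by metis
  have i': "((\<lambda>y. \<bar>det (matrix (D y))\<bar>) has_integral measure lborel (cbox l u) *\<^sub>R (1 / 3 :: real)) ?S"
    by (rule has_integral_eq[OF _ i]) (simp add: D(2))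
  note img = measurable_differentiable_image_eq[OF fmeasurableD[OF S] D(1) inj_on_cone_map[OF ab(1,3)]]
    measure_differentiable_image_eq[OF fmeasurableD[OF S] D(1) inj_on_cone_map[OF ab(1,3)]]
  show "cone_map ` ?S \<in> lmeasurable" using img(1) i' by blast
  show "measure lebesgue (cone_map ` ?S) = 2 * pi * (b - a) / 3"
    using img(2) i' c by (simp add: has_integral_integrable integral_unique)
qed

lemma
  assumes ab: "0 \<le> \<alpha>" "\<alpha> < \<beta>" "\<beta> < pi"
  shows lmeasurable_cone_zone_axis: "solid_cone (zone (axis 3 1) \<alpha> \<beta>) \<in> lmeasurable" (is "?C \<in> _")
    and measure_cone_zone_axis: "measure lebesgue (solid_cone (zone (axis 3 1) \<alpha> \<beta>)) = 2 * pi * (cos \<alpha> - cos \<beta>) / 3"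
proof -
  let ?T = "cone_map ` cone_domain (cos \<beta>) (cos \<alpha>)"
  have lt: "cos \<beta> < cos \<alpha>" using ab by (simp add: cos_mono_less_eq)
  have S2: "x \<in> S2 \<longleftrightarrow> (x $ 1)\<^sup>2 + (x $ 2)\<^sup>2 + (x $ 3)\<^sup>2 = 1" for x :: "real^3"
    by (simp add: norm_eq_1 inner_vec_def sum_3 power2_eq_square)
  have ax: "axis 3 1 \<bullet> x = x $ 3" for x :: "real^3" by (simp add: inner_axis')
  have 1: "?T \<subseteq> ?C"
  proof safe
    fix y assume y: "y \<in> cone_domain (cos \<beta>) (cos \<alpha>)"
    have "cos \<beta> < y $ 3" "y $ 3 < cos \<alpha>" using y by (auto simp: cone_domain_def)
    then have "\<bar>y $ 3\<bar> < 1" using cos_ge_minus_one[of \<beta>] cos_le_one[of \<alpha>] by linarith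
    then have q: "(sqrt (1 - (y $ 3)\<^sup>2))\<^sup>2 = 1 - (y $ 3)\<^sup>2" by (simp add: abs_square_less_1 less_imp_le)
    define x :: "real^3" where "x = vector [sqrt (1 - (y $ 3)\<^sup>2) * cos (y $ 2), sqrt (1 - (y $ 3)\<^sup>2) * sin (y $ 2), y $ 3]"
    have "(x $ 1)\<^sup>2 + (x $ 2)\<^sup>2 + (x $ 3)\<^sup>2 = (sqrt (1 - (y $ 3)\<^sup>2))\<^sup>2 * ((cos (y $ 2))\<^sup>2 + (sin (y $ 2))\<^sup>2) + (y $ 3)\<^sup>2"
      unfolding x_def vector_3 power_mult_distrib by (simp only: distrib_left)
    then have "x \<in> S2" unfolding S2 q by simp
    then have "x \<in> zone (axis 3 1) \<alpha> \<beta>" using y by (simp add: zone_def ax cone_domain_def) (simp add: x_def vector_3)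
    moreover have "cone_map y = (y $ 1 powr (1 / 3)) *\<^sub>R x"
      by (simp add: vec_eq_iff forall_3 cone_map_nth x_def vector_3)
    moreover have "0 < y $ 1 powr (1 / 3)" "y $ 1 powr (1 / 3) \<le> 1"
      using y by (auto simp: cone_domain_def powr_le1)
    ultimately show "cone_map y \<in> ?C" unfolding solid_cone_def by blast
  qed
  \<comment> \<open>What is missing lies on the axis; the plane is a convenient null set around
    it.\<close>
  have 2: "?C - ?T \<subseteq> {v. v $ 1 = 0}"
  proof safe
    fix v assume v: "v \<in> ?C" "v \<notin> ?T"
    then obtain t x where tx: "v = t *\<^sub>R x" "0 < t" "t \<le> 1" "x \<in> zone (axis 3 1) \<alpha> \<beta>" by (auto simp: solid_cone_def)
    show "v $ 1 = 0"
    proof (rule ccontr)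
      assume "v $ 1 \<noteq> 0"
      then have x1: "(x $ 1)\<^sup>2 > 0" using tx by simp
      have x: "(x $ 1)\<^sup>2 + (x $ 2)\<^sup>2 + (x $ 3)\<^sup>2 = 1" "cos \<beta> < x $ 3" "\<alpha> = 0 \<or> x $ 3 < cos \<alpha>"
        using tx(4) S2[of x] by (auto simp: zone_def ax)
      define q where "q = sqrt (1 - (x $ 3)\<^sup>2)"
      have "1 - (x $ 3)\<^sup>2 > 0" using x(1) x1 zero_le_power2[of "x $ 2"] by linarith
      then have q: "q > 0" "q\<^sup>2 = (x $ 1)\<^sup>2 + (x $ 2)\<^sup>2" using x(1) by (auto simp: q_def)
      have "\<bar>x $ 3\<bar> < 1" using \<open>1 - (x $ 3)\<^sup>2 > 0\<close> by (simp add: abs_square_less_1[symmetric])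
      then have x3: "x $ 3 < cos \<alpha>" using x(3) by auto
      have cq: "cmod (Complex (x $ 1) (x $ 2)) = q" using q by (simp add: cmod_def real_sqrt_unique)
      define \<theta> where "\<theta> = Arg (Complex (x $ 1) (x $ 2))"
      have th: "- pi < \<theta>" "\<theta> \<le> pi" using Arg_bounded[of "Complex (x $ 1) (x $ 2)"] by (auto simp: \<theta>_def)
      have "Complex (x $ 1) (x $ 2) = rcis q \<theta>"
        using rcis_cmod_Arg[of "Complex (x $ 1) (x $ 2)"] by (simp add: cq \<theta>_def)
      then have xx: "x $ 1 = q * cos \<theta>" "x $ 2 = q * sin \<theta>" by (simp_all add: complex_eq_iff rcis_def)
      define y :: "real^3" where "y = vector [t ^ 3, \<theta>, x $ 3]"
      have "t ^ 3 \<le> 1" using tx by (simp add: power_le_one)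
      have "(t powr 3) powr (1 / 3) = t" using tx by (simp only: powr_powr) simp
      then have t3: "(t ^ 3) powr (1 / 3) = t" using tx by simp
      have "y \<in> cone_domain (cos \<beta>) (cos \<alpha>)"
        using \<open>t ^ 3 \<le> 1\<close> tx th x x3 by (simp add: cone_domain_def y_def vector_3)
      moreover have "cone_map y = v"
        using tx by (simp add: vec_eq_iff forall_3 cone_map_nth y_def vector_3 t3 xx flip: q_def)
      ultimately show False using v(2) by blast
    qed
  qed
  have neg: "negligible ((?T - ?C) \<union> (?C - ?T))"
    by (rule negligible_subset[OF negligible_standard_hyperplane_cart[of 1]]) (use 1 2 in auto)
  have m: "?T \<in> lmeasurable" by (rule lmeasurable_cone_map) (use lt in auto)
  show "?C \<in> lmeasurable" by (rule lmeasurable_negligible_symdiff[OF m neg])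
  show "measure lebesgue ?C = 2 * pi * (cos \<alpha> - cos \<beta>) / 3"
    using measure_negligible_symdiff[OF m neg] measure_cone_map[of "cos \<beta>" "cos \<alpha>"] lt by simp
qed

lemma sphere_area_zone:
  assumes p: "p \<in> S2" and ab: "0 \<le> \<alpha>" "\<alpha> < \<beta>" "\<beta> < pi"
  shows "sphere_area (zone p \<alpha> \<beta>) = 2 * pi * (cos \<alpha> - cos \<beta>)"
proof -
  have "norm (axis 3 1 :: real^3) = norm p" using p by (simp add: norm_axis_1)
  then obtain f where f: "orthogonal_transformation f" "f (axis 3 1 :: real^3) = p"
    by (rule orthogonal_transformation_exists)
  then have lf: "linear f" and ip: "f v \<bullet> f w = v \<bullet> w" for v w
    by (auto simp: orthogonal_transformation_def)
  have nf: "norm (f v) = norm v" for v by (simp add: norm_eq_sqrt_inner ip)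
  have "zone p \<alpha> \<beta> = f ` zone (axis 3 1) \<alpha> \<beta>"
  proof safe
    fix x assume x: "x \<in> zone p \<alpha> \<beta>"
    obtain y where y: "x = f y" using orthogonal_transformation_surj[OF f(1)] by (metis surjD)
    then have "y \<in> zone (axis 3 1) \<alpha> \<beta>" using x by (simp add: zone_def nf flip: f(2)) (simp add: ip)
    then show "x \<in> f ` zone (axis 3 1) \<alpha> \<beta>" using y by blast
  next
    fix y assume "y \<in> zone (axis 3 1) \<alpha> \<beta>"
    then show "f y \<in> zone p \<alpha> \<beta>" by (simp add: zone_def nf ip flip: f(2))
  qed
  then have "solid_cone (zone p \<alpha> \<beta>) = f ` solid_cone (zone (axis 3 1) \<alpha> \<beta>)"
    unfolding solid_cone_def using lf by (force simp: linear_cmul image_iff)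
  then have "measure lebesgue (solid_cone (zone p \<alpha> \<beta>)) = measure lebesgue (solid_cone (zone (axis 3 1) \<alpha> \<beta>))"
    using measure_orthogonal_image[OF f(1) lmeasurable_cone_zone_axis[OF ab]] by simp
  then show ?thesis
    unfolding sphere_area_def solid_cone_def[symmetric] measure_cone_zone_axis[OF ab] by simp
qed

section \<open>Expansion of the boundary conditions\<close>

text \<open>Here \<open>\<kappa> = s * a\<close> and \<open>1 - y = s * w\<close>, so multiplying by
  \<open>w\<close> clears the poles at \<open>y = 1\<close>. \<open>E\<close> and \<open>F\<close>
  stand for bounds on \<open>exp \<kappa>\<close>, and \<open>m\<close> for a bound on
  \<open>ln (1 - y)\<close>.\<close>

lemma annulus_condition_expand:
  fixes s w a E F m :: real
  assumes "s > 0" "w > 0"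
  shows "(2 * (s * w) * (s * a * E * log_major' (4/3) (2/3) (1 - s * w)) - (1 + s * a * F * (4/3 * (1 - s * w) / (s * w) - 2/3 * m))) * w
    = a * E * (8/3 + 4/3 * (s * w)) - w - a * F * (4/3 * (1 - s * w) - 2/3 * (s * w) * m)"
proof -
  define D where "D = s * w"
  have D: "D > 0" using assms by (simp add: D_def)
  define q where "q = (1 - D) / D"
  have q: "q * D = 1 - D" using D by (simp add: q_def)
  have L: "D * D * log_major' (4/3) (2/3) (1 - D) = 4/3 + 2/3 * D"
    using D by (simp add: log_major'_def field_simps power2_eq_square)
  have "(2 * D * (s * a * E * log_major' (4/3) (2/3) (1 - D)) - (1 + s * a * F * (4/3 * q - 2/3 * m))) * w
     = 2 * a * E * (D * (s * w) * log_major' (4/3) (2/3) (1 - D)) - w - a * F * (4/3 * (q * (s * w)) - 2/3 * (s * w) * m)"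
    by (simp add: ring_distribs mult_ac)
  also have "\<dots> = a * E * (8/3 + 4/3 * D) - w - a * F * (4/3 * (1 - D) - 2/3 * D * m)"
    unfolding D_def[symmetric] q L by (simp add: ring_distribs mult_ac)
  finally show ?thesis by (simp add: D_def q_def)
qed

text \<open>Any sufficiently large constant would do in place of 1000 in the two brackets.\<close>

lemma annulus_bracket:
  "eventually (\<lambda>s::real. \<exists>\<kappa>. 0 \<le> \<kappa> \<and> \<kappa> \<le> 1 / 4 \<and> \<bar>4 * \<kappa> - (6 * s - 6 * s\<^sup>2 * ln s)\<bar> \<le> 1000 * s\<^sup>2 \<and>
     hyp (1/2) (3/2) \<kappa> ((1 - s)\<^sup>2) = 2 * (1 - (1 - s)\<^sup>2) * hyp' (1/2) (3/2) \<kappa> ((1 - s)\<^sup>2)) (at_right 0)"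
proof -
  define y where "y = (\<lambda>s::real. (1 - s)\<^sup>2)"
  \<comment> \<open>The bracket is for \<open>\<kappa> = \<eta> / 4\<close>, hence the division by
    4.\<close>
  define lo hi where "lo = (\<lambda>s::real. (6 * s - 6 * s\<^sup>2 * ln s - 1000 * s\<^sup>2) / 4)" and "hi = (\<lambda>s::real. (6 * s - 6 * s\<^sup>2 * ln s + 1000 * s\<^sup>2) / 4)"
  note defs = y_def lo_def hi_def log_major_def log_major'_def
  have "eventually (\<lambda>s. 0 < lo s) (at_right 0)" unfolding defs by real_asymp
  moreover have "eventually (\<lambda>s. hi s < 1 / 4) (at_right 0)" unfolding defs by real_asymp
  moreover have "eventually (\<lambda>s. 0 < y s \<and> y s < 1) (at_right 0)" unfolding defs by (intro eventually_conj) real_asymp+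
  moreover have "eventually (\<lambda>s::real. 0 < s) (at_right 0)" "eventually (\<lambda>s::real. s < 1) (at_right 0)" by real_asymp+
  \<comment> \<open>Both \<open>lo s\<close> and \<open>hi s\<close> are asymptotic to
    \<open>3/2 * s\<close>, so 20 leaves ample room.\<close>
  moreover have "eventually (\<lambda>s. exp (lo s) \<le> 1 + 20 * s) (at_right 0)" "eventually (\<lambda>s. exp (hi s) \<le> 1 + 20 * s) (at_right 0)"
    unfolding defs by real_asymp+
  \<comment> \<open>With \<open>a = 3/2 - 3/2 * s * ln s\<close> the constant terms cancel, as
    \<open>(8/3 - 4/3) * 3/2 = 2\<close>, and so do those in \<open>s * ln s\<close>. At order
    \<open>s\<close> the term \<open>250 * s\<close>, from \<open>1000 / 4\<close>, outweighs the
    rest, including the effect of \<open>20 * s\<close>.\<close>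
  moreover have "eventually (\<lambda>s::real. (3/2 - 3/2 * s * ln s + 250 * s) * 1 * (8/3 + 4/3 * (s * (2 - s))) - (2 - s)
      - (3/2 - 3/2 * s * ln s + 250 * s) * (1 + 20 * s) * (4/3 * (1 - s * (2 - s)) - 2/3 * (s * (2 - s)) * ln s) > 0) (at_right 0)"
    by real_asymp
  moreover have "eventually (\<lambda>s::real. (3/2 - 3/2 * s * ln s - 250 * s) * (1 + 20 * s) * (8/3 + 4/3 * (s * (2 - s))) - (2 - s)
      - (3/2 - 3/2 * s * ln s - 250 * s) * 1 * (4/3 * (1 - s * (2 - s)) - 2/3 * (s * (2 - s)) * (ln s + 1)) < 0) (at_right 0)"
    by real_asymp
  ultimately show ?thesis
  proof eventually_elim
    case (elim s)
    define \<psi> where "\<psi> \<kappa> = 2 * (1 - y s) * hyp' (1/2) (3/2) \<kappa> (y s) - hyp (1/2) (3/2) \<kappa> (y s)" for \<kappa>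
    have lh: "lo s \<le> hi s" by (simp add: lo_def hi_def divide_simps)
    then have r: "0 \<le> lo s" "lo s \<le> 1" "0 \<le> hi s" "hi s \<le> 1" using elim by auto
    have y: "0 \<le> y s" "y s < 1" "\<bar>y s\<bar> < 1" using elim by auto
    have D: "1 - y s = s * (2 - s)" by (simp add: y_def power2_eq_square algebra_simps)
    have s01: "0 < s" "s < 1" using elim by auto
    \<comment> \<open>\<open>1 - y s = s * (2 - s)\<close> lies between \<open>s\<close> and
      \<open>s * exp 1\<close>. A bounded error in the logarithm changes \<open>\<eta>\<close> by
      O(s^2) only.\<close>
    have "ln s \<le> ln (1 - y s)" unfolding D using s01 by simp
    then have "log_major (4/3) (2/3) (y s) \<le> 4/3 * y s / (1 - y s) - 2/3 * ln s"
      by (simp add: log_major_def)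
    then have hi: "hi s * exp (hi s) * log_major (4/3) (2/3) (y s) \<le> hi s * exp (hi s) * (4/3 * y s / (1 - y s) - 2/3 * ln s)"
      using r by (intro mult_left_mono) auto
    have "ln (1 - y s) \<le> ln (s * exp 1)" unfolding D
      using s01 exp_ge_add_one_self[of 1] by (intro ln_mono mult_left_mono mult_pos_pos) auto
    also have "\<dots> = ln s + 1" using s01 by (simp add: ln_mult)
    finally have "4/3 * y s / (1 - y s) - 2/3 * (ln s + 1) \<le> log_major (4/3) (2/3) (y s)"
      by (simp add: log_major_def)
    then have lo: "lo s * (4/3 * y s / (1 - y s) - 2/3 * (ln s + 1)) \<le> lo s * log_major (4/3) (2/3) (y s)"
      using r by (intro mult_left_mono) auto
    define w where "w = 2 - s"
    have los: "lo s = s * (3/2 - 3/2 * s * ln s - 250 * s)" and his: "hi s = s * (3/2 - 3/2 * s * ln s + 250 * s)"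
      by (simp_all add: lo_def hi_def field_simps power2_eq_square)
    have w: "w > 0" using s01 by (simp add: w_def)
    have ys: "1 - y s = s * w" "y s = 1 - s * w" using D by (simp_all add: w_def)
    have "(2 * (1 - y s) * (lo s * (1 + 20 * s) * log_major' (4/3) (2/3) (y s)) - (1 + lo s * 1 * (4/3 * y s / (1 - y s) - 2/3 * (ln s + 1)))) * w < 0"
      unfolding ys(1) unfolding ys(2) los annulus_condition_expand[OF s01(1) w] using elim unfolding w_def by simp
    then have lo': "2 * (1 - y s) * (lo s * (1 + 20 * s) * log_major' (4/3) (2/3) (y s)) - (1 + lo s * (4/3 * y s / (1 - y s) - 2/3 * (ln s + 1))) < 0"
      using w by (simp add: mult_less_0_iff)
    have "(2 * (1 - y s) * (hi s * 1 * log_major' (4/3) (2/3) (y s)) - (1 + hi s * (1 + 20 * s) * (4/3 * y s / (1 - y s) - 2/3 * ln s))) * w > 0"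
      unfolding ys(1) unfolding ys(2) his annulus_condition_expand[OF s01(1) w] using elim unfolding w_def by simp
    then have hi': "2 * (1 - y s) * (hi s * log_major' (4/3) (2/3) (y s)) - (1 + hi s * (1 + 20 * s) * (4/3 * y s / (1 - y s) - 2/3 * ln s)) > 0"
      using w by (simp add: zero_less_mult_iff)
    have L': "log_major' (4/3) (2/3) (y s) \<ge> 0" using y by (simp add: log_major'_def)
    have El: "2 * (1 - y s) * (lo s * exp (lo s) * log_major' (4/3) (2/3) (y s)) \<le> 2 * (1 - y s) * (lo s * (1 + 20 * s) * log_major' (4/3) (2/3) (y s))"
      using r y L' elim by (intro mult_left_mono mult_right_mono) auto
    have "ln s \<le> 0" using s01 by simp
    moreover have "0 \<le> 4/3 * y s / (1 - y s)" using y by simp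
    ultimately have "0 \<le> 4/3 * y s / (1 - y s) - 2/3 * ln s" by linarith
    then have Eh: "hi s * exp (hi s) * (4/3 * y s / (1 - y s) - 2/3 * ln s) \<le> hi s * (1 + 20 * s) * (4/3 * y s / (1 - y s) - 2/3 * ln s)"
      using r elim by (intro mult_left_mono mult_right_mono) auto
    have "\<psi> (lo s) \<le> 2 * (1 - y s) * (lo s * exp (lo s) * log_major' (4/3) (2/3) (y s)) - (1 + lo s * log_major (4/3) (2/3) (y s))"
      unfolding \<psi>_def using y annulus.hyp'_upper[OF r(1,2) y(1,2)] annulus.hyp_lower[OF r(1,2) y(1,2)]
      by (intro diff_mono mult_left_mono) auto
    then have 1: "\<psi> (lo s) \<le> 0" using lo lo' El by linarith
    have "2 * (1 - y s) * (hi s * log_major' (4/3) (2/3) (y s)) - (1 + hi s * exp (hi s) * log_major (4/3) (2/3) (y s)) \<le> \<psi> (hi s)"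
      unfolding \<psi>_def using y annulus.hyp'_lower[OF r(3,4) y(1,2)] annulus.hyp_upper[OF r(3,4) y(1,2)]
      by (intro diff_mono mult_left_mono) auto
    then have 2: "0 \<le> \<psi> (hi s)" using hi hi' Eh by linarith
    have "continuous_on {lo s..hi s} \<psi>" unfolding \<psi>_def
      using r by (intro continuous_intros continuous_on_subset[OF annulus.continuous_on_hyp[OF y(3)]]
        continuous_on_subset[OF annulus.continuous_on_hyp'[OF y(3)]]) auto
    from IVT'[OF 1 2 lh this] obtain \<kappa> where k: "lo s \<le> \<kappa>" "\<kappa> \<le> hi s" "\<psi> \<kappa> = 0" by blast
    have "\<bar>4 * \<kappa> - (6 * s - 6 * s\<^sup>2 * ln s)\<bar> \<le> 1000 * s\<^sup>2"
      using k(1,2) unfolding lo_def hi_def by (simp add: abs_le_iff field_simps)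
    then show ?case using k elim r by (intro exI[of _ \<kappa>]) (auto simp: \<psi>_def y_def)
  qed
qed

text \<open>With \<open>\<kappa> = s * a\<close>, the limit of the condition is
  \<open>a / 3 = 1 + a / 6\<close>, whence \<open>a = 6\<close>. The coefficient -12 of
  \<open>s * ln s\<close> in \<open>a\<close> solves \<open>c / 6 + 6 / 3 = 0\<close>.\<close>

lemma disk_bracket:
  "eventually (\<lambda>s::real. \<exists>\<kappa>. 0 \<le> \<kappa> \<and> \<kappa> \<le> 1 \<and> \<bar>\<kappa> - (6 * s - 12 * s\<^sup>2 * ln s)\<bar> \<le> 1000 * s\<^sup>2 \<and>
     (2 * (1 - s) - 1) * hyp 2 3 \<kappa> (1 - s) = 2 * (1 - s) * s * hyp' 2 3 \<kappa> (1 - s)) (at_right 0)"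
proof -
  define lo hi where "lo = (\<lambda>s::real. 6 * s - 12 * s\<^sup>2 * ln s - 1000 * s\<^sup>2)" and "hi = (\<lambda>s::real. 6 * s - 12 * s\<^sup>2 * ln s + 1000 * s\<^sup>2)"
  note defs = lo_def hi_def log_major_def log_major'_def
  have "eventually (\<lambda>s. 0 < lo s) (at_right 0)" unfolding defs by real_asymp
  moreover have "eventually (\<lambda>s. hi s < 1) (at_right 0)" unfolding defs by real_asymp
  moreover have "eventually (\<lambda>s::real. 0 < s) (at_right 0)" "eventually (\<lambda>s::real. s < 1 / 2) (at_right 0)" by real_asymp+
  moreover have "eventually (\<lambda>s. 2 * (1 - s) * s * (hi s * log_major' (1/6) (1/3) (1 - s)) - (2 * (1 - s) - 1) * (1 + hi s * exp (hi s) * log_major (1/6) (1/3) (1 - s)) > 0) (at_right 0)"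
    unfolding defs by real_asymp
  moreover have "eventually (\<lambda>s. exp (lo s) \<le> 1 + 20 * s) (at_right 0)" unfolding defs by real_asymp
  \<comment> \<open>The condition at \<open>lo s\<close> with the poles cleared,
    \<open>lo s = s * a\<close>, and \<open>exp (lo s)\<close> replaced by its bound.\<close>
  moreover have "eventually (\<lambda>s::real. (1 - s) * (6 - 12 * s * ln s - 1000 * s) * (1 + 20 * s) * (1/3 + 2/3 * s)
      - (1 - 2 * s) * (1 + (6 - 12 * s * ln s - 1000 * s) * ((1 - s) / 6 - s * ln s / 3)) < 0) (at_right 0)"
    by real_asymp
  ultimately show ?thesis
  proof eventually_elim
    case (elim s)
    define \<psi> where "\<psi> \<kappa> = 2 * (1 - s) * s * hyp' 2 3 \<kappa> (1 - s) - (2 * (1 - s) - 1) * hyp 2 3 \<kappa> (1 - s)" for \<kappa>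
    have lh: "lo s \<le> hi s" by (simp add: lo_def hi_def)
    then have r: "0 \<le> lo s" "lo s \<le> 1" "0 \<le> hi s" "hi s \<le> 1" using elim by auto
    have y: "0 \<le> 1 - s" "1 - s < 1" "\<bar>1 - s\<bar> < 1" using elim by auto
    define a where "a = 6 - 12 * s * ln s - 1000 * s"
    have los: "lo s = s * a" by (simp add: lo_def a_def algebra_simps power2_eq_square)
    have s0: "s > 0" using elim by simp
    have L': "s\<^sup>2 * log_major' (1/6) (1/3) (1 - s) = 1/6 + 1/3 * s"
      using s0 by (simp add: log_major'_def field_simps power2_eq_square)
    have L: "s * log_major (1/6) (1/3) (1 - s) = (1 - s) / 6 - s * ln s / 3"
      using s0 by (simp add: log_major_def field_simps)
    have "2 * (1 - s) * s * (lo s * (1 + 20 * s) * log_major' (1/6) (1/3) (1 - s)) - (2 * (1 - s) - 1) * (1 + lo s * log_major (1/6) (1/3) (1 - s))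
        = 2 * (1 - s) * a * (1 + 20 * s) * (s\<^sup>2 * log_major' (1/6) (1/3) (1 - s)) - (1 - 2 * s) * (1 + a * (s * log_major (1/6) (1/3) (1 - s)))"
      unfolding los by (simp add: power2_eq_square mult_ac)
    also have "\<dots> = (1 - s) * a * (1 + 20 * s) * (1/3 + 2/3 * s) - (1 - 2 * s) * (1 + a * ((1 - s) / 6 - s * ln s / 3))"
      unfolding L L' by (simp add: ring_distribs mult_ac)
    also have "\<dots> < 0" using elim unfolding a_def by simp
    finally have lo: "2 * (1 - s) * s * (lo s * (1 + 20 * s) * log_major' (1/6) (1/3) (1 - s)) - (2 * (1 - s) - 1) * (1 + lo s * log_major (1/6) (1/3) (1 - s)) < 0" .
    have "log_major' (1/6) (1/3) (1 - s) \<ge> 0" using s0 by (simp add: log_major'_def)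
    then have E: "2 * (1 - s) * s * (lo s * exp (lo s) * log_major' (1/6) (1/3) (1 - s)) \<le> 2 * (1 - s) * s * (lo s * (1 + 20 * s) * log_major' (1/6) (1/3) (1 - s))"
      using r y s0 elim by (intro mult_left_mono mult_right_mono) auto
    have "\<psi> (lo s) \<le> 2 * (1 - s) * s * (lo s * exp (lo s) * log_major' (1/6) (1/3) (1 - s)) - (2 * (1 - s) - 1) * (1 + lo s * log_major (1/6) (1/3) (1 - s))"
      unfolding \<psi>_def using elim disk.hyp'_upper[OF r(1,2) y(1,2)] disk.hyp_lower[OF r(1,2) y(1,2)]
      by (intro diff_mono mult_left_mono) auto
    then have 1: "\<psi> (lo s) \<le> 0" using lo E by linarith
    have "2 * (1 - s) * s * (hi s * log_major' (1/6) (1/3) (1 - s)) - (2 * (1 - s) - 1) * (1 + hi s * exp (hi s) * log_major (1/6) (1/3) (1 - s)) \<le> \<psi> (hi s)"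
      unfolding \<psi>_def using elim disk.hyp'_lower[OF r(3,4) y(1,2)] disk.hyp_upper[OF r(3,4) y(1,2)]
      by (intro diff_mono mult_left_mono) auto
    then have 2: "0 \<le> \<psi> (hi s)" using elim by linarith
    have "continuous_on {lo s..hi s} \<psi>" unfolding \<psi>_def
      using r by (intro continuous_intros continuous_on_subset[OF disk.continuous_on_hyp[OF y(3)]]
        continuous_on_subset[OF disk.continuous_on_hyp'[OF y(3)]]) auto
    from IVT'[OF 1 2 lh this] obtain \<kappa> where k: "lo s \<le> \<kappa>" "\<kappa> \<le> hi s" "\<psi> \<kappa> = 0" by blast
    have "\<bar>\<kappa> - (6 * s - 12 * s\<^sup>2 * ln s)\<bar> \<le> 1000 * s\<^sup>2"
      using k(1,2) unfolding lo_def hi_def by (simp add: abs_le_iff)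
    then show ?case using k elim r by (intro exI[of _ \<kappa>]) (auto simp: \<psi>_def)
  qed
qed

section \<open>Passage from \<open>1 - cos \<epsilon>\<close> back to
  \<open>\<epsilon>\<close>\<close>

lemma remainder_asymp:
  "(\<lambda>\<epsilon>::real. (1 - cos \<epsilon>)\<^sup>2) \<in> o[at_right 0](\<lambda>\<epsilon>. \<epsilon> ^ 4 * \<bar>ln \<epsilon>\<bar>)"
  by real_asymp

text \<open>Splitting \<open>ln (1 - cos \<epsilon>)\<close> into \<open>2 * ln \<epsilon>\<close>
  and the bounded \<open>ln ((1 - cos \<epsilon>) / \<epsilon>\<^sup>2)\<close> leaves
  \<open>- 12 * (1 - cos \<epsilon>)\<^sup>2\<close>, which is asymptotic to
  \<open>- 3 * \<epsilon> ^ 4\<close>.\<close>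

lemma main_term_asymp:
  "(\<lambda>\<epsilon>::real. - 6 * (1 - cos \<epsilon>)\<^sup>2 * ln (1 - cos \<epsilon>) - 3 * \<epsilon> ^ 4 * \<bar>ln \<epsilon>\<bar>) \<in> o[at_right 0](\<lambda>\<epsilon>. \<epsilon> ^ 4 * \<bar>ln \<epsilon>\<bar>)"
proof -
  have t: "((\<lambda>\<epsilon>::real. (1 - cos \<epsilon>) / \<epsilon>\<^sup>2) \<longlongrightarrow> 1 / 2) (at_right 0)" by real_asymp
  have "(\<lambda>\<epsilon>::real. ln ((1 - cos \<epsilon>) / \<epsilon>\<^sup>2)) \<in> O[at_right 0](\<lambda>_. 1)"
    using tendsto_ln[OF t] by (intro bigoI_tendsto) auto
  from landau_o.big.mult[OF _ this, of "\<lambda>\<epsilon>. - 6 * (1 - cos \<epsilon>)\<^sup>2" "\<lambda>\<epsilon>. (1 - cos \<epsilon>)\<^sup>2"]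
  have "(\<lambda>\<epsilon>::real. - 6 * (1 - cos \<epsilon>)\<^sup>2 * ln ((1 - cos \<epsilon>) / \<epsilon>\<^sup>2)) \<in> O[at_right 0](\<lambda>\<epsilon>. (1 - cos \<epsilon>)\<^sup>2)" by simp
  then have 1: "(\<lambda>\<epsilon>::real. - 6 * (1 - cos \<epsilon>)\<^sup>2 * ln ((1 - cos \<epsilon>) / \<epsilon>\<^sup>2)) \<in> o[at_right 0](\<lambda>\<epsilon>. \<epsilon> ^ 4 * \<bar>ln \<epsilon>\<bar>)"
    using remainder_asymp by (rule landau_o.big_small_trans)
  have "((\<lambda>\<epsilon>::real. - 12 * ((1 - cos \<epsilon>) / \<epsilon>\<^sup>2)\<^sup>2 + 3) \<longlongrightarrow> - 12 * (1 / 2)\<^sup>2 + 3) (at_right 0)"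
    by (intro tendsto_intros t)
  moreover have "eventually (\<lambda>\<epsilon>::real. - 12 * ((1 - cos \<epsilon>) / \<epsilon>\<^sup>2)\<^sup>2 + 3 = (- 12 * (1 - cos \<epsilon>)\<^sup>2 + 3 * \<epsilon> ^ 4) / \<epsilon> ^ 4) (at_right 0)"
    using eventually_at_right_less[of 0] by eventually_elim (simp add: field_simps power_divide)
  ultimately have "((\<lambda>\<epsilon>::real. (- 12 * (1 - cos \<epsilon>)\<^sup>2 + 3 * \<epsilon> ^ 4) / \<epsilon> ^ 4) \<longlongrightarrow> 0) (at_right 0)"
    by (simp add: power2_eq_square Lim_transform_eventually)
  then have "(\<lambda>\<epsilon>::real. - 12 * (1 - cos \<epsilon>)\<^sup>2 + 3 * \<epsilon> ^ 4) \<in> o[at_right 0](\<lambda>\<epsilon>. \<epsilon> ^ 4)"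
    by (rule smalloI_tendsto) (use eventually_at_right_less[of "0::real"] in eventually_elim, simp)
  from landau_o.small_big_mult[OF this, of ln "\<lambda>\<epsilon>. \<bar>ln \<epsilon>\<bar>"]
  have 2: "(\<lambda>\<epsilon>::real. (- 12 * (1 - cos \<epsilon>)\<^sup>2 + 3 * \<epsilon> ^ 4) * ln \<epsilon>) \<in> o[at_right 0](\<lambda>\<epsilon>. \<epsilon> ^ 4 * \<bar>ln \<epsilon>\<bar>)"
    by simp
  have "eventually (\<lambda>\<epsilon>::real. 0 < \<epsilon>) (at_right 0)" "eventually (\<lambda>\<epsilon>::real. \<epsilon> < 1) (at_right 0)"
    "eventually (\<lambda>\<epsilon>::real. 0 < 1 - cos \<epsilon>) (at_right 0)" by real_asymp+
  then have "eventually (\<lambda>\<epsilon>::real. - 6 * (1 - cos \<epsilon>)\<^sup>2 * ln (1 - cos \<epsilon>) - 3 * \<epsilon> ^ 4 * \<bar>ln \<epsilon>\<bar> =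
      - 6 * (1 - cos \<epsilon>)\<^sup>2 * ln ((1 - cos \<epsilon>) / \<epsilon>\<^sup>2) + (- 12 * (1 - cos \<epsilon>)\<^sup>2 + 3 * \<epsilon> ^ 4) * ln \<epsilon>) (at_right 0)"
  proof eventually_elim
    case (elim \<epsilon>)
    have e: "ln (1 - cos \<epsilon>) = ln ((1 - cos \<epsilon>) / \<epsilon>\<^sup>2) + 2 * ln \<epsilon>"
      using elim by (simp add: ln_div ln_realpow)
    have a: "\<bar>ln \<epsilon>\<bar> = - ln \<epsilon>" using elim by simp
    show ?case unfolding e a by (simp add: algebra_simps)
  qed
  from landau_o.small.in_cong[OF this] show ?thesis using sum_in_smallo(1)[OF 1 2] by blast
qed

lemma one_minus_cos_at_right: "filterlim (\<lambda>\<epsilon>::real. 1 - cos \<epsilon>) (at_right 0) (at_right 0)"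
  by real_asymp

section \<open>The two eigenvalues\<close>

text \<open>\<open>LEAST\<close> on the reals needs an attained minimum:
  \<open>neumann_eigenvalue_zone\<close> exhibits the value,
  \<open>neumann_eigenvalue_zone_ge\<close> bounds all others.\<close>

lemma mu2_zone:
  assumes p: "p \<in> S2" and ab: "0 \<le> \<alpha>" "\<alpha> < \<beta>" "\<beta> < pi"
    and J: "open J" "{cos \<beta>..cos \<alpha>} \<subseteq> J"
    and g: "\<And>z. z \<in> J \<Longrightarrow> (g has_real_derivative g' z) (at z)"
    and g': "\<And>z. z \<in> J \<Longrightarrow> (g' has_real_derivative g'' z) (at z)"
    and g'': "continuous_on J g''"
    and ode: "\<And>z. z \<in> J \<Longrightarrow> (1 - z\<^sup>2) * g'' z - 4 * z * g' z = \<eta> * g z"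
    and pos: "\<And>z. z \<in> {cos \<beta>..cos \<alpha>} \<Longrightarrow> g z > 0"
    and bc: "\<And>r. r = \<beta> \<or> (\<alpha> \<noteq> 0 \<and> r = \<alpha>) \<Longrightarrow> cos r * g (cos r) = (1 - (cos r)\<^sup>2) * g' (cos r)"
    and \<eta>: "\<eta> < 2"
  shows "mu2 (zone p \<alpha> \<beta>) = 2 - \<eta>"
  unfolding mu2_def
proof (rule Least_equality)
  show "0 < 2 - \<eta> \<and> neumann_eigenvalue (zone p \<alpha> \<beta>) (2 - \<eta>)"
    using neumann_eigenvalue_zone[OF p ab J g g' g'' ode pos bc] \<eta> by simp
  show "2 - \<eta> \<le> \<mu>" if "0 < \<mu> \<and> neumann_eigenvalue (zone p \<alpha> \<beta>) \<mu>" for \<mu>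
    using that by (intro neumann_eigenvalue_zone_ge[OF p ab J(2) g g' ode pos bc]) auto
qed

text \<open>The positive profile is even in \<open>z\<close>, so the conditions on the two boundary
  circles coincide; \<open>cond\<close> is this condition with the factor \<open>cos r\<close>
  cancelled.\<close>

lemma mu2_annulus:
  assumes p: "p \<in> S2" and \<epsilon>: "0 < \<epsilon>" "\<epsilon> < pi / 2" and \<kappa>: "0 \<le> \<kappa>" "\<kappa> \<le> 1 / 4"
    and cond: "hyp (1/2) (3/2) \<kappa> ((cos \<epsilon>)\<^sup>2) = 2 * (1 - (cos \<epsilon>)\<^sup>2) * hyp' (1/2) (3/2) \<kappa> ((cos \<epsilon>)\<^sup>2)"
  shows "mu2 (annulus p \<epsilon>) = 2 - 4 * \<kappa>"
proof -
  define h h' h'' where "h = hyp (1/2) (3/2) \<kappa>" and "h' = hyp' (1/2) (3/2) \<kappa>" and "h'' = hyp'' (1/2) (3/2) \<kappa>"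
  have k: "0 \<le> \<kappa>" "\<kappa> \<le> 1" using \<kappa> by auto
  have sq: "\<bar>z\<^sup>2\<bar> < 1" if "z \<in> {-1<..<1}" for z :: real
    using that abs_square_less_1[of z] by (simp add: abs_less_iff)
  have dsq: "((\<lambda>z. z\<^sup>2) has_real_derivative 2 * z) (at z)" for z :: real
    by (auto intro!: derivative_eq_intros)
  have dh: "((\<lambda>z. h (z\<^sup>2)) has_real_derivative h' (z\<^sup>2) * (2 * z)) (at z)"
    and dh': "((\<lambda>z. h' (z\<^sup>2)) has_real_derivative h'' (z\<^sup>2) * (2 * z)) (at z)" if "z \<in> {-1<..<1}" for z
    unfolding h_def h'_def h''_def
    by (rule DERIV_chain2[OF annulus.DERIV_hyp[OF k sq[OF that]] dsq], rule DERIV_chain2[OF annulus.DERIV_hyp'[OF k sq[OF that]] dsq])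
  have ce: "0 < cos \<epsilon>" "cos \<epsilon> < 1"
    using \<epsilon> cos_monotone_0_pi[of 0 \<epsilon>] by (auto intro: cos_gt_zero)
  have "mu2 (zone p \<epsilon> (pi - \<epsilon>)) = 2 - 4 * \<kappa>"
  proof (rule mu2_zone[where J = "{-1<..<1}" and g = "\<lambda>z. h (z\<^sup>2)" and g' = "\<lambda>z. 2 * z * h' (z\<^sup>2)"
      and g'' = "\<lambda>z. 2 * h' (z\<^sup>2) + 4 * z\<^sup>2 * h'' (z\<^sup>2)"])
    show "{cos (pi - \<epsilon>)..cos \<epsilon>} \<subseteq> {-1<..<1}" using ce by auto
    show "((\<lambda>z. h (z\<^sup>2)) has_real_derivative 2 * z * h' (z\<^sup>2)) (at z)" if "z \<in> {-1<..<1}" for z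
      using dh[OF that] by (simp add: mult_ac)
    show "((\<lambda>z. 2 * z * h' (z\<^sup>2)) has_real_derivative 2 * h' (z\<^sup>2) + 4 * z\<^sup>2 * h'' (z\<^sup>2)) (at z)" if "z \<in> {-1<..<1}" for z
    proof -
      have "((\<lambda>z. 2 * z * h' (z\<^sup>2)) has_real_derivative 2 * h' (z\<^sup>2) + h'' (z\<^sup>2) * (2 * z) * (2 * z)) (at z)"
        using DERIV_mult[OF DERIV_cmult_Id[of 2] dh'[OF that]] by simp
      then show ?thesis by (simp add: power2_eq_square mult_ac)
    qed
    have isC: "isCont (\<lambda>z. h'' (z\<^sup>2)) z" "isCont (\<lambda>z. h' (z\<^sup>2)) z" if "z \<in> {-1<..<1}" for z
      unfolding h''_def using DERIV_isCont[OF dh'[OF that]]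
        isCont_o2[where f = "\<lambda>z. z\<^sup>2" and a = z, OF _ annulus.isCont_hyp''[OF k sq[OF that]]] by auto
    then show "continuous_on {-1<..<1} (\<lambda>z. 2 * h' (z\<^sup>2) + 4 * z\<^sup>2 * h'' (z\<^sup>2))"
      by (intro continuous_at_imp_continuous_on ballI continuous_intros)
    show "(1 - z\<^sup>2) * (2 * h' (z\<^sup>2) + 4 * z\<^sup>2 * h'' (z\<^sup>2)) - 4 * z * (2 * z * h' (z\<^sup>2)) = 4 * \<kappa> * h (z\<^sup>2)"
      if "z \<in> {-1<..<1}" for z
    proof -
      have "(1 - z\<^sup>2) * (2 * h' (z\<^sup>2) + 4 * z\<^sup>2 * h'' (z\<^sup>2)) - 4 * z * (2 * z * h' (z\<^sup>2))
        = 4 * (z\<^sup>2 * (1 - z\<^sup>2) * h'' (z\<^sup>2) + (1/2 - (3/2 + 1) * z\<^sup>2) * h' (z\<^sup>2))"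
        by (simp add: field_simps power2_eq_square)
      then show ?thesis using annulus.hyp_ode[OF k sq[OF that]] by (simp add: h_def h'_def h''_def)
    qed
    show "0 < h (z\<^sup>2)" if z: "z \<in> {cos (pi - \<epsilon>)..cos \<epsilon>}" for z
      unfolding h_def using sq[of z] z ce by (intro annulus.hyp_pos[OF k]) auto
    show "cos r * h ((cos r)\<^sup>2) = (1 - (cos r)\<^sup>2) * (2 * cos r * h' ((cos r)\<^sup>2))"
      if "r = pi - \<epsilon> \<or> \<epsilon> \<noteq> 0 \<and> r = \<epsilon>" for r
    proof -
      have "(cos r)\<^sup>2 = (cos \<epsilon>)\<^sup>2" using that by auto
      then show ?thesis using cond by (simp add: h_def h'_def)
    qed
  qed (use p \<epsilon> \<kappa> in auto)
  then show ?thesis using annulus_eq_zone[OF p \<epsilon>] by simp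
qed

text \<open>The series is centred at \<open>y = 0\<close>, that is \<open>z = 1\<close>, the centre
  of the disk. \<open>\<bar>y\<bar> < 1\<close> corresponds to \<open>z \<in> {-1<..<3}\<close>, so
  the centre is interior to \<open>J\<close>.\<close>

lemma mu2_disk:
  assumes q: "q \<in> S2" and R: "0 < R" "R < pi" and \<kappa>: "0 \<le> \<kappa>" "\<kappa> \<le> 1"
    and y: "cos R = 1 - 2 * y" and cond: "(2 * y - 1) * hyp 2 3 \<kappa> y = 2 * y * (1 - y) * hyp' 2 3 \<kappa> y"
  shows "mu2 (zone q 0 R) = 2 - \<kappa>"
proof -
  define h h' h'' where "h = hyp 2 3 \<kappa>" and "h' = hyp' 2 3 \<kappa>" and "h'' = hyp'' 2 3 \<kappa>"
  let ?t = "\<lambda>z::real. (1 - z) / 2"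
  have ab: "\<bar>?t z\<bar> < 1" if "z \<in> {-1<..<3}" for z using that by auto
  have dt: "(?t has_real_derivative - 1 / 2) (at z)" for z
    by (auto intro!: derivative_eq_intros)
  have dh: "((\<lambda>z. h (?t z)) has_real_derivative h' (?t z) * (- 1 / 2)) (at z)"
    and dh': "((\<lambda>z. h' (?t z)) has_real_derivative h'' (?t z) * (- 1 / 2)) (at z)" if "z \<in> {-1<..<3}" for z
    unfolding h_def h'_def h''_def
    by (rule DERIV_chain2[OF disk.DERIV_hyp[OF \<kappa> ab[OF that]] dt], rule DERIV_chain2[OF disk.DERIV_hyp'[OF \<kappa> ab[OF that]] dt])
  have cR: "-1 < cos R" using cos_monotone_0_pi[of R pi] R by simp
  show ?thesis
  proof (rule mu2_zone[where J = "{-1<..<3}" and g = "\<lambda>z. h (?t z)" and g' = "\<lambda>z. h' (?t z) * (- 1 / 2)"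
      and g'' = "\<lambda>z. h'' (?t z) / 4"])
    show "{cos R..cos 0} \<subseteq> {-1<..<3}" using cR by auto
    show "((\<lambda>z. h (?t z)) has_real_derivative h' (?t z) * (- 1 / 2)) (at z)" if "z \<in> {-1<..<3}" for z
      by (rule dh[OF that])
    show "((\<lambda>z. h' (?t z) * (- 1 / 2)) has_real_derivative h'' (?t z) / 4) (at z)" if "z \<in> {-1<..<3}" for z
      using DERIV_cmult_right[OF dh'[OF that], of "- 1 / 2"] by simp
    have "isCont (\<lambda>z. h'' (?t z)) z" if "z \<in> {-1<..<3}" for z
      unfolding h''_def using isCont_o2[where f = ?t and a = z, OF _ disk.isCont_hyp''[OF \<kappa> ab[OF that]]] by simp
    then show "continuous_on {-1<..<3} (\<lambda>z. h'' (?t z) / 4)"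
      by (intro continuous_at_imp_continuous_on ballI continuous_intros) auto
    show "(1 - z\<^sup>2) * (h'' (?t z) / 4) - 4 * z * (h' (?t z) * (- 1 / 2)) = \<kappa> * h (?t z)"
      if "z \<in> {-1<..<3}" for z
    proof -
      have "(1 - z\<^sup>2) * (h'' (?t z) / 4) - 4 * z * (h' (?t z) * (- 1 / 2)) = ?t z * (1 - ?t z) * h'' (?t z) + (2 - (3 + 1) * ?t z) * h' (?t z)"
        by (simp add: field_simps power2_eq_square)
      then show ?thesis using disk.hyp_ode[OF \<kappa> ab[OF that]] by (simp add: h_def h'_def h''_def)
    qed
    show "0 < h (?t z)" if z: "z \<in> {cos R..cos 0}" for z
      unfolding h_def using z cR by (intro disk.hyp_pos[OF \<kappa>]) auto
    show "cos r * h (?t (cos r)) = (1 - (cos r)\<^sup>2) * (h' (?t (cos r)) * (- 1 / 2))"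
      if "r = R \<or> 0 \<noteq> (0::real) \<and> r = 0" for r
    proof -
      have c: "cos r = 1 - 2 * y" using that y by simp
      then have t: "?t (cos r) = y" by simp
      have "cos r * h y = - ((2 * y - 1) * h y)" unfolding c by (simp add: algebra_simps)
      also have "\<dots> = - (2 * y * (1 - y) * h' y)" using cond by (simp add: h_def h'_def)
      also have "\<dots> = (1 - (cos r)\<^sup>2) * (h' y * (- 1 / 2))"
        unfolding c by (simp add: field_simps power2_eq_square)
      finally show ?thesis unfolding t .
    qed
  qed (use q R \<kappa> in auto)
qed

theorem theorem1p2:
  fixes p :: "real^3" and \<Omega>star :: "real \<Rightarrow> (real^3) set"
  assumes "p \<in> S2"
    and "\<And>\<epsilon>. 0 < \<epsilon> \<Longrightarrow> \<epsilon> < pi / 2 \<Longrightarrow> is_geodesic_disk (\<Omega>star \<epsilon>)"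
    and "\<And>\<epsilon>. 0 < \<epsilon> \<Longrightarrow> \<epsilon> < pi / 2 \<Longrightarrow> sphere_area (\<Omega>star \<epsilon>) = sphere_area (annulus p \<epsilon>)"
  shows "(\<lambda>\<epsilon>. mu2 (annulus p \<epsilon>) - mu2 (\<Omega>star \<epsilon>) - 3 * \<epsilon> ^ 4 * \<bar>ln \<epsilon>\<bar>)
           \<in> o[at_right 0](\<lambda>\<epsilon>. \<epsilon> ^ 4 * \<bar>ln \<epsilon>\<bar>)"
proof -
  let ?s = "\<lambda>\<epsilon>::real. 1 - cos \<epsilon>"
  let ?d = "\<lambda>\<epsilon>. mu2 (annulus p \<epsilon>) - mu2 (\<Omega>star \<epsilon>) - (- 6 * (?s \<epsilon>)\<^sup>2 * ln (?s \<epsilon>))"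
  have pos: "eventually (\<lambda>\<epsilon>::real. 0 < \<epsilon>) (at_right 0)" "eventually (\<lambda>\<epsilon>::real. \<epsilon> < pi / 2) (at_right 0)"
    by (auto intro: eventually_at_right_less eventually_at_rightI[of 0 "pi / 2"])
  note ev = eventually_compose_filterlim[OF annulus_bracket one_minus_cos_at_right]
    eventually_compose_filterlim[OF disk_bracket one_minus_cos_at_right]
  \<comment> \<open>The terms linear in \<open>?s \<epsilon>\<close> cancel, and 2000 is the sum of
    the two bracket errors.\<close>
  have "eventually (\<lambda>\<epsilon>. \<bar>?d \<epsilon>\<bar> \<le> 2000 * (?s \<epsilon>)\<^sup>2) (at_right 0)"
    using pos ev
  proof eventually_elim
    case (elim \<epsilon>)
    obtain k where k: "0 \<le> k" "k \<le> 1 / 4" "\<bar>4 * k - (6 * ?s \<epsilon> - 6 * (?s \<epsilon>)\<^sup>2 * ln (?s \<epsilon>))\<bar> \<le> 1000 * (?s \<epsilon>)\<^sup>2"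
      "hyp (1/2) (3/2) k ((cos \<epsilon>)\<^sup>2) = 2 * (1 - (cos \<epsilon>)\<^sup>2) * hyp' (1/2) (3/2) k ((cos \<epsilon>)\<^sup>2)"
      using elim(3) by auto
    obtain l where l: "0 \<le> l" "l \<le> 1" "\<bar>l - (6 * ?s \<epsilon> - 12 * (?s \<epsilon>)\<^sup>2 * ln (?s \<epsilon>))\<bar> \<le> 1000 * (?s \<epsilon>)\<^sup>2"
      "(2 * cos \<epsilon> - 1) * hyp 2 3 l (cos \<epsilon>) = 2 * cos \<epsilon> * (1 - cos \<epsilon>) * hyp' 2 3 l (cos \<epsilon>)"
      using elim(4) by auto
    have A: "mu2 (annulus p \<epsilon>) = 2 - 4 * k"
      using assms(1) elim k by (intro mu2_annulus) auto
    obtain q R where q: "q \<in> S2" "0 < R" "R < pi" "\<Omega>star \<epsilon> = {x \<in> S2. geodesic_dist q x < R}"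
      using assms(2)[OF elim(1,2)] unfolding is_geodesic_disk_def by blast
    have \<Omega>: "\<Omega>star \<epsilon> = zone q 0 R" using q disk_eq_zone by simp
    \<comment> \<open>Equality of areas; it identifies the variable \<open>y\<close> of
      \<open>mu2_disk\<close> at the boundary as \<open>cos \<epsilon>\<close>, the point
      \<open>1 - s\<close> of \<open>disk_bracket\<close>.\<close>
    have "2 * pi * (cos 0 - cos R) = 2 * pi * (cos \<epsilon> - cos (pi - \<epsilon>))"
      using assms(3)[OF elim(1,2)] q elim
      by (simp add: \<Omega> annulus_eq_zone[OF assms(1)] sphere_area_zone[OF assms(1)] sphere_area_zone[OF q(1)])
    then have "cos R = 1 - 2 * cos \<epsilon>" by simp
    then have D: "mu2 (\<Omega>star \<epsilon>) = 2 - l"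
      unfolding \<Omega> using q l by (intro mu2_disk[where y = "cos \<epsilon>"]) auto
    show ?case unfolding A D using k(3) l(3) by linarith
  qed
  then have "?d \<in> O[at_right 0](\<lambda>\<epsilon>. (?s \<epsilon>)\<^sup>2)"
    by (intro bigoI[of _ 2000]) simp
  then have "?d \<in> o[at_right 0](\<lambda>\<epsilon>. \<epsilon> ^ 4 * \<bar>ln \<epsilon>\<bar>)"
    using remainder_asymp by (rule landau_o.big_small_trans)
  moreover have "(\<lambda>\<epsilon>. mu2 (annulus p \<epsilon>) - mu2 (\<Omega>star \<epsilon>) - 3 * \<epsilon> ^ 4 * \<bar>ln \<epsilon>\<bar>)
      = (\<lambda>\<epsilon>. ?d \<epsilon> + (- 6 * (?s \<epsilon>)\<^sup>2 * ln (?s \<epsilon>) - 3 * \<epsilon> ^ 4 * \<bar>ln \<epsilon>\<bar>))"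
    by (simp add: fun_eq_iff)
  ultimately show ?thesis using main_term_asymp by (simp only: sum_in_smallo)
qed

end
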